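(* Let $n\ge 2$, let $D$ and $D'$ be two proper subdomains of $\mathbb{R}^n$, and let $f:D\to f(D)=D'$ be a homeomorphism which is an isometry of $(D,\lambda_D)$ onto $(D',\lambda_{D'})$, i.e. $\lambda_{D'}(f(x),f(y))=\lambda_D(x,y)$ for all $x,y\in D$ with $x\ne y$. Then $f$ is quasiconformal with linear dilatation $H(f)\le 256$.
   Context: $\overline{\mathbb{R}^n}=\mathbb{R}^n\cup\{\infty\}$; boundaries of domains are taken in $\overline{\mathbb{R}^n}$. For a family $\Gamma$ of curves, $M(\Gamma)$ denotes its conformal modulus, $M(\Gamma)=\inf_\rho\int_{\mathbb{R}^n}\rho^n\,dm_n$, where the infimum is over all nonnegative Borel functions $\rho$ with $\int_\gamma\rho\,ds\ge1$ for every locally rectifiable $\gamma\in\Gamma$. For sets $E,F,D$, $\Delta(E,F;D)$ is the family of all curves joining $E$ to $F$ in $D$. For a proper subdomain $D$ of $\mathbb{R}^n$ and distinct $x,y\in D$, $$\lambda_D(x,y)=\inf_{C_x,C_y}M(\Delta(C_x,C_y;D)),$$ where the infimum is over all pairs of curves $C_x,C_y$ in $D$ such that $C_z$ (for $z=x,y$) joins $z$ to the boundary of $D$; that is, $C_z=\gamma_z([0,1))\subset D$ with $\gamma_z$ continuous, $\gamma_z(0)=z$ and $\gamma_z(t)\to\partial D$ as $t\to1$. The linear dilatation of a homeomorphism $f$ at $x$ is $$H(x,f)=\limsup_{r\to0+,\ |x-y|=|x-z|=r}\frac{|f(x)-f(y)|}{|f(x)-f(z)|}.$$ The homeomorphism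 $f:D\to D'$ is quasiconformal (metric definition) if $H(x,f)$ is bounded on $D$; $H(f)\le c$ means $H(x,f)\le c$ for every $x\in D$. *)

theory Defs
  imports "HOL-Analysis.Analysis"
begin

definition proper_subdomain :: "('a::real_normed_vector) set \<Rightarrow> bool" where
  "proper_subdomain D \<longleftrightarrow> open D \<and> connected D \<and> D \<noteq> {} \<and> D \<noteq> UNIV"

definition curve_length :: "(real \<Rightarrow> 'a::real_normed_vector) \<Rightarrow> real \<Rightarrow> real \<Rightarrow> ennreal" where
  "curve_length \<gamma> a b =
     (SUP d\<in>{d. d division_of {a..b}}. \<Sum>k\<in>d. ennreal (norm (\<gamma> (Sup k) - \<gamma> (Inf k))))"

(* Curves are parametrised on the compact interval {0..1}, where locally rectifiable
   and rectifiable mean the same. *)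
definition rectifiable :: "(real \<Rightarrow> 'a::real_normed_vector) \<Rightarrow> bool" where
  "rectifiable \<gamma> \<longleftrightarrow> curve_length \<gamma> 0 1 < \<infinity>"

(* The curve reparametrised by arc length, meaningful for u between 0 and the length of \<gamma>.
   The choice of t is irrelevant, since \<gamma> is constant where its length function is. *)
definition arc_length_param :: "(real \<Rightarrow> 'a::real_normed_vector) \<Rightarrow> real \<Rightarrow> 'a" where
  "arc_length_param \<gamma> u = \<gamma> (SOME t. t \<in> {0..1} \<and> curve_length \<gamma> 0 t = ennreal u)"

definition line_integral ::
    "('a::real_normed_vector \<Rightarrow> ennreal) \<Rightarrow> (real \<Rightarrow> 'a) \<Rightarrow> ennreal" where
  "line_integral \<rho> \<gamma> =
     (\<integral>\<^sup>+u\<in>{0..enn2real (curve_length \<gamma> 0 1)}. \<rho> (arc_length_param \<gamma> u) \<partial>lborel)"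

definition admissible ::
    "(real \<Rightarrow> 'a::real_normed_vector) set \<Rightarrow> ('a \<Rightarrow> ennreal) \<Rightarrow> bool" where
  "admissible \<Gamma> \<rho> \<longleftrightarrow>
     \<rho> \<in> borel_measurable borel \<and> (\<forall>\<gamma>\<in>\<Gamma>. rectifiable \<gamma> \<longrightarrow> 1 \<le> line_integral \<rho> \<gamma>)"

definition modulus :: "(real \<Rightarrow> real ^ 'n) set \<Rightarrow> ennreal" where
  "modulus \<Gamma> = (INF \<rho>\<in>{\<rho>. admissible \<Gamma> \<rho>}. \<integral>\<^sup>+x. \<rho> x ^ CARD('n) \<partial>lborel)"

definition joining_curves ::
    "'a::topological_space set \<Rightarrow> 'a set \<Rightarrow> 'a set \<Rightarrow> (real \<Rightarrow> 'a) set" where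
  "joining_curves E F D =
     {\<gamma>. path \<gamma> \<and> pathstart \<gamma> \<in> E \<and> pathfinish \<gamma> \<in> F \<and> \<gamma> ` {0<..<1} \<subseteq> D}"

(* The extended space adds the point at infinity, None; so None belongs to the boundary of D
   exactly if D is unbounded. *)
abbreviation extended_space :: "'a::topological_space option topology" where
  "extended_space \<equiv> Alexandroff_compactification euclidean"

definition extended_boundary :: "'a::topological_space set \<Rightarrow> 'a option set" where
  "extended_boundary D = extended_space frontier_of (Some ` D)"

(* Convergence to the boundary as a set: \<gamma> t is eventually in every neighbourhood of it,
   without having to converge to a single boundary point. The boundary being compact, this is
   convergence to 0 of the spherical distance to it. *)
definition tends_to_boundary :: "(real \<Rightarrow> 'a::topological_space) \<Rightarrow> 'a set \<Rightarrow> bool" where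
  "tends_to_boundary \<gamma> D \<longleftrightarrow>
     (\<forall>U. openin extended_space U \<longrightarrow> extended_boundary D \<subseteq> U \<longrightarrow>
        (\<forall>\<^sub>F t in at_left 1. Some (\<gamma> t) \<in> U))"

definition curves_to_boundary :: "'a::topological_space set \<Rightarrow> 'a \<Rightarrow> 'a set set" where
  "curves_to_boundary D z =
     {\<gamma> ` {0..<1} | \<gamma>. continuous_on {0..<1} \<gamma> \<and> \<gamma> ` {0..<1} \<subseteq> D \<and> \<gamma> 0 = z \<and>
                     tends_to_boundary \<gamma> D}"

definition lambda_mod :: "(real ^ 'n) set \<Rightarrow> real ^ 'n \<Rightarrow> real ^ 'n \<Rightarrow> ennreal" where
  "lambda_mod D x y =
     (INF (Cx, Cy)\<in>curves_to_boundary D x \<times> curves_to_boundary D y.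
        modulus (joining_curves Cx Cy D))"

(* For x in an open domain of f, the values of f outside the domain do not matter, since small
   spheres about x lie in the domain. *)
definition linear_dilatation ::
    "('a::real_normed_vector \<Rightarrow> 'b::real_normed_vector) \<Rightarrow> 'a \<Rightarrow> ereal" where
  "linear_dilatation f x =
     Limsup (at_right 0) (\<lambda>r. SUP (y, z)\<in>sphere x r \<times> sphere x r.
       ereal (norm (f x - f y) / norm (f x - f z)))"

definition quasiconformal ::
    "('a::real_normed_vector) set \<Rightarrow> ('b::real_normed_vector) set \<Rightarrow> ('a \<Rightarrow> 'b) \<Rightarrow> bool" where
  "quasiconformal D D' f \<longleftrightarrow>
     (\<exists>g. homeomorphism D D' f g) \<and> (\<exists>c::real. \<forall>x\<in>D. linear_dilatation f x \<le> ereal c)"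

end

theory Submission
  imports Defs "HOL-Real_Asymp.Real_Asymp"
begin

text \<open>For \<open>y\<close> close to \<open>x\<close>, put \<open>r = dist x y\<close> and let \<open>d\<close> be the distance of \<open>x\<close> to the complement of
  \<open>D\<close>. Then \<open>c * ln (2 * d / r - 1) \<le> lambda_mod D x y \<le> c * ln (31 * d / r)\<close>, where \<open>c\<close> depends only
  on the dimension. The lower bound is the spherical cap inequality on the spheres about the midpoint
  of \<open>x\<close> and \<open>y\<close> which meet both curves. For the upper bound, one curve runs from \<open>x\<close> to a
  nearest boundary point and the other one from \<open>y\<close> to infinity; both are logarithmic spirals about \<open>x\<close>
  whose common axis turns slowly enough, with the logarithm of the radius, not to affect the leading
  terms. At scale \<open>r\<close> the two curves look like the rays left of a line when an open segment is removed,
  and so they do at scale \<open>d\<close> after an inversion; the test function is glued from the two explicit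
  potentials, functions of one prolate spheroidal coordinate, at the radius \<open>sqrt (r * d)\<close>. Both
  estimates hold in \<open>D\<close> and in \<open>D'\<close> with the same constants, so \<open>dist (f x) (f y)\<close> equals \<open>d' * r / d\<close>
  up to a factor of 16, where \<open>d'\<close> is the distance of \<open>f x\<close> to the complement of \<open>D'\<close>.\<close>

subsection \<open>Length of curves\<close>

definition chord_sum :: "(real \<Rightarrow> 'a::real_normed_vector) \<Rightarrow> real set set \<Rightarrow> ennreal" where
  "chord_sum \<gamma> d = (\<Sum>k\<in>d. ennreal (norm (\<gamma> (Sup k) - \<gamma> (Inf k))))"

abbreviation clip :: "real \<Rightarrow> real \<Rightarrow> real \<Rightarrow> real" where
  "clip u v t \<equiv> max u (min t v)"

lemma division_real_interval:
  assumes "d division_of {a..b::real}" "k \<in> d"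
  shows "k = {Inf k..Sup k}" "Inf k \<le> Sup k" "a \<le> Inf k" "Sup k \<le> b"
proof -
  obtain u v where k: "k = cbox u v" and "k \<noteq> {}" and sub: "k \<subseteq> {a..b}"
    using division_ofD(2,3,4)[OF assms(1)] assms(2) by metis
  then have "u \<le> v" by auto
  with k have "Inf k = u" "Sup k = v" by auto
  with k sub \<open>u \<le> v\<close> show "k = {Inf k..Sup k}" "Inf k \<le> Sup k" "a \<le> Inf k" "Sup k \<le> b" by auto
qed

lemma division_member_inter_Icc:
  assumes d: "d division_of {a..b::real}" "k \<in> d" and "u \<le> v" "{u..v} \<inter> k \<noteq> {}"
  shows "{u..v} \<inter> k = {clip u v (Inf k)..clip u v (Sup k)}"
    "clip u v (Inf k) \<le> clip u v (Sup k)"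
proof -
  note bounds = division_real_interval[OF d]
  have "u \<le> Sup k" "Inf k \<le> v" using assms(4) by (subst (asm) bounds(1), force)+
  then have "{u..v} \<inter> {Inf k..Sup k} = {clip u v (Inf k)..clip u v (Sup k)}"
    using bounds(2) \<open>u \<le> v\<close> by (auto simp: max_def min_def)
  then show "{u..v} \<inter> k = {clip u v (Inf k)..clip u v (Sup k)}" using bounds(1) by metis
  show "clip u v (Inf k) \<le> clip u v (Sup k)" using bounds(2) by auto
qed

lemma division_member_disjoint_Icc:
  assumes d: "d division_of {a..b::real}" "k \<in> d" and "u \<le> v" "{u..v} \<inter> k = {}"
  shows "clip u v (Sup k) = clip u v (Inf k)"
proof -
  note bounds = division_real_interval[OF d]
  have "Sup k < u \<or> v < Inf k" using assms(4) bounds(2) \<open>u \<le> v\<close> by (subst (asm) bounds(1)) auto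
  then show ?thesis using bounds(2) \<open>u \<le> v\<close> by auto
qed

lemma chord_sum_le_curve_length: "d division_of {a..b} \<Longrightarrow> chord_sum \<gamma> d \<le> curve_length \<gamma> a b"
  unfolding curve_length_def chord_sum_def by (intro SUP_upper) auto

lemma curve_length_least:
  "(\<And>d. d division_of {a..b} \<Longrightarrow> chord_sum \<gamma> d \<le> B) \<Longrightarrow> curve_length \<gamma> a b \<le> B"
  unfolding curve_length_def chord_sum_def by (intro SUP_least) auto

lemma curve_length_nearly_attained:
  assumes "curve_length \<gamma> a b < \<infinity>" "0 < \<epsilon>" "a \<le> b"
  obtains d where "d division_of {a..b}" "curve_length \<gamma> a b \<le> chord_sum \<gamma> d + ennreal \<epsilon>"
proof -
  have nonempty: "{d. d division_of {a..b}} \<noteq> {}"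
    using assms(3) division_of_self[of a b] by auto
  have "\<exists>d\<in>{d. d division_of {a..b}}. curve_length \<gamma> a b < chord_sum \<gamma> d + ennreal \<epsilon>"
    unfolding chord_sum_def using assms(1)
    by (intro SUP_approx_ennreal[OF assms(2) nonempty curve_length_def]) simp
  then show thesis using that by (auto intro: less_imp_le)
qed

lemma chord_sum_clip_le:
  assumes d: "d division_of {a..b}" and uv: "a \<le> u" "u \<le> v" "v \<le> b"
  shows "chord_sum (\<lambda>t. \<gamma> (clip u v t)) d \<le> curve_length \<gamma> u v"
proof -
  define d' where "d' = {k \<in> d. {u..v} \<inter> k \<noteq> {}}"
  let ?f = "\<lambda>k. ennreal (norm (\<gamma> (Sup k) - \<gamma> (Inf k)))"
  have clip: "Inf ({u..v} \<inter> k) = clip u v (Inf k)" "Sup ({u..v} \<inter> k) = clip u v (Sup k)"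
    "{u..v} \<inter> k = {clip u v (Inf k)..clip u v (Sup k)}" "clip u v (Inf k) \<le> clip u v (Sup k)" if "k \<in> d'" for k
    using division_member_inter_Icc[OF d _ uv(2), of k] that by (auto simp: d'_def)
  have "chord_sum (\<lambda>t. \<gamma> (clip u v t)) d = (\<Sum>k\<in>d'. ennreal (norm (\<gamma> (clip u v (Sup k)) - \<gamma> (clip u v (Inf k)))))"
    unfolding chord_sum_def
    by (rule sum.mono_neutral_right)
       (use d in \<open>auto simp: d'_def division_member_disjoint_Icc[OF d _ uv(2)]\<close>)
  also have "\<dots> = (\<Sum>k\<in>d'. ?f ({u..v} \<inter> k))"
    using clip by (intro sum.cong) auto
  also have "\<dots> = chord_sum \<gamma> ((\<inter>) {u..v} ` d')"
    unfolding chord_sum_def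
  proof (rule sum.reindex_nontrivial[symmetric, unfolded o_def])
    show "finite d'" using d by (auto simp: d'_def)
    fix k l assume kl: "k \<in> d'" "l \<in> d'" "k \<noteq> l" "{u..v} \<inter> k = {u..v} \<inter> l"
    then have "interior ({u..v} \<inter> k) \<subseteq> interior k \<inter> interior l"
      by (metis Int_lower2 interior_mono le_inf_iff)
    then have "interior ({u..v} \<inter> k) = {}" using division_ofD(5)[OF d _ _ kl(3)] kl(1,2) by (auto simp: d'_def)
    then have "clip u v (Sup k) \<le> clip u v (Inf k)"
      unfolding clip(3)[OF kl(1)] by (simp add: interior_atLeastAtMost_real)
    then have "clip u v (Sup k) = clip u v (Inf k)" using clip(4)[OF kl(1)] by (rule antisym)
    then show "?f ({u..v} \<inter> k) = 0" unfolding clip(1,2)[OF kl(1)] by simp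
  qed
  also have "\<dots> \<le> curve_length \<gamma> u v"
  proof (rule chord_sum_le_curve_length)
    have "(\<inter>) {u..v} ` d' = {cbox u v \<inter> k | k. k \<in> d \<and> cbox u v \<inter> k \<noteq> {}}" by (auto simp: d'_def)
    then show "(\<inter>) {u..v} ` d' division_of {u..v}" using division_inter_1[OF d, of u v] uv by simp
  qed
  finally show ?thesis .
qed

lemma chord_sum_split:
  fixes \<gamma> :: "real \<Rightarrow> 'a::real_normed_vector"
  assumes d: "d division_of {a..b}" and uv: "a \<le> u" "u \<le> v" "v \<le> b"
  shows "chord_sum \<gamma> d \<le> chord_sum (\<lambda>t. \<gamma> (clip a u t)) d +
    (chord_sum (\<lambda>t. \<gamma> (clip u v t)) d + chord_sum (\<lambda>t. \<gamma> (clip v b t)) d)"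
  unfolding chord_sum_def sum.distrib[symmetric]
proof (rule sum_mono)
  fix k assume k: "k \<in> d"
  let ?s = "Sup k" and ?i = "Inf k"
  let ?\<Delta> = "\<lambda>p q. \<gamma> (clip p q ?s) - \<gamma> (clip p q ?i)"
  have telescope: "\<gamma> t = \<gamma> (clip a u t) + (\<gamma> (clip u v t) - \<gamma> u) + (\<gamma> (clip v b t) - \<gamma> v)"
    if "t \<in> {a..b}" for t
    using that uv by (cases "t \<le> u"; cases "t \<le> v") auto
  have regroup: "(x + (y - p) + (z - q)) - (x' + (y' - p) + (z' - q)) = (x - x') + ((y - y') + (z - z'))"
    for x y z x' y' z' p q :: 'a by (simp add: algebra_simps)
  have "?s \<in> {a..b}" "?i \<in> {a..b}" using division_real_interval[OF d k] by auto
  from arg_cong2[of _ _ _ _ minus, OF telescope[OF this(1)] telescope[OF this(2)]]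
  have "\<gamma> ?s - \<gamma> ?i = ?\<Delta> a u + (?\<Delta> u v + ?\<Delta> v b)"
    unfolding regroup .
  then have "norm (\<gamma> ?s - \<gamma> ?i) \<le> norm (?\<Delta> a u) + (norm (?\<Delta> u v) + norm (?\<Delta> v b))"
    by (simp only:) (intro norm_triangle_le add_left_mono norm_triangle_ineq)
  then have "ennreal (norm (\<gamma> ?s - \<gamma> ?i)) \<le> ennreal (norm (?\<Delta> a u) + (norm (?\<Delta> u v) + norm (?\<Delta> v b)))"
    by (rule ennreal_leI)
  also have "\<dots> = ennreal (norm (?\<Delta> a u)) + (ennreal (norm (?\<Delta> u v)) + ennreal (norm (?\<Delta> v b)))"
    by (simp only: ennreal_plus norm_ge_zero add_nonneg_nonneg)
  finally show "ennreal (norm (\<gamma> ?s - \<gamma> ?i)) \<le> \<dots>" .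
qed

lemma norm_diff_le_curve_length:
  assumes "a \<le> b"
  shows "ennreal (norm (\<gamma> b - \<gamma> a)) \<le> curve_length \<gamma> a b"
  using chord_sum_le_curve_length[of "{{a..b}}" a b \<gamma>] assms
  by (simp add: chord_sum_def division_of_self[of a b, simplified])

lemma curve_length_same [simp]: "curve_length \<gamma> a a = 0"
proof -
  have "Sup k = Inf k" if "d division_of {a..a}" "k \<in> d" for d k
    using division_real_interval[OF that] by simp
  then have "curve_length \<gamma> a a \<le> 0" by (intro curve_length_least) (simp add: chord_sum_def)
  then show ?thesis by simp
qed

lemma curve_length_subadditive:
  assumes "a \<le> v" "v \<le> b"
  shows "curve_length \<gamma> a b \<le> curve_length \<gamma> a v + curve_length \<gamma> v b"
proof (rule curve_length_least)
  fix d assume d: "d division_of {a..b}"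
  have "chord_sum \<gamma> d \<le> curve_length \<gamma> a v + (curve_length \<gamma> v b + curve_length \<gamma> b b)"
    using assms by (intro order_trans[OF chord_sum_split[OF d assms order_refl]] add_mono
      chord_sum_clip_le[OF d]) auto
  then show "chord_sum \<gamma> d \<le> curve_length \<gamma> a v + curve_length \<gamma> v b" by simp
qed

lemma curve_length_superadditive:
  assumes "a \<le> v" "v \<le> b"
  shows "curve_length \<gamma> a v + curve_length \<gamma> v b \<le> curve_length \<gamma> a b"
proof -
  have nonempty: "{d. d division_of {x..y::real}} \<noteq> {}" if "x \<le> y" for x y
    using that division_of_self[of x y] by auto
  have union: "chord_sum \<gamma> d + chord_sum \<gamma> e \<le> curve_length \<gamma> a b"
    if d: "d division_of {a..v}" and e: "e division_of {v..b}" for d e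
  proof -
    have "(d \<union> e) division_of ({a..v} \<union> {v..b})"
      by (rule division_disjoint_union[OF d e]) (auto simp: interior_atLeastAtMost_real)
    then have de: "(d \<union> e) division_of {a..b}"
      using assms by (simp add: ivl_disj_un)
    have "Sup k = Inf k" if "k \<in> d \<inter> e" for k
      using division_real_interval(2,4)[OF d, of k] division_real_interval(2,3)[OF e, of k] that by auto
    then have "chord_sum \<gamma> d + chord_sum \<gamma> e = chord_sum \<gamma> (d \<union> e)"
      using d e unfolding chord_sum_def by (subst sum.union_inter[symmetric]) (auto simp: division_of_finite)
    with chord_sum_le_curve_length[OF de] show ?thesis by metis
  qed
  have "chord_sum \<gamma> d + curve_length \<gamma> v b \<le> curve_length \<gamma> a b" if d: "d division_of {a..v}" for d
    unfolding curve_length_def[of \<gamma> v b] chord_sum_def[symmetric] using union[OF d] nonempty[OF assms(2)]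
    by (subst ennreal_SUP_add_right) (auto intro!: SUP_least)
  then show ?thesis
    unfolding curve_length_def[of \<gamma> a v] chord_sum_def[symmetric] using nonempty[OF assms(1)]
    by (subst ennreal_SUP_add_left[symmetric]) (auto intro!: SUP_least)
qed

lemma curve_length_mono:
  assumes "a' \<le> a" "a \<le> b" "b \<le> b'"
  shows "curve_length \<gamma> a b \<le> curve_length \<gamma> a' b'"
proof -
  have "curve_length \<gamma> a b \<le> curve_length \<gamma> a' a + curve_length \<gamma> a b"
    by (simp add: add_increasing)
  also have "\<dots> \<le> curve_length \<gamma> a' b"
    by (rule curve_length_superadditive) fact+
  also have "\<dots> \<le> curve_length \<gamma> a' b + curve_length \<gamma> b b'"
    by (simp add: add_increasing2)
  also have "\<dots> \<le> curve_length \<gamma> a' b'"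
    using assms by (intro curve_length_superadditive) auto
  finally show ?thesis .
qed

lemma curve_length_le_chord_sum_clip:
  assumes d: "d division_of {a..b}" "curve_length \<gamma> a b \<le> chord_sum \<gamma> d + \<epsilon>"
    and fin: "curve_length \<gamma> a b < \<infinity>" and uv: "a \<le> u" "u \<le> v" "v \<le> b"
  shows "curve_length \<gamma> u v \<le> chord_sum (\<lambda>t. \<gamma> (clip u v t)) d + \<epsilon>"
proof -
  let ?L = "curve_length \<gamma>" and ?S = "chord_sum (\<lambda>t. \<gamma> (clip u v t)) d"
  have "?L a u + ?L v b + ?L u v = ?L a u + (?L u v + ?L v b)" by (simp add: ac_simps)
  also have "\<dots> \<le> ?L a u + ?L u b"
    using uv by (intro add_left_mono curve_length_superadditive)
  also have "\<dots> \<le> ?L a b"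
    using uv by (intro curve_length_superadditive) auto
  also have "\<dots> \<le> chord_sum \<gamma> d + \<epsilon>" by (rule d(2))
  also have "\<dots> \<le> (?L a u + (?S + ?L v b)) + \<epsilon>"
    using uv by (intro add_right_mono order_trans[OF chord_sum_split[OF d(1) uv]] add_mono
      chord_sum_clip_le[OF d(1)] order_refl) auto
  also have "\<dots> = ?L a u + ?L v b + (?S + \<epsilon>)" by (simp add: ac_simps)
  finally have "?L a u + ?L v b + ?L u v \<le> ?L a u + ?L v b + (?S + \<epsilon>)" .
  moreover have "?L a u < \<infinity>" "?L v b < \<infinity>"
    using uv fin curve_length_mono[of a a u b \<gamma>] curve_length_mono[of a v b b \<gamma>] by (auto intro: le_less_trans)
  ultimately show ?thesis by (auto simp: ennreal_add_left_cancel_le)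
qed

lemma curve_length_small:
  assumes cont: "continuous_on {a..b} \<gamma>" and fin: "curve_length \<gamma> a b < \<infinity>" and "a \<le> b" "0 < e"
  obtains \<delta> where "0 < \<delta>" "\<And>u v. a \<le> u \<Longrightarrow> u \<le> v \<Longrightarrow> v \<le> b \<Longrightarrow> v - u < \<delta> \<Longrightarrow> curve_length \<gamma> u v \<le> ennreal e"
proof -
  obtain d where d: "d division_of {a..b}" "curve_length \<gamma> a b \<le> chord_sum \<gamma> d + ennreal (e/2)"
    using curve_length_nearly_attained[OF fin, of "e/2"] assms by auto
  define \<eta> where "\<eta> = e / (2 * (real (card d) + 1))"
  have \<eta>: "0 < \<eta>" "real (card d) * \<eta> \<le> e / 2" using \<open>0 < e\<close> by (auto simp: \<eta>_def field_simps)
  obtain \<delta> where \<delta>: "\<delta> > 0" "\<And>s t. s \<in> {a..b} \<Longrightarrow> t \<in> {a..b} \<Longrightarrow> dist s t < \<delta> \<Longrightarrow> dist (\<gamma> s) (\<gamma> t) < \<eta>"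
    using compact_uniformly_continuous[OF cont] \<eta>(1) unfolding uniformly_continuous_on_def
    by (metis compact_Icc dist_commute)
  have "curve_length \<gamma> u v \<le> ennreal e" if uv: "a \<le> u" "u \<le> v" "v \<le> b" "v - u < \<delta>" for u v
  proof -
    have "chord_sum (\<lambda>t. \<gamma> (clip u v t)) d \<le> (\<Sum>k\<in>d. ennreal \<eta>)"
      unfolding chord_sum_def
    proof (intro sum_mono ennreal_leI)
      fix k
      have "clip u v (Sup k) \<in> {u..v}" "clip u v (Inf k) \<in> {u..v}" using uv by auto
      then have "dist (\<gamma> (clip u v (Sup k))) (\<gamma> (clip u v (Inf k))) < \<eta>"
        using uv by (intro \<delta>(2)) (auto simp: dist_real_def)
      then show "norm (\<gamma> (clip u v (Sup k)) - \<gamma> (clip u v (Inf k))) \<le> \<eta>" by (simp add: dist_norm)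
    qed
    also have "\<dots> = ennreal (real (card d) * \<eta>)"
      using \<eta>(1) by (simp add: ennreal_mult ennreal_of_nat_eq_real_of_nat)
    also have "\<dots> \<le> ennreal (e/2)" using \<eta>(2) by (rule ennreal_leI)
    finally have "curve_length \<gamma> u v \<le> ennreal (e/2) + ennreal (e/2)"
      using curve_length_le_chord_sum_clip[OF d fin uv(1-3)] by (meson add_right_mono order_trans)
    then show ?thesis using \<open>0 < e\<close> by (simp add: ennreal_plus[symmetric] del: ennreal_plus)
  qed
  with \<delta>(1) show thesis by (rule that)
qed

lemma continuous_on_curve_length:
  assumes cont: "continuous_on {a..b} \<gamma>" and fin: "curve_length \<gamma> a b < \<infinity>"
  shows "continuous_on {a..b} (\<lambda>t. enn2real (curve_length \<gamma> a t))"
  unfolding continuous_on_iff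
proof (intro ballI allI impI)
  fix t e :: real assume t: "t \<in> {a..b}" and e: "0 < e"
  let ?s = "\<lambda>t. enn2real (curve_length \<gamma> a t)"
  obtain \<delta> where \<delta>: "0 < \<delta>" "\<And>u v. a \<le> u \<Longrightarrow> u \<le> v \<Longrightarrow> v \<le> b \<Longrightarrow> v - u < \<delta> \<Longrightarrow> curve_length \<gamma> u v \<le> ennreal (e/2)"
    using curve_length_small[OF cont fin, of "e/2"] t e by auto
  have increment: "\<bar>?s v - ?s u\<bar> \<le> e/2" if uv: "a \<le> u" "u \<le> v" "v \<le> b" "v - u < \<delta>" for u v
  proof -
    have finite_to: "curve_length \<gamma> a w < \<infinity>" if "a \<le> w" "w \<le> b" for w
      using curve_length_mono[of a a w b \<gamma>] fin that by (auto intro: le_less_trans)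
    have "curve_length \<gamma> a v \<le> curve_length \<gamma> a u + ennreal (e/2)"
      using curve_length_subadditive[OF uv(1,2), of \<gamma>] \<delta>(2)[OF uv] by (meson add_left_mono order_trans)
    also have "\<dots> = ennreal (?s u + e/2)"
      using finite_to[of u] uv e by (simp add: ennreal_enn2real ennreal_plus)
    finally have "?s v \<le> ?s u + e/2" using e by (intro enn2real_leI) auto
    moreover have "?s u \<le> ?s v" using uv finite_to[of v] by (intro enn2real_mono curve_length_mono) auto
    ultimately show ?thesis by simp
  qed
  have "\<bar>?s w - ?s t\<bar> < e" if w: "w \<in> {a..b}" "\<bar>w - t\<bar> < \<delta>" for w
  proof -
    have "\<bar>?s w - ?s t\<bar> \<le> e/2"
    proof (cases "w \<le> t")
      case True
      then have "\<bar>?s t - ?s w\<bar> \<le> e/2" using t w by (intro increment) auto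
      then show ?thesis by (simp only: abs_minus_commute)
    next
      case False
      then show ?thesis using t w by (intro increment) auto
    qed
    then show ?thesis using e by linarith
  qed
  then show "\<exists>\<delta>>0. \<forall>w\<in>{a..b}. dist w t < \<delta> \<longrightarrow> dist (?s w) (?s t) < e"
    using \<delta>(1) by (auto simp: dist_real_def)
qed

subsection \<open>Arc length parametrisation\<close>

lemma arc_length_param_witness:
  assumes "path \<gamma>" "rectifiable \<gamma>" "u \<in> {0..enn2real (curve_length \<gamma> 0 1)}"
  obtains t where "t \<in> {0..1}" "curve_length \<gamma> 0 t = ennreal u" "arc_length_param \<gamma> u = \<gamma> t"
proof -
  have fin: "curve_length \<gamma> 0 1 < \<infinity>" using assms(2) by (simp add: rectifiable_def)
  have "\<exists>t. 0 \<le> t \<and> t \<le> 1 \<and> enn2real (curve_length \<gamma> 0 t) = u"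
    using continuous_on_curve_length[OF _ fin] assms by (intro IVT') (auto simp: path_def)
  then obtain t where t: "0 \<le> t" "t \<le> 1" "enn2real (curve_length \<gamma> 0 t) = u" by auto
  have "curve_length \<gamma> 0 t < \<infinity>"
    using curve_length_mono[OF order_refl t(1,2), of \<gamma>] fin by (auto intro: le_less_trans)
  then have "t \<in> {0..1} \<and> curve_length \<gamma> 0 t = ennreal u"
    using t by (auto simp: ennreal_enn2real)
  then have "(SOME t. t \<in> {0..1} \<and> curve_length \<gamma> 0 t = ennreal u) \<in> {0..1} \<and>
      curve_length \<gamma> 0 (SOME t. t \<in> {0..1} \<and> curve_length \<gamma> 0 t = ennreal u) = ennreal u"
    by (rule someI)
  then show thesis using that by (auto simp: arc_length_param_def)
qed

lemma norm_diff_le_length_diff: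
  assumes "a \<le> s" "s \<le> t" "curve_length \<gamma> a s = ennreal u" "curve_length \<gamma> a t = ennreal v" "0 \<le> u" "0 \<le> v"
  shows "norm (\<gamma> t - \<gamma> s) \<le> v - u"
proof -
  have "ennreal u + ennreal (norm (\<gamma> t - \<gamma> s)) \<le> ennreal v"
    using curve_length_superadditive[OF assms(1,2), of \<gamma>] norm_diff_le_curve_length[OF assms(2), of \<gamma>] assms(3,4)
    by (metis add_left_mono order_trans)
  then show ?thesis using assms by (simp add: ennreal_plus[symmetric] del: ennreal_plus)
qed

lemma arc_length_param_lipschitz:
  assumes "path \<gamma>" "rectifiable \<gamma>"
  shows "1-lipschitz_on {0..enn2real (curve_length \<gamma> 0 1)} (arc_length_param \<gamma>)"
proof (rule lipschitz_onI)
  fix u v assume uv: "u \<in> {0..enn2real (curve_length \<gamma> 0 1)}" "v \<in> {0..enn2real (curve_length \<gamma> 0 1)}"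
  obtain s where s: "s \<in> {0..1}" "curve_length \<gamma> 0 s = ennreal u" "arc_length_param \<gamma> u = \<gamma> s"
    using arc_length_param_witness[OF assms uv(1)] .
  obtain t where t: "t \<in> {0..1}" "curve_length \<gamma> 0 t = ennreal v" "arc_length_param \<gamma> v = \<gamma> t"
    using arc_length_param_witness[OF assms uv(2)] .
  show "dist (arc_length_param \<gamma> u) (arc_length_param \<gamma> v) \<le> 1 * dist u v"
    using norm_diff_le_length_diff[of 0 s t \<gamma> u v] norm_diff_le_length_diff[of 0 t s \<gamma> v u] s t uv
    by (cases "s \<le> t") (auto simp: norm_minus_commute dist_norm)
qed simp

lemma arc_length_param_ends:
  assumes "path \<gamma>" "rectifiable \<gamma>"
  shows "arc_length_param \<gamma> 0 = \<gamma> 0" "arc_length_param \<gamma> (enn2real (curve_length \<gamma> 0 1)) = \<gamma> 1"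
proof -
  obtain s where s: "s \<in> {0..1}" "curve_length \<gamma> 0 s = ennreal 0" "arc_length_param \<gamma> 0 = \<gamma> s"
    using arc_length_param_witness[OF assms, of 0] by auto
  show "arc_length_param \<gamma> 0 = \<gamma> 0"
    using norm_diff_le_length_diff[of 0 0 s \<gamma> 0 0] s by auto
  let ?l = "enn2real (curve_length \<gamma> 0 1)"
  have l: "curve_length \<gamma> 0 1 = ennreal ?l" using assms(2) by (simp add: rectifiable_def ennreal_enn2real)
  obtain t where t: "t \<in> {0..1}" "curve_length \<gamma> 0 t = ennreal ?l" "arc_length_param \<gamma> ?l = \<gamma> t"
    using arc_length_param_witness[OF assms, of ?l] by auto
  show "arc_length_param \<gamma> ?l = \<gamma> 1"
    using norm_diff_le_length_diff[of 0 t 1 \<gamma> ?l ?l] t l by auto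
qed

subsection \<open>Pointwise slopes\<close>

definition slope_le :: "('a::metric_space \<Rightarrow> 'b::metric_space) \<Rightarrow> real \<Rightarrow> 'a \<Rightarrow> 'a set \<Rightarrow> bool" where
  "slope_le u g z S \<longleftrightarrow> (\<forall>\<eta>>0. \<forall>\<^sub>F q in at z within S. dist (u q) (u z) \<le> (g + \<eta>) * dist q z)"

lemma slope_leD:
  assumes "slope_le u g z S" "0 < \<eta>"
  obtains \<delta> where "0 < \<delta>" "\<And>q. q \<in> S \<Longrightarrow> dist q z < \<delta> \<Longrightarrow> dist (u q) (u z) \<le> (g + \<eta>) * dist q z"
proof -
  obtain \<delta> where \<delta>: "0 < \<delta>" "\<forall>q\<in>S. q \<noteq> z \<and> dist q z < \<delta> \<longrightarrow> dist (u q) (u z) \<le> (g + \<eta>) * dist q z"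
    using assms unfolding slope_le_def eventually_at by blast
  then have "dist (u q) (u z) \<le> (g + \<eta>) * dist q z" if "q \<in> S" "dist q z < \<delta>" for q
    using that by (cases "q = z") auto
  with \<delta>(1) show thesis by (rule that)
qed

lemma slope_le_mono:
  assumes "slope_le u g z S" "g \<le> g'"
  shows "slope_le u g' z S"
  unfolding slope_le_def
proof (intro allI impI)
  fix \<eta> :: real assume "0 < \<eta>"
  then have "\<forall>\<^sub>F q in at z within S. dist (u q) (u z) \<le> (g + \<eta>) * dist q z"
    using assms(1) by (simp add: slope_le_def)
  then show "\<forall>\<^sub>F q in at z within S. dist (u q) (u z) \<le> (g' + \<eta>) * dist q z"
    by eventually_elim (meson add_right_mono assms(2) mult_right_mono order_trans zero_le_dist)
qed

lemma slope_le_of_dist_le: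
  assumes "slope_le u g z S" "\<And>q. dist (v q) (v z) \<le> dist (u q) (u z)"
  shows "slope_le v g z S"
  using assms(1) unfolding slope_le_def
  by (auto elim!: eventually_mono intro: order_trans[OF assms(2)])

lemma slope_le_cong:
  assumes "\<forall>\<^sub>F q in nhds z. u q = v q"
  shows "slope_le u g z S \<longleftrightarrow> slope_le v g z S"
proof -
  have "slope_le u g z S" if "slope_le v g z S" "\<forall>\<^sub>F q in nhds z. u q = v q" for u v
    unfolding slope_le_def
  proof (intro allI impI)
    fix \<eta> :: real assume "0 < \<eta>"
    then have "\<forall>\<^sub>F q in at z within S. dist (v q) (v z) \<le> (g + \<eta>) * dist q z"
      using that(1) by (simp add: slope_le_def)
    moreover have "\<forall>\<^sub>F q in at z within S. u q = v q"
      using that(2) by (simp add: eventually_at_filter eventually_mono)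
    ultimately show "\<forall>\<^sub>F q in at z within S. dist (u q) (u z) \<le> (g + \<eta>) * dist q z"
      by eventually_elim (simp add: eventually_nhds_x_imp_x[OF that(2)])
  qed
  from this[of v u] this[of u v] show ?thesis using assms by (auto simp: eq_commute)
qed

lemma slope_le_const: "0 \<le> g \<Longrightarrow> slope_le (\<lambda>_. c) g z S"
  by (simp add: slope_le_def)

lemma slope_le_lipschitz:
  assumes "L-lipschitz_on S u" "z \<in> S"
  shows "slope_le u L z S"
  unfolding slope_le_def eventually_at
proof (intro allI impI exI[of _ 1] conjI ballI)
  fix \<eta> :: real and q assume "0 < \<eta>" "q \<in> S"
  then have "L * dist q z \<le> (L + \<eta>) * dist q z" by (intro mult_right_mono) auto
  then show "dist (u q) (u z) \<le> (L + \<eta>) * dist q z"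
    using lipschitz_onD[OF assms(1) \<open>q \<in> S\<close> assms(2)] by linarith
qed simp

lemma slope_le_has_derivative:
  assumes "(u has_derivative u') (at z within S)" "\<And>h. norm (u' h) \<le> g * norm h"
  shows "slope_le u g z S"
  unfolding slope_le_def
proof (intro allI impI)
  fix \<eta> :: real assume "0 < \<eta>"
  then obtain \<delta> where \<delta>: "\<delta> > 0"
    "\<And>q. q \<in> S \<Longrightarrow> norm (q - z) < \<delta> \<Longrightarrow> norm (u q - u z - u' (q - z)) \<le> \<eta> * norm (q - z)"
    using assms(1) unfolding has_derivative_within_alt by blast
  have "norm (u q - u z) \<le> (g + \<eta>) * norm (q - z)" if "q \<in> S" "norm (q - z) < \<delta>" for q
    using norm_triangle_sub[of "u q - u z" "u' (q - z)"] \<delta>(2)[OF that] assms(2)[of "q - z"]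
    by (simp add: distrib_right)
  then show "\<forall>\<^sub>F q in at z within S. dist (u q) (u z) \<le> (g + \<eta>) * dist q z"
    unfolding eventually_at dist_norm using \<delta>(1) by blast
qed

lemma slope_le_max:
  fixes u v :: "'a::metric_space \<Rightarrow> real"
  assumes "slope_le u g z S" "slope_le v g z S"
  shows "slope_le (\<lambda>q. max (u q) (v q)) g z S"
  unfolding slope_le_def
proof (intro allI impI)
  fix \<eta> :: real assume "0 < \<eta>"
  then have "\<forall>\<^sub>F q in at z within S. dist (u q) (u z) \<le> (g + \<eta>) * dist q z"
    "\<forall>\<^sub>F q in at z within S. dist (v q) (v z) \<le> (g + \<eta>) * dist q z"
    using assms by (auto simp: slope_le_def)
  then show "\<forall>\<^sub>F q in at z within S. dist (max (u q) (v q)) (max (u z) (v z)) \<le> (g + \<eta>) * dist q z"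
    by eventually_elim (simp only: dist_real_def; linarith)
qed

lemma slope_le_diff:
  fixes u v :: "'a::metric_space \<Rightarrow> 'b::real_normed_vector"
  assumes "slope_le u g z S" "slope_le v k z S"
  shows "slope_le (\<lambda>q. u q - v q) (g + k) z S"
  unfolding slope_le_def
proof (intro allI impI)
  fix \<eta> :: real assume "0 < \<eta>"
  then have "\<forall>\<^sub>F q in at z within S. dist (u q) (u z) \<le> (g + \<eta>/2) * dist q z"
    "\<forall>\<^sub>F q in at z within S. dist (v q) (v z) \<le> (k + \<eta>/2) * dist q z"
    using assms unfolding slope_le_def by (meson half_gt_zero)+
  then show "\<forall>\<^sub>F q in at z within S. dist (u q - v q) (u z - v z) \<le> (g + k + \<eta>) * dist q z"
  proof eventually_elim
    case (elim q)
    have "dist (u q - v q) (u z - v z) \<le> dist (u q) (u z) + dist (v q) (v z)"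
      using norm_triangle_ineq4[of "u q - u z" "v q - v z"] by (simp add: dist_norm algebra_simps)
    also have "\<dots> \<le> (g + \<eta>/2) * dist q z + (k + \<eta>/2) * dist q z" by (rule add_mono) fact+
    also have "\<dots> = (g + k + \<eta>) * dist q z" by (simp add: field_simps)
    finally show ?case .
  qed
qed

lemma slope_le_compose_lipschitz:
  assumes u: "slope_le u g (f z) T" and f: "L-lipschitz_on S f" "f ` S \<subseteq> T" and "z \<in> S" "0 \<le> g"
  shows "slope_le (\<lambda>q. u (f q)) (g * L) z S"
  unfolding slope_le_def
proof (intro allI impI)
  fix \<eta> :: real assume \<eta>: "0 < \<eta>"
  have L: "0 \<le> L" using f(1) by (rule lipschitz_on_nonneg)
  define \<theta> where "\<theta> = \<eta> / (L + 1)"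
  have \<theta>: "0 < \<theta>" "\<theta> * L \<le> \<eta>" using \<eta> L by (auto simp: \<theta>_def field_simps)
  obtain \<delta> where \<delta>: "0 < \<delta>" "\<And>p. p \<in> T \<Longrightarrow> dist p (f z) < \<delta> \<Longrightarrow> dist (u p) (u (f z)) \<le> (g + \<theta>) * dist p (f z)"
    using slope_leD[OF u \<theta>(1)] by blast
  have "dist (u (f q)) (u (f z)) \<le> (g * L + \<eta>) * dist q z" if q: "q \<in> S" "dist q z < \<delta> / (L + 1)" for q
  proof -
    have lip: "dist (f q) (f z) \<le> L * dist q z" using lipschitz_onD[OF f(1) q(1) \<open>z \<in> S\<close>] .
    also have "\<dots> \<le> (L + 1) * dist q z" by (simp add: mult_right_mono)
    also have "\<dots> < \<delta>" using q(2) L by (simp add: pos_less_divide_eq mult.commute)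
    finally have "dist (u (f q)) (u (f z)) \<le> (g + \<theta>) * dist (f q) (f z)"
      using \<delta>(2)[of "f q"] f(2) q(1) by blast
    also have "\<dots> \<le> (g + \<theta>) * (L * dist q z)" using lip \<open>0 \<le> g\<close> \<theta>(1) by (intro mult_left_mono) auto
    also have "\<dots> = (g * L + \<theta> * L) * dist q z" by (simp add: algebra_simps)
    also have "\<dots> \<le> (g * L + \<eta>) * dist q z" using \<theta>(2) by (intro mult_right_mono) auto
    finally show ?thesis .
  qed
  moreover have "0 < \<delta> / (L + 1)" using \<delta>(1) L by simp
  ultimately show "\<forall>\<^sub>F q in at z within S. dist (u (f q)) (u (f z)) \<le> (g * L + \<eta>) * dist q z"
    unfolding eventually_at by blast
qed

lemma norm_increment_le_tagged_sum:
  fixes \<phi> :: "real \<Rightarrow> 'a::real_normed_vector"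
  assumes "a \<le> b" and D: "D tagged_division_of {a..b}"
    and bound: "\<And>x K w. (x, K) \<in> D \<Longrightarrow> w \<in> K \<Longrightarrow> norm (\<phi> w - \<phi> x) \<le> L x * \<bar>w - x\<bar>"
  shows "norm (\<phi> b - \<phi> a) \<le> (\<Sum>(x,K)\<in>D. L x * measure lborel K)"
proof -
  have "norm (\<phi> b - \<phi> a) = norm (\<Sum>(x,K)\<in>D. \<phi> (Sup K) - \<phi> (Inf K))"
    using additive_tagged_division_1[OF assms(1) D, of \<phi>] by simp
  also have "\<dots> \<le> (\<Sum>(x,K)\<in>D. L x * measure lborel K)"
  proof (rule sum_norm_le, clarify)
    fix x K assume xK: "(x, K) \<in> D"
    obtain u v where K: "K = cbox u v" using tagged_division_ofD(4)[OF D xK] by auto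
    have uv: "u \<le> x" "x \<le> v" using tagged_division_ofD(2)[OF D xK] K by auto
    then have "u \<in> K" "v \<in> K" using K by auto
    from bound[OF xK this(1)] bound[OF xK this(2)]
    have "norm (\<phi> v - \<phi> u) \<le> L x * \<bar>v - x\<bar> + L x * \<bar>u - x\<bar>"
      using norm_triangle_ineq4[of "\<phi> v - \<phi> x" "\<phi> u - \<phi> x"] by simp
    also have "\<dots> = L x * measure lborel K" using K uv by (simp add: algebra_simps)
    finally show "norm (\<phi> (Sup K) - \<phi> (Inf K)) \<le> L x * measure lborel K" using K uv by simp
  qed
  finally show ?thesis .
qed

lemma norm_increment_le_has_integral:
  fixes \<phi> :: "real \<Rightarrow> 'a::real_normed_vector"
  assumes ab: "a \<le> b" and int: "(g has_integral I) {a..b}"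
    and slope: "\<And>v. v \<in> {a..b} \<Longrightarrow> slope_le \<phi> (g v) v {a..b}"
  shows "norm (\<phi> b - \<phi> a) \<le> I"
proof (rule field_le_epsilon)
  fix e :: real assume e: "0 < e"
  define \<epsilon> where "\<epsilon> = e / (2 * (b - a + 1))"
  have \<epsilon>: "0 < \<epsilon>" "\<epsilon> * (b - a) \<le> e / 2" using e ab by (auto simp: \<epsilon>_def field_simps)
  obtain G where G: "gauge G" "\<And>D. D tagged_division_of cbox a b \<Longrightarrow> G fine D \<Longrightarrow>
      norm ((\<Sum>(x,k)\<in>D. measure lborel k *\<^sub>R g x) - I) < e/2"
    using int[folded cbox_interval, unfolded has_integral, rule_format, of "e/2"] e by auto
  have "\<exists>\<delta>>0. \<forall>w\<in>{a..b}. dist w v < \<delta> \<longrightarrow> norm (\<phi> w - \<phi> v) \<le> (g v + \<epsilon>) * \<bar>w - v\<bar>" if "v \<in> {a..b}" for v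
    using slope_leD[OF slope[OF that] \<epsilon>(1)] unfolding dist_norm real_norm_def by metis
  then obtain \<delta> where \<delta>: "\<And>v. v \<in> {a..b} \<Longrightarrow> 0 < \<delta> v"
    "\<And>v w. v \<in> {a..b} \<Longrightarrow> w \<in> {a..b} \<Longrightarrow> dist w v < \<delta> v \<Longrightarrow> norm (\<phi> w - \<phi> v) \<le> (g v + \<epsilon>) * \<bar>w - v\<bar>"
    by metis
  define r where "r v = (if v \<in> {a..b} then \<delta> v else 1)" for v
  have "gauge (\<lambda>x. G x \<inter> ball x (r x))"
    using G(1) \<delta>(1) by (intro gauge_Int gauge_ball_dependent) (auto simp: r_def)
  then obtain D where D: "D tagged_division_of {a..b}" "(\<lambda>x. G x \<inter> ball x (r x)) fine D"
    using fine_division_exists_real by blast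
  have "norm (\<phi> b - \<phi> a) \<le> (\<Sum>(x,K)\<in>D. (g x + \<epsilon>) * measure lborel K)"
  proof (rule norm_increment_le_tagged_sum[OF ab D(1)])
    fix x K w assume xK: "(x, K) \<in> D" and "w \<in> K"
    moreover have "x \<in> {a..b}" "K \<subseteq> {a..b}" using tagged_division_ofD(2,3)[OF D(1) xK] by auto
    moreover have "K \<subseteq> ball x (r x)" using D(2) xK by (auto simp: fine_def)
    ultimately show "norm (\<phi> w - \<phi> x) \<le> (g x + \<epsilon>) * \<bar>w - x\<bar>"
      by (intro \<delta>(2)) (auto simp: r_def dist_commute)
  qed
  also have "\<dots> = (\<Sum>(x,K)\<in>D. measure lborel K *\<^sub>R g x) + \<epsilon> * (\<Sum>(x,K)\<in>D. measure lborel K)"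
    by (simp add: sum.distrib sum_distrib_left split_def algebra_simps)
  also have "(\<Sum>(x,K)\<in>D. measure lborel K) = b - a"
    using additive_content_tagged_division[of D a b] D(1) ab by simp
  also have "(\<Sum>(x,K)\<in>D. measure lborel K *\<^sub>R g x) \<le> I + e / 2"
  proof -
    have "norm ((\<Sum>(x,K)\<in>D. measure lborel K *\<^sub>R g x) - I) < e/2"
      using D by (intro G(2)) (simp_all only: cbox_interval fine_Int)
    then show ?thesis unfolding real_norm_def by linarith
  qed
  finally show "norm (\<phi> b - \<phi> a) \<le> I + e" using \<epsilon>(2) by linarith
qed

lemma norm_increment_le_nn_integral:
  fixes \<phi> :: "real \<Rightarrow> 'a::real_normed_vector"
  assumes ab: "a \<le> b" and meas: "(\<lambda>v. ennreal (g v) * indicator {a..b} v) \<in> borel_measurable borel"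
    and nonneg: "\<And>v. 0 \<le> g v" and slope: "\<And>v. v \<in> {a..b} \<Longrightarrow> slope_le \<phi> (g v) v {a..b}"
  shows "ennreal (norm (\<phi> b - \<phi> a)) \<le> (\<integral>\<^sup>+v\<in>{a..b}. ennreal (g v) \<partial>lborel)"
proof (cases "(\<integral>\<^sup>+v\<in>{a..b}. ennreal (g v) \<partial>lborel) < \<infinity>")
  case True
  have eq: "ennreal (g v) * indicator {a..b} v = ennreal (indicator {a..b} v *\<^sub>R g v)" for v
    by (auto simp: indicator_def)
  have "(\<lambda>v. enn2real (ennreal (indicator {a..b} v *\<^sub>R g v))) \<in> borel_measurable borel"
    using meas unfolding eq by measurable
  then have "(\<lambda>v. indicator {a..b} v *\<^sub>R g v) \<in> borel_measurable borel"
    using nonneg by simp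
  then have int: "set_integrable lborel {a..b} g"
    unfolding set_integrable_def using True nonneg by (intro integrableI_nonneg) (auto simp: eq)
  have "(g has_integral (LINT v:{a..b}|lborel. g v)) {a..b}"
    using set_borel_integral_eq_integral[OF int] by (simp add: has_integral_iff)
  then have "norm (\<phi> b - \<phi> a) \<le> (LINT v:{a..b}|lborel. g v)"
    by (rule norm_increment_le_has_integral[OF ab _ slope])
  also have "ennreal \<dots> = (\<integral>\<^sup>+v\<in>{a..b}. ennreal (g v) \<partial>lborel)"
    unfolding set_lebesgue_integral_def eq
    using int nonneg by (intro nn_integral_eq_integral[symmetric]) (auto simp: set_integrable_def)
  finally show ?thesis by (simp add: ennreal_leI)
next
  case False
  then show ?thesis by (simp add: less_top[symmetric])
qed

subsection \<open>Line integrals\<close>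

lemma borel_measurable_compose_indicator:
  fixes \<rho> :: "'a::euclidean_space \<Rightarrow> ennreal" and \<gamma> :: "real \<Rightarrow> 'a"
  assumes [measurable]: "\<rho> \<in> borel_measurable borel" and A[measurable]: "A \<in> sets borel" and "continuous_on A \<gamma>"
  shows "(\<lambda>v. \<rho> (\<gamma> v) * indicator A v) \<in> borel_measurable borel"
proof -
  have [measurable]: "(\<lambda>v. indicator A v *\<^sub>R \<gamma> v) \<in> borel_measurable borel"
    using assms by (intro borel_measurable_continuous_on_indicator) auto
  have "(\<lambda>v. \<rho> (\<gamma> v) * indicator A v) = (\<lambda>v. \<rho> (indicator A v *\<^sub>R \<gamma> v) * indicator A v)"
    by (auto simp: indicator_def)
  then show ?thesis by simp
qed

lemma line_integral_ge_of_slope_le: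
  fixes u :: "'a::euclidean_space \<Rightarrow> 'b::real_normed_vector" and \<rho> :: "'a \<Rightarrow> real"
  assumes \<gamma>: "path \<gamma>" "rectifiable \<gamma>" and meas: "\<rho> \<in> borel_measurable borel" and nonneg: "\<And>p. 0 \<le> \<rho> p"
    and slope: "\<And>p. slope_le u (\<rho> p) p UNIV"
  shows "ennreal (norm (u (\<gamma> 1) - u (\<gamma> 0))) \<le> line_integral (\<lambda>p. ennreal (\<rho> p)) \<gamma>"
proof -
  let ?l = "enn2real (curve_length \<gamma> 0 1)" and ?G = "arc_length_param \<gamma>"
  note lip = arc_length_param_lipschitz[OF \<gamma>]
  have "ennreal (norm (u (?G ?l) - u (?G 0))) \<le> (\<integral>\<^sup>+v\<in>{0..?l}. ennreal (\<rho> (?G v)) \<partial>lborel)"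
  proof (rule norm_increment_le_nn_integral[where \<phi> = "\<lambda>v. u (?G v)"])
    show "(\<lambda>v. ennreal (\<rho> (?G v)) * indicator {0..?l} v) \<in> borel_measurable borel"
      using meas by (intro borel_measurable_compose_indicator[where \<gamma> = ?G] lipschitz_on_continuous_on[OF lip]) auto
    show "slope_le (\<lambda>v. u (?G v)) (\<rho> (?G v)) v {0..?l}" if "v \<in> {0..?l}" for v
      using slope_le_compose_lipschitz[OF slope lip _ that nonneg] by simp
  qed (use nonneg in auto)
  then show ?thesis by (simp add: arc_length_param_ends[OF \<gamma>] line_integral_def)
qed

text \<open>Truncating \<open>u\<close> at the levels \<open>\<eta>\<close> and \<open>1 - \<eta>\<close> makes its slope vanish outside \<open>{0 < u < 1}\<close>,
  the only place where \<open>\<rho>\<close> controls it.\<close>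

lemma line_integral_ge_one:
  fixes u \<rho> :: "'a::euclidean_space \<Rightarrow> real"
  assumes \<gamma>: "path \<gamma>" "rectifiable \<gamma>" "u (\<gamma> 0) = 1" "u (\<gamma> 1) = 0"
    and cont: "continuous_on UNIV u" and meas: "\<rho> \<in> borel_measurable borel" and nonneg: "\<And>p. 0 \<le> \<rho> p"
    and slope: "\<And>p. 0 < u p \<Longrightarrow> u p < 1 \<Longrightarrow> slope_le u (\<rho> p) p UNIV"
  shows "1 \<le> line_integral (\<lambda>p. ennreal (\<rho> p)) \<gamma>"
proof (rule ccontr)
  assume "\<not> ?thesis"
  then obtain x where x: "line_integral (\<lambda>p. ennreal (\<rho> p)) \<gamma> = ennreal x" "0 \<le> x" "x < 1"
    by (cases "line_integral (\<lambda>p. ennreal (\<rho> p)) \<gamma>") auto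
  define \<eta> where "\<eta> = (1 - x) / 4"
  have \<eta>: "0 < \<eta>" "\<eta> < 1/2" "x < 1 - 2 * \<eta>" using x by (auto simp: \<eta>_def field_simps)
  define v where "v p = clip \<eta> (1 - \<eta>) (u p)" for p
  have "slope_le v (\<rho> p) p UNIV" for p
  proof -
    have "(u \<longlongrightarrow> u p) (nhds p)"
      using cont by (metis UNIV_I continuous_on_eq_continuous_at isCont_def open_UNIV tendsto_at_iff_tendsto_nhds)
    note near = order_tendstoD[OF this]
    consider (low) "u p < \<eta>" | (high) "1 - \<eta> < u p" | (between) "\<eta> \<le> u p" "u p \<le> 1 - \<eta>" by linarith
    then show ?thesis
    proof cases
      case low
      have "\<forall>\<^sub>F q in nhds p. v q = \<eta>"
        using near(2)[OF low] by eventually_elim (simp add: v_def)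
      then show ?thesis using slope_le_const[OF nonneg] by (subst slope_le_cong)
    next
      case high
      have "\<forall>\<^sub>F q in nhds p. v q = 1 - \<eta>"
        using near(1)[OF high] by eventually_elim (use \<eta> in \<open>simp add: v_def\<close>)
      then show ?thesis using slope_le_const[OF nonneg] by (subst slope_le_cong)
    next
      case between
      then have "slope_le u (\<rho> p) p UNIV" using \<eta> by (intro slope) auto
      then show ?thesis by (rule slope_le_of_dist_le) (auto simp: v_def dist_real_def)
    qed
  qed
  from line_integral_ge_of_slope_le[OF \<gamma>(1,2) meas nonneg this]
  have "ennreal (1 - 2 * \<eta>) \<le> ennreal x" using \<gamma>(3,4) \<eta> x(1) by (simp add: v_def)
  then show False using x \<eta> by simp
qed

subsection \<open>Curves of constant speed\<close>

lemma lipschitz_on_vector_derivative_le: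
  fixes \<gamma> :: "real \<Rightarrow> 'a::banach"
  assumes cont: "continuous_on {a..b} \<gamma>" and S: "finite S" and l: "0 \<le> l"
    and deriv: "\<And>t. t \<in> {a<..<b} - S \<Longrightarrow> (\<gamma> has_vector_derivative \<gamma>' t) (at t)"
    and bound: "\<And>t. t \<in> {a<..<b} - S \<Longrightarrow> norm (\<gamma>' t) \<le> l"
  shows "l-lipschitz_on {a..b} \<gamma>"
proof -
  have "norm (\<gamma> v - \<gamma> u) \<le> l * (v - u)" if uv: "a \<le> u" "u \<le> v" "v \<le> b" for u v
  proof -
    have "(\<gamma>' has_integral \<gamma> v - \<gamma> u) {u..v}"
      using uv by (intro fundamental_theorem_of_calculus_interior_strong[OF S] deriv
        continuous_on_subset[OF cont]) auto
    then have "norm (\<gamma> v - \<gamma> u) \<le> l * measure lborel {u..v}"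
      using S uv bound by (intro has_integral_bound_real[OF l, of "insert u (insert v S)"]) auto
    then show ?thesis using uv by simp
  qed
  then have "dist (\<gamma> u) (\<gamma> v) \<le> l * dist u v" if "u \<in> {a..b}" "v \<in> {a..b}" for u v
    using that by (cases "u \<le> v") (force simp: dist_norm norm_minus_commute)+
  then show ?thesis using l by (rule lipschitz_onI)
qed

lemma curve_length_le_lipschitz:
  assumes lip: "l-lipschitz_on {a..b} \<gamma>" and "a \<le> b"
  shows "curve_length \<gamma> a b \<le> ennreal (l * (b - a))"
proof (rule curve_length_least)
  have l: "0 \<le> l" using lip by (rule lipschitz_on_nonneg)
  fix d assume d: "d division_of {a..b}"
  have "chord_sum \<gamma> d \<le> (\<Sum>k\<in>d. ennreal (l * measure lborel k))"
    unfolding chord_sum_def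
  proof (intro sum_mono ennreal_leI)
    fix k assume k: "k \<in> d"
    note bounds = division_real_interval[OF d k]
    have "measure lborel k = Sup k - Inf k" using bounds(1,2) by (metis content_real)
    with bounds lipschitz_onD[OF lip, of "Sup k" "Inf k"]
    show "norm (\<gamma> (Sup k) - \<gamma> (Inf k)) \<le> l * measure lborel k" by (simp add: dist_norm)
  qed
  also have "\<dots> = ennreal (l * (\<Sum>k\<in>d. measure lborel k))"
    using l by (simp add: sum_distrib_left sum_ennreal)
  also have "(\<Sum>k\<in>d. measure lborel k) = b - a"
    using additive_content_division[of d a b] d \<open>a \<le> b\<close> by simp
  finally show "chord_sum \<gamma> d \<le> ennreal (l * (b - a))" .
qed

lemma length_deficit_increment_le:
  assumes lip: "l-lipschitz_on {a..b} \<gamma>" and uv: "u \<in> {a..b}" "v \<in> {a..b}"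
  defines "g \<equiv> \<lambda>t. l * t - enn2real (curve_length \<gamma> a t)"
  shows "\<bar>g v - g u\<bar> \<le> l * \<bar>v - u\<bar> - norm (\<gamma> v - \<gamma> u)"
proof -
  have l: "0 \<le> l" using lip by (rule lipschitz_on_nonneg)
  have upper: "curve_length \<gamma> u v \<le> ennreal (l * (v - u))" if "a \<le> u" "u \<le> v" "v \<le> b" for u v
    using that by (intro curve_length_le_lipschitz lipschitz_on_subset[OF lip]) auto
  define s where "s t = enn2real (curve_length \<gamma> a t)" for t
  have s: "curve_length \<gamma> a v = ennreal (s v)" if "v \<in> {a..b}" for v
    unfolding s_def using upper[of a v] that by (cases "curve_length \<gamma> a v") (auto simp: top_unique)
  have ordered: "\<bar>g v - g u\<bar> \<le> l * (v - u) - norm (\<gamma> v - \<gamma> u)" if "a \<le> u" "u \<le> v" "v \<le> b" for u v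
  proof -
    have "ennreal (s v) \<le> ennreal (s u) + ennreal (l * (v - u))"
      using curve_length_subadditive[OF that(1,2), of \<gamma>] upper[OF that] s[of u] s[of v] that
      by (auto intro: order_trans add_left_mono)
    then have "s v \<le> s u + l * (v - u)"
      using l that by (simp add: s_def ennreal_plus[symmetric] del: ennreal_plus)
    moreover have "norm (\<gamma> v - \<gamma> u) \<le> s v - s u"
      using that by (intro norm_diff_le_length_diff[OF that(1,2) s s]) (auto simp: s_def)
    ultimately show ?thesis by (simp add: g_def s_def algebra_simps)
  qed
  show ?thesis
    using ordered[of u v] ordered[of v u] uv by (cases "u \<le> v") (auto simp: norm_minus_commute abs_minus_commute)
qed

lemma slope_le_length_deficit:
  assumes lip: "l-lipschitz_on {a..b} \<gamma>" and v: "v \<in> {a..b}"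
    and deriv: "(\<gamma> has_vector_derivative \<gamma>') (at v)" and speed: "norm \<gamma>' = l"
  shows "slope_le (\<lambda>t. l * t - enn2real (curve_length \<gamma> a t)) 0 v {a..b}"
  unfolding slope_le_def
proof (intro allI impI)
  fix \<eta> :: real assume "0 < \<eta>"
  with deriv obtain \<delta> where \<delta>: "0 < \<delta>"
    "\<And>q. norm (q - v) < \<delta> \<Longrightarrow> norm (\<gamma> q - \<gamma> v - (q - v) *\<^sub>R \<gamma>') \<le> \<eta> * norm (q - v)"
    unfolding has_vector_derivative_def has_derivative_at_alt by blast
  let ?g = "\<lambda>t. l * t - enn2real (curve_length \<gamma> a t)"
  have "dist (?g q) (?g v) \<le> (0 + \<eta>) * dist q v" if q: "q \<in> {a..b}" "dist q v < \<delta>" for q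
  proof -
    have "l * \<bar>q - v\<bar> - norm (\<gamma> q - \<gamma> v) = norm ((q - v) *\<^sub>R \<gamma>') - norm (\<gamma> q - \<gamma> v)"
      by (simp add: speed)
    also have "\<dots> \<le> norm (\<gamma> q - \<gamma> v - (q - v) *\<^sub>R \<gamma>')"
      by (metis norm_minus_commute norm_triangle_ineq2)
    also have "\<dots> \<le> \<eta> * \<bar>q - v\<bar>" using \<delta>(2)[of q] q(2) by (simp add: dist_norm)
    finally show ?thesis
      using length_deficit_increment_le[OF lip v q(1)] by (simp add: dist_real_def)
  qed
  then show "\<forall>\<^sub>F q in at v within {a..b}. dist (?g q) (?g v) \<le> (0 + \<eta>) * dist q v"
    unfolding eventually_at using \<delta>(1) by blast
qed

lemma curve_length_const_speed:
  fixes \<gamma> :: "real \<Rightarrow> 'a::banach"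
  assumes cont: "continuous_on {a..b} \<gamma>" and S: "finite S" and l: "0 \<le> l" and t: "t \<in> {a..b}"
    and deriv: "\<And>t. t \<in> {a<..<b} - S \<Longrightarrow> (\<gamma> has_vector_derivative \<gamma>' t) (at t)"
    and speed: "\<And>t. t \<in> {a<..<b} - S \<Longrightarrow> norm (\<gamma>' t) = l"
  shows "curve_length \<gamma> a t = ennreal (l * (t - a))"
proof -
  have "l-lipschitz_on {a..b} \<gamma>"
    using speed by (intro lipschitz_on_vector_derivative_le[OF cont S l deriv]) auto
  then have lip: "l-lipschitz_on {a..t} \<gamma>" using t by (auto intro: lipschitz_on_subset)
  define g where "g t = l * t - enn2real (curve_length \<gamma> a t)" for t
  define S' where "S' = insert a (insert t S)"
  have "norm (g t - g a) \<le> 0"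
  proof (rule norm_increment_le_has_integral[where \<phi> = g])
    show "((\<lambda>v. if v \<in> S' then l else 0) has_integral 0) {a..t}"
      by (rule has_integral_spike_finite[OF _ _ has_integral_0[of "{a..t}"], of S'])
         (use S in \<open>auto simp: S'_def\<close>)
    fix v assume v: "v \<in> {a..t}"
    show "slope_le g (if v \<in> S' then l else 0) v {a..t}"
    proof (cases "v \<in> S'")
      case True
      have "dist (g p) (g q) \<le> l * dist p q" if "p \<in> {a..t}" "q \<in> {a..t}" for p q
        using length_deficit_increment_le[OF lip that(2,1)] norm_ge_zero[of "\<gamma> p - \<gamma> q"]
        unfolding dist_real_def g_def by linarith
      then have "l-lipschitz_on {a..t} g" using l by (rule lipschitz_onI)
      then show ?thesis using slope_le_lipschitz[OF _ v] True by simp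
    next
      case False
      then have "v \<in> {a<..<b} - S" using v t by (auto simp: S'_def less_le)
      then show ?thesis
        using slope_le_length_deficit[OF lip v deriv speed] False by (simp add: g_def[abs_def])
    qed
  qed (use t in simp)
  then have "enn2real (curve_length \<gamma> a t) = l * (t - a)" by (simp add: g_def algebra_simps)
  moreover have "curve_length \<gamma> a t < \<infinity>"
    using curve_length_le_lipschitz[OF lip] t by (auto intro: le_less_trans)
  ultimately show ?thesis by (metis ennreal_enn2real infinity_ennreal_def)
qed

lemma line_integral_const_speed:
  fixes \<gamma> :: "real \<Rightarrow> 'a::euclidean_space"
  assumes \<gamma>: "path \<gamma>" and \<rho>: "\<rho> \<in> borel_measurable borel" and l: "0 \<le> l"
    and len: "\<And>t. t \<in> {0..1} \<Longrightarrow> curve_length \<gamma> 0 t = ennreal (l * t)"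
  shows "rectifiable \<gamma>" "line_integral \<rho> \<gamma> = ennreal l * (\<integral>\<^sup>+t\<in>{0..1}. \<rho> (\<gamma> t) \<partial>lborel)"
proof -
  show rect: "rectifiable \<gamma>" using len[of 1] by (simp add: rectifiable_def)
  have length: "enn2real (curve_length \<gamma> 0 1) = l" using len[of 1] l by simp
  let ?f = "\<lambda>u. \<rho> (arc_length_param \<gamma> u) * indicator {0..l} u"
  have f_measurable: "?f \<in> borel_measurable borel"
    using arc_length_param_lipschitz[OF \<gamma> rect] \<rho> unfolding length
    by (intro borel_measurable_compose_indicator lipschitz_on_continuous_on) auto
  have "line_integral \<rho> \<gamma> = (\<integral>\<^sup>+u. ?f u \<partial>lborel)" by (simp add: line_integral_def length)
  also have "\<dots> = ennreal l * (\<integral>\<^sup>+t\<in>{0..1}. \<rho> (\<gamma> t) \<partial>lborel)"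
  proof (cases "l = 0")
    case True
    have "AE u in lborel. ?f u = 0"
      using AE_lborel_singleton[of "0::real"] by eventually_elim (auto simp: indicator_def True)
    then show ?thesis using True f_measurable by (simp add: nn_integral_0_iff_AE)
  next
    case False
    have "arc_length_param \<gamma> (l * t) = \<gamma> t" if t: "t \<in> {0..1}" for t
    proof -
      obtain t' where t': "t' \<in> {0..1}" "curve_length \<gamma> 0 t' = ennreal (l * t)"
        "arc_length_param \<gamma> (l * t) = \<gamma> t'"
        using arc_length_param_witness[OF \<gamma> rect, of "l * t"] t l unfolding length by (auto simp: mult_left_le)
      then have "t' = t" using len[OF t'(1)] l False t by simp
      with t'(3) show ?thesis by simp
    qed
    moreover have "l * t \<in> {0..l} \<longleftrightarrow> t \<in> {0..1}" for t
      using l False by (simp add: zero_le_mult_iff)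
    ultimately have "?f (0 + l * t) = \<rho> (\<gamma> t) * indicator {0..1} t" for t
      by (simp add: indicator_def)
    then show ?thesis using nn_integral_real_affine[OF f_measurable False, of 0] l by simp
  qed
  finally show "line_integral \<rho> \<gamma> = ennreal l * (\<integral>\<^sup>+t\<in>{0..1}. \<rho> (\<gamma> t) \<partial>lborel)" .
qed

lemma line_integral_const: "rectifiable (\<lambda>_. c)" "\<rho> \<in> borel_measurable borel \<Longrightarrow> line_integral \<rho> (\<lambda>_. c) = 0"
  for c :: "'a::euclidean_space"
proof -
  have len: "curve_length (\<lambda>_. c) 0 t = ennreal (0 * t)" if "t \<in> {0..1}" for t
    using curve_length_const_speed[of 0 1 "\<lambda>_. c" "{}" 0 t "\<lambda>_. 0"] that by simp
  have "path (\<lambda>_. c)" by (simp add: path_def)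
  note const_speed = line_integral_const_speed[OF this _ order_refl len]
  show "rectifiable (\<lambda>_. c)" by (rule const_speed(1)[of "\<lambda>_. 0"]) auto
  show "line_integral \<rho> (\<lambda>_. c) = 0" if "\<rho> \<in> borel_measurable borel"
    using const_speed(2)[OF that] by simp
qed

lemma nn_integral_real_translate:
  fixes f :: "real \<Rightarrow> ennreal"
  assumes "f \<in> borel_measurable borel"
  shows "(\<integral>\<^sup>+x. f (t + x) \<partial>lborel) = (\<integral>\<^sup>+x. f x \<partial>lborel)"
  using nn_integral_real_affine[OF assms, of 1 t] by simp

lemma nn_integral_real_reflect:
  fixes f :: "real \<Rightarrow> ennreal"
  assumes "f \<in> borel_measurable borel"
  shows "(\<integral>\<^sup>+x. f (t - x) \<partial>lborel) = (\<integral>\<^sup>+x. f x \<partial>lborel)"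
  using nn_integral_real_affine[OF assms, of "-1" t] by simp

lemma nn_integral_join_reverse:
  fixes g h :: "real \<Rightarrow> 'a::euclidean_space" and \<rho> :: "'a \<Rightarrow> ennreal"
  assumes gh: "path g" "path h" and \<rho>: "\<rho> \<in> borel_measurable borel"
  shows "2 * (\<integral>\<^sup>+t\<in>{0..1}. \<rho> ((g +++ reversepath h) t) \<partial>lborel) = (\<integral>\<^sup>+t\<in>{0..1}. \<rho> (g t) + \<rho> (h t) \<partial>lborel)"
proof -
  let ?g = "\<lambda>t. \<rho> (g t) * indicator {0..1} t" and ?h = "\<lambda>t. \<rho> (h t) * indicator {0..1} t"
  have meas[measurable]: "?g \<in> borel_measurable borel" "?h \<in> borel_measurable borel"
    using gh \<rho> by (auto simp: path_def intro!: borel_measurable_compose_indicator)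
  have half: "2 * (\<integral>\<^sup>+t. f (c + 2 * t) \<partial>lborel) = (\<integral>\<^sup>+t. f t \<partial>lborel)"
    if "f \<in> borel_measurable borel" for f :: "real \<Rightarrow> ennreal" and c
    using nn_integral_real_affine[OF that, of 2 c] by simp
  have halves: "(\<integral>\<^sup>+t\<in>{0..1}. \<rho> ((g +++ reversepath h) t) \<partial>lborel) = (\<integral>\<^sup>+t. ?g (2 * t) + ?h (2 - 2 * t) \<partial>lborel)"
  proof (rule nn_integral_cong_AE)
    show "AE t in lborel. \<rho> ((g +++ reversepath h) t) * indicator {0..1} t = ?g (2 * t) + ?h (2 - 2 * t)"
      using AE_lborel_singleton[of "1/2::real"]
      by eventually_elim (auto simp: joinpaths_def reversepath_def indicator_def algebra_simps)
  qed
  have "2 * (\<integral>\<^sup>+t\<in>{0..1}. \<rho> ((g +++ reversepath h) t) \<partial>lborel) =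
      2 * (\<integral>\<^sup>+t. ?g (2 * t) \<partial>lborel) + 2 * (\<integral>\<^sup>+t. ?h (2 - 2 * t) \<partial>lborel)"
    unfolding halves by (subst nn_integral_add) (auto simp: distrib_left)
  also have "2 * (\<integral>\<^sup>+t. ?g (2 * t) \<partial>lborel) = (\<integral>\<^sup>+t. ?g t \<partial>lborel)" using half[of ?g 0] by simp
  also have "2 * (\<integral>\<^sup>+t. ?h (2 - 2 * t) \<partial>lborel) = (\<integral>\<^sup>+t. ?h (2 - t) \<partial>lborel)"
    using half[of "\<lambda>t. ?h (2 - t)" 0] by simp
  also have "(\<integral>\<^sup>+t. ?h (2 - t) \<partial>lborel) = (\<integral>\<^sup>+t. ?h t \<partial>lborel)" by (rule nn_integral_real_reflect) (rule meas)
  also have "(\<integral>\<^sup>+t. ?g t \<partial>lborel) + (\<integral>\<^sup>+t. ?h t \<partial>lborel) = (\<integral>\<^sup>+t\<in>{0..1}. \<rho> (g t) + \<rho> (h t) \<partial>lborel)"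
    by (subst nn_integral_add[symmetric]) (auto simp: distrib_right)
  finally show ?thesis .
qed

lemma line_integral_join_reverse:
  fixes g h :: "real \<Rightarrow> 'a::euclidean_space"
  assumes gh: "path g" "path h" "pathfinish g = pathfinish h" and \<rho>: "\<rho> \<in> borel_measurable borel" and l: "0 \<le> l"
    and g': "\<And>t. t \<in> {0<..<1} \<Longrightarrow> (g has_vector_derivative g' t) (at t)" "\<And>t. t \<in> {0<..<1} \<Longrightarrow> norm (g' t) = l"
    and h': "\<And>t. t \<in> {0<..<1} \<Longrightarrow> (h has_vector_derivative h' t) (at t)" "\<And>t. t \<in> {0<..<1} \<Longrightarrow> norm (h' t) = l"
  shows "rectifiable (g +++ reversepath h)"
    "line_integral \<rho> (g +++ reversepath h) = ennreal l * (\<integral>\<^sup>+t\<in>{0..1}. \<rho> (g t) + \<rho> (h t) \<partial>lborel)"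
proof -
  let ?\<gamma> = "g +++ reversepath h"
  have path: "path ?\<gamma>" using gh by (intro path_join_imp) auto
  define \<gamma>' where "\<gamma>' t = (if t < 1/2 then 2 *\<^sub>R g' (2 * t) else - 2 *\<^sub>R h' (2 - 2 * t))" for t
  have deriv: "(?\<gamma> has_vector_derivative \<gamma>' t) (at t)" if t: "t \<in> {0<..<1} - {1/2}" for t
  proof (cases "t < 1/2")
    case True
    have "((\<lambda>t. g (2 * t)) has_vector_derivative 2 *\<^sub>R g' (2 * t)) (at t)"
      using True t by (intro vector_diff_chain_at[unfolded o_def] g') (auto intro!: derivative_eq_intros)
    moreover have "?\<gamma> u = g (2 * u)" if "u \<in> {..<1/2}" for u using that by (simp add: joinpaths_def)
    ultimately show ?thesis
      using True by (auto simp: \<gamma>'_def intro: has_vector_derivative_transform_within_open[of _ _ _ "{..<1/2}"])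
  next
    case False
    have "((\<lambda>t. h (2 - 2 * t)) has_vector_derivative - 2 *\<^sub>R h' (2 - 2 * t)) (at t)"
      using False t by (intro vector_diff_chain_at[unfolded o_def] h') (auto intro!: derivative_eq_intros)
    moreover have "?\<gamma> u = h (2 - 2 * u)" if "u \<in> {1/2<..}" for u
      using that by (simp add: joinpaths_def reversepath_def algebra_simps)
    ultimately show ?thesis
      using False t by (auto simp: \<gamma>'_def intro: has_vector_derivative_transform_within_open[of _ _ _ "{1/2<..}"])
  qed
  have speed: "norm (\<gamma>' t) = 2 * l" if t: "t \<in> {0<..<1} - {1/2}" for t
    using t g'(2)[of "2 * t"] h'(2)[of "2 - 2 * t"] by (auto simp: \<gamma>'_def)
  have len: "curve_length ?\<gamma> 0 t = ennreal (2 * l * t)" if "t \<in> {0..1}" for t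
    using curve_length_const_speed[OF path[unfolded path_def], of "{1/2}", OF _ _ that deriv speed] l by simp
  note const_speed = line_integral_const_speed[OF path \<rho> _ len]
  show "rectifiable ?\<gamma>" using const_speed(1) l by simp
  have "line_integral \<rho> ?\<gamma> = ennreal l * (2 * (\<integral>\<^sup>+t\<in>{0..1}. \<rho> (?\<gamma> t) \<partial>lborel))"
    using const_speed(2) l by (simp add: ennreal_mult mult_ac)
  then show "line_integral \<rho> ?\<gamma> = ennreal l * (\<integral>\<^sup>+t\<in>{0..1}. \<rho> (g t) + \<rho> (h t) \<partial>lborel)"
    unfolding nn_integral_join_reverse[OF gh(1,2) \<rho>] .
qed

subsection \<open>Integration over lines in a fixed direction\<close>

lemma nn_integral_lborel_scale:
  fixes f :: "'a::euclidean_space \<Rightarrow> ennreal"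
  assumes [measurable]: "f \<in> borel_measurable borel" and c: "c \<noteq> 0"
  shows "(\<integral>\<^sup>+x. f x \<partial>lborel) = ennreal (\<bar>c\<bar> ^ DIM('a)) * (\<integral>\<^sup>+x. f (c *\<^sub>R x) \<partial>lborel)"
  by (subst lborel_affine[OF c, of 0])
     (simp add: nn_integral_density nn_integral_distr nn_integral_cmult)

lemma nn_integral_lborel_translate:
  fixes f :: "'a::euclidean_space \<Rightarrow> ennreal"
  assumes [measurable]: "f \<in> borel_measurable borel"
  shows "(\<integral>\<^sup>+x. f (a + x) \<partial>lborel) = (\<integral>\<^sup>+x. f x \<partial>lborel)"
  by (subst (2) lborel_distr_plus[of a, symmetric]) (simp add: nn_integral_distr)

lemma nn_integral_unit_window:
  "(\<integral>\<^sup>+\<sigma>. indicator {0..<1::real} (x - \<sigma>) \<partial>lborel) = 1"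
  by (simp add: nn_integral_real_reflect)

definition perp :: "'a::real_inner \<Rightarrow> 'a \<Rightarrow> 'a" where
  "perp e w = w - (w \<bullet> e) *\<^sub>R e"

lemma perp_measurable [measurable]: "perp e \<in> borel_measurable (borel :: 'a::euclidean_space measure)"
  unfolding perp_def by measurable

lemma perp_scaleR: "perp e (c *\<^sub>R w) = c *\<^sub>R perp e w"
  by (simp add: perp_def algebra_simps)

lemma inner_perp:
  assumes "norm e = 1"
  shows "perp e w \<bullet> e = 0"
proof -
  have "e \<bullet> e = 1" using assms by (simp add: norm_eq_1)
  then show ?thesis by (simp add: perp_def inner_diff_left)
qed

lemma perp_idem:
  assumes "norm e = 1"
  shows "perp e (perp e w + \<sigma> *\<^sub>R e) = perp e w"
proof -
  have "e \<bullet> e = 1" using assms by (simp add: norm_eq_1)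
  then show ?thesis using inner_perp[OF assms, of w] by (simp add: perp_def[of e "_ + _"] inner_add_left)
qed

lemma AE_perp_nonzero:
  assumes "2 \<le> DIM('a::euclidean_space)"
  shows "AE p in lborel. perp e (p :: 'a) \<noteq> 0"
proof -
  have "dim (span {e}) \<le> 1" by (simp add: dim_le_card')
  then have "negligible (span {e})"
    using assms by (intro negligible_lowdim) auto
  then have "span {e} \<in> null_sets lebesgue" by (simp add: negligible_iff_null_sets)
  then have "span {e} \<in> null_sets lborel"
    using null_sets_completion_iff[of "span {e}" lborel] by (simp add: borel_closed closed_span)
  moreover have "{p \<in> space lborel. \<not> perp e p \<noteq> 0} \<subseteq> span {e}"
    by (auto simp: perp_def span_singleton)
  ultimately show ?thesis by (rule AE_I')
qed

lemma nn_integral_lines: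
  fixes F :: "'a::euclidean_space \<Rightarrow> ennreal"
  assumes F[measurable]: "F \<in> borel_measurable borel" and e: "norm e = 1"
  shows "(\<integral>\<^sup>+p. F p \<partial>lborel) =
    (\<integral>\<^sup>+w. indicator {0..<1} (w \<bullet> e) * (\<integral>\<^sup>+\<sigma>. F (perp e w + \<sigma> *\<^sub>R e) \<partial>lborel) \<partial>lborel)"
proof -
  have shift: "(\<integral>\<^sup>+\<sigma>. F (perp e w + \<sigma> *\<^sub>R e) \<partial>lborel) = (\<integral>\<^sup>+\<sigma>. F (w + \<sigma> *\<^sub>R e) \<partial>lborel)" for w
    using nn_integral_real_translate[of "\<lambda>\<sigma>. F (perp e w + \<sigma> *\<^sub>R e)" "w \<bullet> e"]
    by (simp add: perp_def algebra_simps)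
  have ee: "e \<bullet> e = 1" using e by (simp add: norm_eq_1)
  have "(\<integral>\<^sup>+w. indicator {0..<1} (w \<bullet> e) * (\<integral>\<^sup>+\<sigma>. F (perp e w + \<sigma> *\<^sub>R e) \<partial>lborel) \<partial>lborel)
      = (\<integral>\<^sup>+w. (\<integral>\<^sup>+\<sigma>. indicator {0..<1} (w \<bullet> e) * F (w + \<sigma> *\<^sub>R e) \<partial>lborel) \<partial>lborel)"
    unfolding shift by (simp add: nn_integral_cmult)
  also have "\<dots> = (\<integral>\<^sup>+\<sigma>. (\<integral>\<^sup>+w. indicator {0..<1} (w \<bullet> e) * F (w + \<sigma> *\<^sub>R e) \<partial>lborel) \<partial>lborel)"
    by (rule lborel_pair.Fubini') simp
  also have "\<dots> = (\<integral>\<^sup>+\<sigma>. (\<integral>\<^sup>+w. indicator {0..<1} (w \<bullet> e - \<sigma>) * F w \<partial>lborel) \<partial>lborel)"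
  proof (rule nn_integral_cong)
    fix \<sigma> :: real
    show "(\<integral>\<^sup>+w. indicator {0..<1} (w \<bullet> e) * F (w + \<sigma> *\<^sub>R e) \<partial>lborel) =
        (\<integral>\<^sup>+w. indicator {0..<1} (w \<bullet> e - \<sigma>) * F w \<partial>lborel)"
      using nn_integral_lborel_translate[of "\<lambda>w. indicator {0..<1} (w \<bullet> e - \<sigma>) * F w" "\<sigma> *\<^sub>R e"] ee
      by (simp add: algebra_simps inner_add_left)
  qed
  also have "\<dots> = (\<integral>\<^sup>+w. (\<integral>\<^sup>+\<sigma>. indicator {0..<1} (w \<bullet> e - \<sigma>) * F w \<partial>lborel) \<partial>lborel)"
    by (rule lborel_pair.Fubini') simp
  also have "\<dots> = (\<integral>\<^sup>+w. F w \<partial>lborel)"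
    by (simp add: nn_integral_multc nn_integral_unit_window)
  finally show ?thesis ..
qed

subsection \<open>The measure on the sphere\<close>

definition radial_weight :: "'a::euclidean_space \<Rightarrow> ennreal" where
  "radial_weight q = ennreal (1 / norm q ^ DIM('a))"

text \<open>The radial projection of the shell between the radii 1 and \<open>exp 1\<close>; the weight makes all
  shells of the same logarithmic thickness equivalent.\<close>

definition sphere_measure :: "'a::euclidean_space measure" where
  "sphere_measure = distr (density lborel (\<lambda>q. radial_weight q * indicator {0..<1} (ln (norm q)))) borel sgn"

lemma radial_weight_measurable [measurable]: "radial_weight \<in> borel_measurable borel"
  unfolding radial_weight_def by measurable

lemma radial_weight_zero [simp]: "radial_weight 0 = 0"
  by (simp add: radial_weight_def power_0_left)

lemma sets_sphere_measure [simp, measurable_cong]: "sets sphere_measure = sets borel"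
  by (simp add: sphere_measure_def)

lemma space_sphere_measure [simp]: "space sphere_measure = UNIV"
  by (simp add: sphere_measure_def)

lemma nn_integral_sphere_measure:
  fixes f :: "'a::euclidean_space \<Rightarrow> ennreal"
  assumes [measurable]: "f \<in> borel_measurable borel"
  shows "(\<integral>\<^sup>+q. f q \<partial>sphere_measure) = (\<integral>\<^sup>+q. radial_weight q *
      (indicator {0..<1} (ln (norm q)) * f (sgn q)) \<partial>lborel)"
  unfolding sphere_measure_def by (simp add: nn_integral_distr nn_integral_density mult.assoc)

lemma nn_integral_scale_invariant:
  fixes f :: "'a::euclidean_space \<Rightarrow> ennreal"
  assumes [measurable]: "f \<in> borel_measurable borel" and c: "c > 0"
  shows "(\<integral>\<^sup>+x. radial_weight x * f x \<partial>lborel) = (\<integral>\<^sup>+x. radial_weight x * f (c *\<^sub>R x) \<partial>lborel)"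
proof -
  have "ennreal (c ^ DIM('a)) * (radial_weight (c *\<^sub>R x) * f (c *\<^sub>R x)) = radial_weight x * f (c *\<^sub>R x)" for x
    using c by (simp add: radial_weight_def mult.assoc[symmetric] ennreal_mult[symmetric] power_mult_distrib)
  then show ?thesis
    using c by (subst nn_integral_lborel_scale[of _ c]) (simp_all add: nn_integral_cmult[symmetric])
qed

text \<open>Averaging the scale invariance over all dilations by \<open>exp \<sigma>\<close>: a window for the logarithm of
  one homogeneous function can be traded for a window for another one.\<close>

lemma nn_integral_log_average:
  fixes K :: "real \<Rightarrow> 'a::euclidean_space \<Rightarrow> ennreal"
  assumes [measurable]: "(\<lambda>(\<sigma>, p). K \<sigma> p) \<in> borel_measurable (borel \<Otimes>\<^sub>M borel)"
  shows "(\<integral>\<^sup>+p. radial_weight p * (\<integral>\<^sup>+\<sigma>. K \<sigma> p \<partial>lborel) \<partial>lborel) =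
    (\<integral>\<^sup>+p. radial_weight p * (\<integral>\<^sup>+\<sigma>. K \<sigma> (exp \<sigma> *\<^sub>R p) \<partial>lborel) \<partial>lborel)"
proof -
  have swap: "(\<integral>\<^sup>+p. radial_weight p * (\<integral>\<^sup>+\<sigma>. K' \<sigma> p \<partial>lborel) \<partial>lborel) =
      (\<integral>\<^sup>+\<sigma>. (\<integral>\<^sup>+p. radial_weight p * K' \<sigma> p \<partial>lborel) \<partial>lborel)"
    if [measurable]: "(\<lambda>(\<sigma>, p). K' \<sigma> p) \<in> borel_measurable (borel \<Otimes>\<^sub>M borel)" for K' :: "real \<Rightarrow> 'a \<Rightarrow> ennreal"
    by (subst lborel_pair.Fubini') (simp_all add: nn_integral_cmult)
  have "(\<integral>\<^sup>+p. radial_weight p * K \<sigma> p \<partial>lborel) = (\<integral>\<^sup>+p. radial_weight p * K \<sigma> (exp \<sigma> *\<^sub>R p) \<partial>lborel)" for \<sigma>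
    by (intro nn_integral_scale_invariant) auto
  then show ?thesis by (simp add: swap)
qed

lemma nn_integral_polar:
  fixes F :: "real \<Rightarrow> 'a::euclidean_space \<Rightarrow> ennreal"
  assumes [measurable]: "(\<lambda>(\<xi>, q). F \<xi> q) \<in> borel_measurable (borel \<Otimes>\<^sub>M borel)"
  shows "(\<integral>\<^sup>+p. radial_weight p * F (ln (norm p)) (sgn p) \<partial>lborel) =
      (\<integral>\<^sup>+\<xi>. (\<integral>\<^sup>+q. F \<xi> q \<partial>sphere_measure) \<partial>lborel)"
proof -
  let ?K = "\<lambda>\<sigma> p::'a. indicator {0..<1} (ln (norm p) - \<sigma>) * F (ln (norm p)) (sgn p)"
  have "(\<integral>\<^sup>+p. radial_weight p * F (ln (norm p)) (sgn p) \<partial>lborel) =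
    (\<integral>\<^sup>+p. radial_weight p * (\<integral>\<^sup>+\<sigma>. ?K \<sigma> p \<partial>lborel) \<partial>lborel)"
    by (simp add: nn_integral_multc nn_integral_unit_window)
  also have "\<dots> = (\<integral>\<^sup>+p. radial_weight p * (\<integral>\<^sup>+\<sigma>. ?K \<sigma> (exp \<sigma> *\<^sub>R p) \<partial>lborel) \<partial>lborel)"
    by (rule nn_integral_log_average) simp
  also have "\<dots> = (\<integral>\<^sup>+p. (\<integral>\<^sup>+\<sigma>. radial_weight p * (indicator {0..<1} (ln (norm p)) * F \<sigma> (sgn p)) \<partial>lborel) \<partial>lborel)"
  proof (rule nn_integral_cong)
    fix p :: 'a
    show "radial_weight p * (\<integral>\<^sup>+\<sigma>. ?K \<sigma> (exp \<sigma> *\<^sub>R p) \<partial>lborel) =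
      (\<integral>\<^sup>+\<sigma>. radial_weight p * (indicator {0..<1} (ln (norm p)) * F \<sigma> (sgn p)) \<partial>lborel)"
    proof (cases "p = 0")
      case False
      then have "ln (norm (exp \<sigma> *\<^sub>R p)) = ln (norm p) + \<sigma>" for \<sigma> by (simp add: ln_mult)
      then show ?thesis
        using nn_integral_real_translate[of "\<lambda>\<sigma>. F \<sigma> (sgn p)" "ln (norm p)"]
        by (simp add: sgn_scaleR nn_integral_cmult)
    qed simp
  qed
  also have "\<dots> = (\<integral>\<^sup>+\<sigma>. (\<integral>\<^sup>+p. radial_weight p * (indicator {0..<1} (ln (norm p)) * F \<sigma> (sgn p)) \<partial>lborel) \<partial>lborel)"
    by (rule lborel_pair.Fubini') simp
  also have "\<dots> = (\<integral>\<^sup>+\<xi>. (\<integral>\<^sup>+q. F \<xi> q \<partial>sphere_measure) \<partial>lborel)"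
    by (simp add: nn_integral_sphere_measure)
  finally show ?thesis .
qed

lemma sphere_measure_homogeneous_shell:
  fixes G :: "'a::euclidean_space \<Rightarrow> ennreal" and \<nu> :: "'a \<Rightarrow> real"
  assumes [measurable]: "G \<in> borel_measurable borel" "\<nu> \<in> borel_measurable borel"
    and hom: "\<And>c p. c > 0 \<Longrightarrow> \<nu> (c *\<^sub>R p) = c * \<nu> p" and pos: "AE p in lborel. \<nu> p > 0"
  shows "(\<integral>\<^sup>+q. G q \<partial>sphere_measure) =
    (\<integral>\<^sup>+q. radial_weight q * (indicator {0..<1} (ln (\<nu> q)) * G (sgn q)) \<partial>lborel)"
proof -
  let ?K = "\<lambda>\<sigma> p. indicator {0..<1} (ln (norm p) - \<sigma>) * (indicator {0..<1} (ln (\<nu> p)) * G (sgn p))"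
  have "(\<integral>\<^sup>+q. radial_weight q * (indicator {0..<1} (ln (\<nu> q)) * G (sgn q)) \<partial>lborel) =
    (\<integral>\<^sup>+p. radial_weight p * (\<integral>\<^sup>+\<sigma>. ?K \<sigma> p \<partial>lborel) \<partial>lborel)"
    by (simp add: nn_integral_multc nn_integral_unit_window)
  also have "\<dots> = (\<integral>\<^sup>+p. radial_weight p * (\<integral>\<^sup>+\<sigma>. ?K \<sigma> (exp \<sigma> *\<^sub>R p) \<partial>lborel) \<partial>lborel)"
    by (rule nn_integral_log_average) simp
  also have "\<dots> = (\<integral>\<^sup>+q. G q \<partial>sphere_measure)"
    unfolding nn_integral_sphere_measure[OF assms(1)]
  proof (rule nn_integral_cong_AE, rule AE_mp[OF pos], intro AE_I2 impI)
    fix p :: 'a assume pos: "0 < \<nu> p"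
    show "radial_weight p * (\<integral>\<^sup>+\<sigma>. ?K \<sigma> (exp \<sigma> *\<^sub>R p) \<partial>lborel) =
      radial_weight p * (indicator {0..<1} (ln (norm p)) * G (sgn p))"
    proof (cases "p = 0")
      case False
      then have "ln (norm (exp \<sigma> *\<^sub>R p)) = ln (norm p) + \<sigma>" for \<sigma> by (simp add: ln_mult)
      moreover have "ln (\<nu> (exp \<sigma> *\<^sub>R p)) = ln (\<nu> p) + \<sigma>" for \<sigma> using pos by (simp add: ln_mult hom)
      moreover have "(\<integral>\<^sup>+\<sigma>. indicator {0..<1::real} (ln (\<nu> p) + \<sigma>) \<partial>lborel) = 1"
        using nn_integral_real_translate[of "indicator {0..<1}" "ln (\<nu> p)"] by simp
      ultimately show ?thesis
        by (simp add: sgn_scaleR nn_integral_cmult nn_integral_multc)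
    qed simp
  qed
  finally show ?thesis ..
qed

lemma emeasure_sphere_measure_finite: "emeasure sphere_measure (UNIV :: 'a::euclidean_space set) < \<infinity>"
proof -
  have "emeasure sphere_measure (UNIV :: 'a set) =
      (\<integral>\<^sup>+q. radial_weight (q::'a) * indicator {0..<1} (ln (norm q)) \<partial>lborel)"
    using nn_integral_sphere_measure[of "\<lambda>_::'a. 1"] by simp
  also have "\<dots> \<le> (\<integral>\<^sup>+q. indicator (cball (0::'a) (exp 1)) q \<partial>lborel)"
  proof (rule nn_integral_mono)
    fix q :: 'a
    show "radial_weight q * indicator {0..<1} (ln (norm q)) \<le> indicator (cball 0 (exp 1)) q"
    proof (cases "q \<noteq> 0 \<and> 0 \<le> ln (norm q) \<and> ln (norm q) < 1")
      case True
      then have "1 \<le> norm q" "norm q \<le> exp 1"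
        by (auto simp: ln_ge_zero_iff) (metis exp_le_cancel_iff exp_ln less_imp_le zero_less_norm_iff)
      moreover from this have "1 \<le> norm q ^ DIM('a)" by (intro one_le_power)
      ultimately show ?thesis by (auto simp: indicator_def radial_weight_def divide_le_eq)
    qed (auto simp: indicator_def)
  qed
  also have "\<dots> < \<infinity>" using emeasure_bounded_finite[of "cball (0::'a) (exp 1)"] by simp
  finally show ?thesis .
qed

lemma emeasure_sphere_measure_nonzero: "emeasure sphere_measure (UNIV :: 'a::euclidean_space set) \<noteq> 0"
proof
  let ?shell = "ball (0::'a) (exp 1) - cball 0 1"
  assume "emeasure sphere_measure (UNIV :: 'a set) = 0"
  then have "AE q::'a in lborel. radial_weight q * indicator {0..<1} (ln (norm q)) = 0"
    using nn_integral_sphere_measure[of "\<lambda>_::'a. 1"] by (simp add: nn_integral_0_iff_AE)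
  then have "AE q in lborel. q \<notin> ?shell"
  proof eventually_elim
    case (elim q)
    show ?case
    proof
      assume "q \<in> ?shell"
      then have q: "1 < norm q" "norm q < exp 1" by auto
      then have "ln (norm q) < ln (exp 1)" by (subst ln_less_cancel_iff) auto
      with elim q show False by (auto simp: radial_weight_def indicator_def)
    qed
  qed
  then have "?shell \<in> null_sets lborel" by (subst (asm) AE_iff_null_sets[symmetric]) auto
  then have "negligible ?shell" by (simp add: negligible_iff_null_sets null_sets_completionI)
  moreover have "?shell \<noteq> {}"
  proof -
    obtain b :: 'a where b: "b \<in> Basis" using nonempty_Basis by blast
    have "2 \<le> exp (1::real)" using exp_ge_add_one_self[of "1::real"] by simp
    then have "(3/2) *\<^sub>R b \<in> ?shell" using b by auto
    then show ?thesis by blast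
  qed
  ultimately show False using open_not_negligible[of ?shell] by auto
qed

lemma nn_integral_sphere_uminus:
  fixes G :: "'a::euclidean_space \<Rightarrow> ennreal"
  assumes [measurable]: "G \<in> borel_measurable borel"
  shows "(\<integral>\<^sup>+q. G (- q) \<partial>sphere_measure) = (\<integral>\<^sup>+q. G q \<partial>sphere_measure)"
proof -
  let ?f = "\<lambda>q. radial_weight q * (indicator {0..<1} (ln (norm q)) * G (sgn q))"
  have "(\<integral>\<^sup>+q. ?f (- q) \<partial>lborel) = (\<integral>\<^sup>+q. ?f q \<partial>lborel)"
    using nn_integral_lborel_scale[of ?f "-1"] by simp
  then show ?thesis by (simp add: nn_integral_sphere_measure sgn_minus radial_weight_def)
qed

subsection \<open>Reflections\<close>

definition reflect :: "'a::real_inner \<Rightarrow> 'a \<Rightarrow> 'a" where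
  "reflect \<nu> q = q - (2 * (q \<bullet> \<nu>)) *\<^sub>R \<nu>"

lemma reflect_measurable [measurable]: "reflect \<nu> \<in> borel_measurable (borel :: 'a::euclidean_space measure)"
  unfolding reflect_def by measurable

lemma bounded_linear_reflect: "bounded_linear (reflect \<nu>)"
  unfolding reflect_def by (intro bounded_linear_intros)

lemma inner_reflect:
  assumes "norm \<nu> = 1"
  shows "reflect \<nu> q \<bullet> \<nu> = - (q \<bullet> \<nu>)"
proof -
  have "\<nu> \<bullet> \<nu> = 1" using assms by (simp add: norm_eq_1)
  then show ?thesis by (simp add: reflect_def inner_diff_left)
qed

lemma norm_reflect:
  assumes "norm \<nu> = 1"
  shows "norm (reflect \<nu> q) = norm q"
proof -
  have "\<nu> \<bullet> \<nu> = 1" using assms by (simp add: norm_eq_1)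
  then have "norm (reflect \<nu> q)^2 = norm q ^2"
    by (simp add: reflect_def power2_norm_eq_inner inner_diff_left inner_diff_right inner_commute algebra_simps)
  then show ?thesis by (rule power2_eq_imp_eq) auto
qed

lemma nn_integral_reflect:
  fixes F :: "'a::euclidean_space \<Rightarrow> ennreal"
  assumes [measurable]: "F \<in> borel_measurable borel" and \<nu>: "norm \<nu> = 1"
  shows "(\<integral>\<^sup>+p. F (reflect \<nu> p) \<partial>lborel) = (\<integral>\<^sup>+p. F p \<partial>lborel)"
proof -
  have "\<nu> \<bullet> \<nu> = 1" using \<nu> by (simp add: norm_eq_1)
  then have "reflect \<nu> (perp \<nu> w + \<sigma> *\<^sub>R \<nu>) = perp \<nu> w + (0 - \<sigma>) *\<^sub>R \<nu>" for w \<sigma>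
    by (simp add: reflect_def inner_add_left inner_perp[OF \<nu>] algebra_simps flip: scaleR_2)
  then have "(\<integral>\<^sup>+\<sigma>. F (reflect \<nu> (perp \<nu> w + \<sigma> *\<^sub>R \<nu>)) \<partial>lborel) = (\<integral>\<^sup>+\<sigma>. F (perp \<nu> w + \<sigma> *\<^sub>R \<nu>) \<partial>lborel)" for w
    using nn_integral_real_reflect[of "\<lambda>\<sigma>. F (perp \<nu> w + \<sigma> *\<^sub>R \<nu>)" 0] by simp
  then show ?thesis
    by (subst (1 2) nn_integral_lines[OF _ \<nu>]) auto
qed

lemma nn_integral_sphere_reflect:
  fixes G :: "'a::euclidean_space \<Rightarrow> ennreal"
  assumes [measurable]: "G \<in> borel_measurable borel" and \<nu>: "norm \<nu> = 1"
  shows "(\<integral>\<^sup>+q. G (reflect \<nu> q) \<partial>sphere_measure) = (\<integral>\<^sup>+q. G q \<partial>sphere_measure)"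
proof -
  let ?f = "\<lambda>q. radial_weight q * (indicator {0..<1} (ln (norm q)) * G (sgn q))"
  have "sgn (reflect \<nu> q) = reflect \<nu> (sgn q)" for q
    by (simp add: sgn_div_norm norm_reflect[OF \<nu>] linear_cmul[OF bounded_linear.linear[OF bounded_linear_reflect]])
  then have "?f (reflect \<nu> q) = radial_weight q * (indicator {0..<1} (ln (norm q)) * G (reflect \<nu> (sgn q)))" for q
    by (simp add: norm_reflect[OF \<nu>] radial_weight_def)
  then show ?thesis
    using nn_integral_reflect[OF _ \<nu>, of ?f] by (simp add: nn_integral_sphere_measure)
qed

lemma reflection_swapping_unit_vectors:
  fixes a b :: "'a::real_inner"
  assumes ab: "norm a = 1" "norm b = 1" "a \<noteq> b"
  obtains \<nu> where "norm \<nu> = 1" "0 < a \<bullet> \<nu>" "reflect \<nu> a = b"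
proof
  let ?\<nu> = "(1 / norm (a - b)) *\<^sub>R (a - b)"
  have pos: "norm (a - b) > 0" using ab by simp
  have unit: "a \<bullet> a = 1" "b \<bullet> b = 1" using ab by (auto simp: norm_eq_1)
  then have "1 - a \<bullet> b = norm (a - b) ^ 2 / 2"
    by (simp add: power2_norm_eq_inner inner_diff_left inner_diff_right inner_commute)
  moreover have "a \<bullet> ?\<nu> = (1 - a \<bullet> b) / norm (a - b)" using unit by (simp add: inner_diff_right)
  ultimately have half: "a \<bullet> ?\<nu> = norm (a - b) / 2" using pos by (simp only: power2_eq_square) simp
  show "norm ?\<nu> = 1" using pos by simp
  show "0 < a \<bullet> ?\<nu>" using pos unfolding half by simp
  show "reflect ?\<nu> a = b" using pos unfolding reflect_def half by simp
qed

subsection \<open>Great circles through a point\<close>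

lemma one_plus_square_pos [simp]: "0 < 1 + (s::real)\<^sup>2"
  using zero_le_power2[of s] by linarith

lemma one_plus_square_neq_0 [simp]: "1 + s\<^sup>2 \<noteq> (0::real)"
  using one_plus_square_pos[of s] by linarith

lemma UN_symmetric_Icc: "(\<Union>N. {- real (Suc N)..real (Suc N)}) = UNIV"
proof -
  have "\<exists>N. x \<in> {- real (Suc N)..real (Suc N)}" for x
  proof -
    obtain N :: nat where "\<bar>x\<bar> \<le> real N" using real_arch_simple by blast
    then show ?thesis by (intro exI[of _ N]) (auto simp: abs_le_iff)
  qed
  then show ?thesis by blast
qed

lemma nn_integral_substitution_UNIV:
  fixes f :: "real \<Rightarrow> ennreal"
  assumes f[measurable]: "f \<in> borel_measurable borel"
    and deriv: "\<And>x. (g has_real_derivative g' x) (at x)"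
    and cont: "continuous_on UNIV g'" and nonneg: "\<And>x. 0 \<le> g' x"
  shows "(\<integral>\<^sup>+x. f (g x) * ennreal (g' x) \<partial>lborel) = (\<integral>\<^sup>+y\<in>range g. f y \<partial>lborel)"
proof -
  have g_cont: "continuous_on UNIV g" using deriv by (meson DERIV_isCont continuous_at_imp_continuous_on)
  have [measurable]: "g \<in> borel_measurable borel" "g' \<in> borel_measurable borel"
    using g_cont cont by (auto intro: borel_measurable_continuous_onI)
  have mono: "g x \<le> g y" if "x \<le> y" for x y
    using DERIV_nonneg_imp_nondecreasing[OF that] deriv nonneg by blast
  let ?A = "\<lambda>N. {- real (Suc N)..real (Suc N)}"
  let ?B = "\<lambda>N. {g (- real (Suc N))..g (real (Suc N))}"
  let ?M = "density lborel (\<lambda>x. f (g x) * ennreal (g' x))"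
  let ?K = "density lborel f"
  have "emeasure ?M (?A N) = emeasure ?K (?B N)" for N
    using nn_integral_substitution_aux[of f "- real (Suc N)" "real (Suc N)" g g'] deriv nonneg
      continuous_on_subset[OF cont]
    by (simp add: emeasure_density)
  moreover have "(SUP N. emeasure ?M (?A N)) = emeasure ?M (\<Union>N. ?A N)"
    by (rule SUP_emeasure_incseq) (auto simp: incseq_def)
  moreover have "(SUP N. emeasure ?K (?B N)) = emeasure ?K (\<Union>N. ?B N)"
    by (rule SUP_emeasure_incseq) (auto simp: incseq_def atLeastatMost_subset_iff intro!: mono)
  moreover note UN_symmetric_Icc
  moreover have "(\<Union>N. ?B N) = range g"
  proof
    show "(\<Union>N. ?B N) \<subseteq> range g"
    proof clarify
      fix y N assume "y \<in> ?B N"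
      then show "y \<in> range g"
        using IVT'[of g "- real (Suc N)" y "real (Suc N)"] continuous_on_subset[OF g_cont] by auto
    qed
    show "range g \<subseteq> (\<Union>N. ?B N)"
    proof clarify
      fix x
      obtain N where "- real (Suc N) \<le> x" "x \<le> real (Suc N)" using UN_symmetric_Icc by fastforce
      then show "g x \<in> (\<Union>N. ?B N)" by (intro UN_I[of N] UNIV_I atLeastAtMost_iff[THEN iffD2] conjI mono)
    qed
  qed
  ultimately show ?thesis by (simp add: emeasure_density)
qed

lemma one_plus_square_not_neg [simp]: "\<not> 1 + (s::real)\<^sup>2 < 0"
  using one_plus_square_pos[of s] by linarith

definition cos_of_cot :: "real \<Rightarrow> real" where
  "cos_of_cot s = s / sqrt (1 + s\<^sup>2)"

lemma cos_of_cot_measurable [measurable]: "cos_of_cot \<in> borel_measurable borel"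
  unfolding cos_of_cot_def by measurable

lemma continuous_on_cos_of_cot [continuous_intros]: "continuous_on S f \<Longrightarrow> continuous_on S (\<lambda>x. cos_of_cot (f x))"
  unfolding cos_of_cot_def by (intro continuous_intros) auto

lemma cos_of_cot_minus: "cos_of_cot (- s) = - cos_of_cot s"
  by (simp add: cos_of_cot_def)

lemma abs_cos_of_cot_less: "\<bar>cos_of_cot s\<bar> < 1"
proof -
  have "\<bar>s\<bar> < sqrt (1 + s\<^sup>2)" by (rule real_less_rsqrt) simp
  then show ?thesis by (simp add: cos_of_cot_def abs_divide)
qed

lemma one_minus_cos_of_cot_sq: "1 - (cos_of_cot s)\<^sup>2 = 1 / (1 + s\<^sup>2)"
  by (simp add: cos_of_cot_def power_divide field_simps)

lemma one_minus_cos_of_cot_sq_powr: "(1 - (cos_of_cot s)\<^sup>2) powr p = (1 + s\<^sup>2) powr (- p)"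
  by (simp add: one_minus_cos_of_cot_sq powr_divide powr_minus_divide)

lemma cos_of_cot_has_derivative:
  "(cos_of_cot has_real_derivative (1 + s\<^sup>2) powr (- 3/2)) (at s)"
proof -
  have "(cos_of_cot has_real_derivative (sqrt (1 + s\<^sup>2) - s * (s / sqrt (1 + s\<^sup>2))) / (1 + s\<^sup>2)) (at s)"
    unfolding cos_of_cot_def
    by (auto intro!: derivative_eq_intros simp: field_simps)
  moreover have "(sqrt (1 + s\<^sup>2) - s * (s / sqrt (1 + s\<^sup>2))) / (1 + s\<^sup>2) = (1 + s\<^sup>2) powr (- 3/2)"
  proof -
    have "sqrt (1 + s\<^sup>2) - s * (s / sqrt (1 + s\<^sup>2)) = 1 / sqrt (1 + s\<^sup>2)"
      by (simp add: field_simps power2_eq_square[symmetric])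
    moreover have "(1 + s\<^sup>2) powr (- 3/2) = (1 + s\<^sup>2) powr (-1) * (1 + s\<^sup>2) powr (-1/2)"
      using powr_add[of "1 + s\<^sup>2" "-1" "-1/2"] by simp
    moreover have "y powr (-1) = 1 / y" "y powr (-1/2) = 1 / sqrt y" if "0 < y" for y :: real
      using that powr_minus_divide[of y 1] powr_minus_divide[of y "1/2"] powr_half_sqrt[of y] by auto
    ultimately show ?thesis by simp
  qed
  ultimately show ?thesis by simp
qed

lemma range_cos_of_cot: "range cos_of_cot = {-1<..<1}"
proof
  show "range cos_of_cot \<subseteq> {-1<..<1}" using abs_cos_of_cot_less by (auto simp: abs_less_iff minus_less_iff)
  show "{-1<..<1} \<subseteq> range cos_of_cot"
  proof
    fix y :: real assume "y \<in> {-1<..<1}"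
    then have pos: "0 < 1 - y\<^sup>2" by (simp add: abs_square_less_1 abs_less_iff)
    define s where "s = y / sqrt (1 - y\<^sup>2)"
    have "1 + s\<^sup>2 = 1 / (1 - y\<^sup>2)" using pos by (simp add: s_def power_divide field_simps)
    then have "cos_of_cot s = y" using pos by (simp add: cos_of_cot_def s_def real_sqrt_divide)
    then show "y \<in> range cos_of_cot" by blast
  qed
qed

definition great_circle :: "'a::real_inner \<Rightarrow> 'a \<Rightarrow> real \<Rightarrow> 'a" where
  "great_circle a v x = cos x *\<^sub>R a + sin x *\<^sub>R v"

text \<open>The point of the great circle through \<open>e\<close> and \<open>v\<close> whose angle to \<open>e\<close> has the cotangent \<open>s\<close>.\<close>

definition meridian :: "'a::real_inner \<Rightarrow> 'a \<Rightarrow> real \<Rightarrow> 'a" where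
  "meridian e v s = (1 / sqrt (1 + s\<^sup>2)) *\<^sub>R (v + s *\<^sub>R e)"

lemma great_circle_measurable [measurable]: "great_circle a v \<in> borel_measurable borel"
  for a :: "'a::euclidean_space"
  unfolding great_circle_def by measurable

lemma meridian_measurable [measurable]:
  "(\<lambda>(v, s). meridian e v s) \<in> borel_measurable (borel \<Otimes>\<^sub>M borel)"
  for e :: "'a::euclidean_space"
  unfolding meridian_def by measurable

lemma great_circle_pi_half_minus_arctan: "great_circle a v (pi/2 - arctan s) = meridian a v s"
  by (simp add: great_circle_def meridian_def cos_diff sin_diff cos_arctan sin_arctan algebra_simps)

lemma great_circle_has_vector_derivative:
  "(great_circle a v has_vector_derivative great_circle v (- a) x) (at x)"
  unfolding great_circle_def
  by (auto intro!: derivative_eq_intros simp: has_vector_derivative_def algebra_simps)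

lemma inner_great_circle:
  assumes "norm a = 1" "norm v = 1" "a \<bullet> v = 0"
  shows "great_circle a v x \<bullet> great_circle a v y = cos (x - y)"
proof -
  have "a \<bullet> a = 1" "v \<bullet> v = 1" "v \<bullet> a = 0" using assms by (auto simp: norm_eq_1 inner_commute)
  then show ?thesis using assms(3)
    by (simp add: great_circle_def inner_add_left inner_add_right cos_diff algebra_simps)
qed

lemma norm_great_circle:
  assumes "norm a = 1" "norm v = 1" "a \<bullet> v = 0"
  shows "norm (great_circle a v x) = 1"
  using inner_great_circle[OF assms, of x x] by (simp add: norm_eq_1)

lemma inner_meridian:
  assumes "norm e = 1" "v \<bullet> e = 0"
  shows "meridian e v s \<bullet> e = cos_of_cot s"
proof -
  have "e \<bullet> e = 1" using assms by (simp add: norm_eq_1)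
  then show ?thesis using assms by (simp add: meridian_def cos_of_cot_def inner_add_left)
qed

lemma nn_integral_great_circle:
  fixes H :: "'a::euclidean_space \<Rightarrow> ennreal"
  assumes [measurable]: "H \<in> borel_measurable borel"
  shows "(\<integral>\<^sup>+x\<in>{0..pi/2 - arctan s0}. H (great_circle a v x) \<partial>lborel) =
    (\<integral>\<^sup>+s. indicator {s0<..} s * (H (meridian a v s) * ennreal (1 / (1 + s\<^sup>2))) \<partial>lborel)"
proof -
  let ?F = "\<lambda>y. H (great_circle a v (pi/2 - y)) * indicator {arctan s0<..} y"
  have range: "range arctan = {-(pi/2)<..<pi/2}"
  proof
    show "range arctan \<subseteq> {-(pi/2)<..<pi/2}" using arctan_bounded by auto
    show "{-(pi/2)<..<pi/2} \<subseteq> range arctan"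
      by (auto intro!: image_eqI[of _ arctan "tan _"] arctan_tan[symmetric])
  qed
  have "(\<integral>\<^sup>+x\<in>{0..pi/2 - arctan s0}. H (great_circle a v x) \<partial>lborel) =
    (\<integral>\<^sup>+y. H (great_circle a v (pi/2 - y)) * indicator {arctan s0..pi/2} y \<partial>lborel)"
    using nn_integral_real_reflect[of "\<lambda>x. H (great_circle a v x) * indicator {0..pi/2 - arctan s0} x" "pi/2"]
    by (simp add: indicator_def conj_commute)
  also have "\<dots> = (\<integral>\<^sup>+y\<in>range arctan. ?F y \<partial>lborel)"
    unfolding range
  proof (rule nn_integral_cong_AE)
    show "AE y in lborel. H (great_circle a v (pi/2 - y)) * indicator {arctan s0..pi/2} y =
      ?F y * indicator {-(pi/2)<..<pi/2} y"
      using AE_lborel_singleton[of "arctan s0"] AE_lborel_singleton[of "pi/2"]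
      by eventually_elim (use arctan_lbound[of s0] in \<open>auto simp: indicator_def\<close>)
  qed
  also have "\<dots> = (\<integral>\<^sup>+s. ?F (arctan s) * ennreal (1 / (1 + s\<^sup>2)) \<partial>lborel)"
  proof (rule nn_integral_substitution_UNIV[symmetric])
    show "(arctan has_real_derivative 1 / (1 + s\<^sup>2)) (at s)" for s
      using DERIV_arctan[of s] by (simp add: divide_inverse)
    show "continuous_on UNIV (\<lambda>s::real. 1 / (1 + s\<^sup>2))" by (intro continuous_intros) auto
  qed auto
  finally show ?thesis
    by (simp add: great_circle_pi_half_minus_arctan indicator_def mult_ac arctan_less_iff)
qed

subsection \<open>Disintegration of the sphere into meridians\<close>

definition equator_measure :: "'a::euclidean_space \<Rightarrow> 'a measure" where
  "equator_measure e = distr (density lborel (\<lambda>w. indicator {0..<1} (w \<bullet> e) *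
     (indicator {0..<1} (ln (norm (perp e w))) * ennreal (1 / norm (perp e w) ^ (DIM('a) - 1)))))
     borel (\<lambda>w. sgn (perp e w))"

lemma space_equator_measure [simp]: "space (equator_measure e) = UNIV"
  by (simp add: equator_measure_def)

lemma nn_integral_equator_measure:
  fixes f :: "'a::euclidean_space \<Rightarrow> ennreal"
  assumes [measurable]: "f \<in> borel_measurable borel"
  shows "(\<integral>\<^sup>+v. f v \<partial>equator_measure e) = (\<integral>\<^sup>+w. indicator {0..<1} (w \<bullet> e) *
    (indicator {0..<1} (ln (norm (perp e w))) * ennreal (1 / norm (perp e w) ^ (DIM('a) - 1))) *
      f (sgn (perp e w)) \<partial>lborel)"
  unfolding equator_measure_def by (simp add: nn_integral_distr nn_integral_density)

lemma AE_equator_measure: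
  fixes e :: "'a::euclidean_space"
  assumes "norm e = 1" "2 \<le> DIM('a)"
  shows "AE v in equator_measure e. norm v = 1 \<and> v \<bullet> e = 0"
proof -
  have "AE w in lborel. norm (sgn (perp e w)) = 1 \<and> sgn (perp e w) \<bullet> e = 0"
    using AE_perp_nonzero[OF assms(2), of e]
    by eventually_elim (simp add: norm_sgn sgn_div_norm inner_perp[OF assms(1)])
  then show ?thesis
    unfolding equator_measure_def by (subst AE_distr_iff) (auto simp: AE_density)
qed

lemma norm_perp_line:
  assumes "norm e = 1" "p \<bullet> e = 0"
  shows "norm (p + (norm p * s) *\<^sub>R e) = norm p * sqrt (1 + s\<^sup>2)"
proof -
  have "e \<bullet> e = 1" using assms by (simp add: norm_eq_1)
  then have "norm (p + (norm p * s) *\<^sub>R e) ^ 2 = norm p ^ 2 + (norm p * s)\<^sup>2"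
    using assms(2) by (simp add: power2_norm_eq_inner inner_add_left inner_add_right inner_commute
        power2_eq_square[of "norm p * s"])
  also have "\<dots> = (norm p * sqrt (1 + s\<^sup>2))\<^sup>2" by (simp add: power_mult_distrib algebra_simps)
  finally show ?thesis by (rule power2_eq_imp_eq) auto
qed

lemma nn_integral_radial_weight_line:
  fixes p e :: "'a::euclidean_space" and G :: "'a \<Rightarrow> ennreal"
  assumes G[measurable]: "G \<in> borel_measurable borel" and e: "norm e = 1" and p: "p \<bullet> e = 0" "p \<noteq> 0"
  shows "(\<integral>\<^sup>+\<sigma>. radial_weight (p + \<sigma> *\<^sub>R e) * G (sgn (p + \<sigma> *\<^sub>R e)) \<partial>lborel) =
    ennreal (1 / norm p ^ (DIM('a) - 1)) *
      (\<integral>\<^sup>+s. ennreal ((1 + s\<^sup>2) powr (- real DIM('a) / 2)) * G (meridian e (sgn p) s) \<partial>lborel)"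
proof -
  let ?n = "DIM('a)" and ?\<nu> = "norm p"
  let ?f = "\<lambda>\<sigma>. radial_weight (p + \<sigma> *\<^sub>R e) * G (sgn (p + \<sigma> *\<^sub>R e))"
  let ?g = "\<lambda>s. ennreal ((1 + s\<^sup>2) powr (- real ?n / 2)) * G (meridian e (sgn p) s)"
  have \<nu>: "0 < ?\<nu>" using p by simp
  have direction: "sgn (p + (?\<nu> * s) *\<^sub>R e) = meridian e (sgn p) s" for s
    unfolding sgn_div_norm norm_perp_line[OF e p(1)] meridian_def using \<nu>
    by (simp add: scaleR_add_right field_simps)
  have weight: "radial_weight (p + (?\<nu> * s) *\<^sub>R e) =
      ennreal (1 / ?\<nu> ^ ?n) * ennreal ((1 + s\<^sup>2) powr (- real ?n / 2))" for s
  proof -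
    have "sqrt (1 + s\<^sup>2) ^ ?n = (1 + s\<^sup>2) powr (real ?n / 2)"
      by (simp add: powr_half_sqrt[symmetric] powr_power)
    then have "1 / norm (p + (?\<nu> * s) *\<^sub>R e) ^ ?n = (1 / ?\<nu> ^ ?n) * (1 + s\<^sup>2) powr (- real ?n / 2)"
      unfolding norm_perp_line[OF e p(1)] by (simp add: power_mult_distrib powr_minus divide_simps)
    then show ?thesis unfolding radial_weight_def by (subst ennreal_mult[symmetric]) auto
  qed
  have "(\<integral>\<^sup>+\<sigma>. ?f \<sigma> \<partial>lborel) = ennreal ?\<nu> * (\<integral>\<^sup>+s. ?f (?\<nu> * s) \<partial>lborel)"
    using \<nu> nn_integral_real_affine[of ?f ?\<nu> 0] by simp
  also have "\<dots> = ennreal ?\<nu> * (\<integral>\<^sup>+s. ennreal (1 / ?\<nu> ^ ?n) * ?g s \<partial>lborel)"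
    unfolding direction weight by (simp add: mult.assoc)
  also have "\<dots> = (ennreal ?\<nu> * ennreal (1 / ?\<nu> ^ ?n)) * (\<integral>\<^sup>+s. ?g s \<partial>lborel)"
    by (subst nn_integral_cmult) (auto simp: mult.assoc)
  also have "ennreal ?\<nu> * ennreal (1 / ?\<nu> ^ ?n) = ennreal (1 / ?\<nu> ^ (?n - 1))"
    using \<nu> by (cases "DIM('a)") (auto simp: ennreal_mult[symmetric])
  finally show ?thesis .
qed

lemma nn_integral_sphere_meridians:
  fixes G :: "'a::euclidean_space \<Rightarrow> ennreal"
  assumes G[measurable]: "G \<in> borel_measurable borel" and e: "norm e = 1" and n: "2 \<le> DIM('a)"
  shows "(\<integral>\<^sup>+q. G q \<partial>sphere_measure) = (\<integral>\<^sup>+v. (\<integral>\<^sup>+s. ennreal ((1 + s\<^sup>2) powr (- real DIM('a) / 2)) *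
     G (meridian e v s) \<partial>lborel) \<partial>equator_measure e)"
proof -
  let ?window = "\<lambda>w. indicator {0..<1} (ln (norm (perp e w))) :: ennreal"
  have "(\<integral>\<^sup>+q. G q \<partial>sphere_measure) = (\<integral>\<^sup>+q. radial_weight q * (?window q * G (sgn q)) \<partial>lborel)"
    using AE_perp_nonzero[OF n, of e]
    by (intro sphere_measure_homogeneous_shell) (auto simp: perp_scaleR)
  also have "\<dots> = (\<integral>\<^sup>+w. indicator {0..<1} (w \<bullet> e) *
      (\<integral>\<^sup>+\<sigma>. ?window w * (radial_weight (perp e w + \<sigma> *\<^sub>R e) * G (sgn (perp e w + \<sigma> *\<^sub>R e))) \<partial>lborel) \<partial>lborel)"
    by (subst nn_integral_lines[OF _ e]) (simp_all add: perp_idem[OF e] mult_ac)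
  also have "\<dots> = (\<integral>\<^sup>+v. (\<integral>\<^sup>+s. ennreal ((1 +
      s\<^sup>2) powr (- real DIM('a) / 2)) * G (meridian e v s) \<partial>lborel) \<partial>equator_measure e)"
  proof (subst nn_integral_equator_measure, measurable, rule nn_integral_cong_AE)
    show "AE w in lborel. indicator {0..<1} (w \<bullet> e) *
        (\<integral>\<^sup>+\<sigma>. ?window w * (radial_weight (perp e w + \<sigma> *\<^sub>R e) * G (sgn (perp e w + \<sigma> *\<^sub>R e))) \<partial>lborel) =
      indicator {0..<1} (w \<bullet> e) * (?window w * ennreal (1 / norm (perp e w) ^ (DIM('a) - 1))) *
        (\<integral>\<^sup>+s. ennreal ((1 + s\<^sup>2) powr (- real DIM('a) / 2)) * G (meridian e (sgn (perp e w)) s) \<partial>lborel)"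
      using AE_perp_nonzero[OF n, of e]
    proof eventually_elim
      case (elim w)
      show ?case
        using nn_integral_radial_weight_line[OF G e inner_perp[OF e] elim]
        by (simp add: nn_integral_cmult mult.assoc)
    qed
  qed
  finally show ?thesis .
qed

definition cot_integral :: "real \<Rightarrow> real" where
  "cot_integral p = enn2real (\<integral>\<^sup>+s. ennreal ((1 + s\<^sup>2) powr (- p)) \<partial>lborel)"

lemma nn_integral_cot_half_finite:
  assumes p: "1/2 < p"
  shows "(\<integral>\<^sup>+s\<in>{0..}. ennreal ((1 + s\<^sup>2) powr (- p)) \<partial>lborel) < \<infinity>"
proof -
  let ?f = "\<lambda>s::real. ennreal ((1 + s\<^sup>2) powr (- p))"
  let ?F = "\<lambda>s::real. - (2 powr p / (2 * p - 1)) * (1 + s) powr (1 - 2 * p)"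
  have "(\<integral>\<^sup>+s\<in>{0..}. ?f s \<partial>lborel) \<le> (\<integral>\<^sup>+s\<in>{0..}. ennreal (2 powr p * (1 + s) powr (- 2 * p)) \<partial>lborel)"
  proof (rule nn_integral_mono)
    fix s :: real
    have "(1 + s\<^sup>2) powr (- p) \<le> 2 powr p * (1 + s) powr (- 2 * p)" if "0 \<le> s"
    proof -
      have "(1 + s)\<^sup>2 / 2 \<le> 1 + s\<^sup>2"
        using zero_le_power2[of "1 - s"] by (simp add: power2_eq_square algebra_simps)
      then have "(1 + s\<^sup>2) powr (- p) \<le> ((1 + s)\<^sup>2 / 2) powr (- p)"
        using that p by (intro powr_mono2') auto
      also have "\<dots> = 2 powr p * (1 + s) powr (- 2 * p)"
        using that by (simp add: powr_divide powr_powr powr_minus_divide flip: powr_numeral)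
      finally show ?thesis .
    qed
    then show "?f s * indicator {0..} s \<le> ennreal (2 powr p * (1 + s) powr (- 2 * p)) * indicator {0..} s"
      by (auto simp: indicator_def intro: ennreal_leI)
  qed
  also have "\<dots> = ennreal (0 - ?F 0)"
  proof (rule nn_integral_FTC_atLeast)
    show "DERIV ?F s :> 2 powr p * (1 + s) powr (- 2 * p)" if "0 \<le> s" for s
    proof -
      have "DERIV ?F s :> - (2 powr p / (2 * p - 1)) * ((1 - 2 * p) * (1 + s) powr (1 - 2 * p - 1))"
        using that p by (auto intro!: derivative_eq_intros)
      moreover have "- (a / (2 * p - 1)) * ((1 - 2 * p) * y) = a * y" for a y :: real
        using p by (simp add: field_simps)
      ultimately show ?thesis by simp
    qed
    have "((\<lambda>s::real. (1 + s) powr (1 - 2 * p)) \<longlongrightarrow> 0) at_top"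
      using p by (intro tendsto_neg_powr filterlim_tendsto_add_at_top[OF tendsto_const] filterlim_ident) auto
    then show "(?F \<longlongrightarrow> 0) at_top" using tendsto_mult_right_zero by blast
  qed auto
  finally show ?thesis by (auto intro: le_less_trans)
qed

lemma nn_integral_cot_finite:
  assumes p: "1/2 < p"
  shows "(\<integral>\<^sup>+s. ennreal ((1 + s\<^sup>2) powr (- p)) \<partial>lborel) < \<infinity>"
proof -
  let ?f = "\<lambda>s::real. ennreal ((1 + s\<^sup>2) powr (- p))"
  have negative: "(\<integral>\<^sup>+s\<in>{..0}. ?f s \<partial>lborel) = (\<integral>\<^sup>+s\<in>{0..}. ?f s \<partial>lborel)"
    using nn_integral_real_reflect[of "\<lambda>s. ?f s * indicator {0..} s" 0] by (simp add: indicator_def)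
  have "(\<integral>\<^sup>+s. ?f s \<partial>lborel) \<le> (\<integral>\<^sup>+s. ?f s * indicator {0..} s + ?f s * indicator {..0} s \<partial>lborel)"
    by (rule nn_integral_mono) (auto simp: indicator_def)
  also have "\<dots> = (\<integral>\<^sup>+s\<in>{0..}. ?f s \<partial>lborel) + (\<integral>\<^sup>+s\<in>{..0}. ?f s \<partial>lborel)"
    by (rule nn_integral_add) auto
  finally show ?thesis unfolding negative using nn_integral_cot_half_finite[OF p] by (auto intro: le_less_trans)
qed

lemma nn_integral_cot:
  assumes "1/2 < p"
  shows "(\<integral>\<^sup>+s. ennreal ((1 + s\<^sup>2) powr (- p)) \<partial>lborel) = ennreal (cot_integral p)"
  unfolding cot_integral_def using nn_integral_cot_finite[OF assms] by (simp add: ennreal_enn2real)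

lemma cot_integral_pos:
  assumes "1/2 < p"
  shows "0 < cot_integral p"
proof (rule ccontr)
  assume "\<not> ?thesis"
  then have "(\<integral>\<^sup>+s. ennreal ((1 + s\<^sup>2) powr (- p)) \<partial>(lborel :: real measure)) = 0"
    using nn_integral_cot[OF assms] by (simp add: ennreal_neg)
  then have "AE s::real in lborel. ennreal ((1 + s\<^sup>2) powr (- p)) = 0"
    by (subst (asm) nn_integral_0_iff_AE) auto
  then have "AE s::real in lborel. False"
    by eventually_elim (simp add: ennreal_eq_0_iff not_le)
  then show False by (simp add: ae_filter_eq_bot_iff trivial_limit_def[symmetric] eventually_False)
qed

definition equator_area :: "'a::euclidean_space itself \<Rightarrow> real" where
  "equator_area _ = enn2real (emeasure sphere_measure (UNIV :: 'a set)) / cot_integral (DIM('a) / 2)"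

lemma emeasure_sphere_measure_eq_equator:
  assumes e: "norm e = 1" and n: "2 \<le> DIM('a::euclidean_space)"
  shows "emeasure sphere_measure (UNIV :: 'a set) =
      ennreal (cot_integral (DIM('a) / 2)) * emeasure (equator_measure e) (UNIV :: 'a set)"
  using nn_integral_sphere_meridians[OF _ e n, of "\<lambda>_. 1"] nn_integral_cot[of "DIM('a) / 2"] n
  by simp

lemma emeasure_equator_measure:
  assumes e: "norm e = 1" and n: "2 \<le> DIM('a::euclidean_space)"
  shows "emeasure (equator_measure e) (UNIV :: 'a set) = ennreal (equator_area TYPE('a))"
proof -
  have J: "0 < cot_integral (DIM('a) / 2)" using n by (intro cot_integral_pos) auto
  show ?thesis
    using emeasure_sphere_measure_eq_equator[OF e n] J emeasure_sphere_measure_finite[where 'a='a]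
    by (cases "emeasure (equator_measure e) (UNIV :: 'a set)")
       (auto simp: equator_area_def ennreal_mult[symmetric] ennreal_mult_top)
qed

lemma equator_area_pos:
  assumes "2 \<le> DIM('a::euclidean_space)"
  shows "0 < equator_area TYPE('a)"
proof -
  have "0 < enn2real (emeasure sphere_measure (UNIV :: 'a set))"
    using emeasure_sphere_measure_finite[where 'a='a] emeasure_sphere_measure_nonzero[where 'a='a]
    by (simp add: enn2real_positive_iff zero_less_iff_neq_zero)
  moreover have "0 < cot_integral (DIM('a) / 2)" using assms by (intro cot_integral_pos) auto
  ultimately show ?thesis by (simp add: equator_area_def)
qed

lemma nn_integral_sphere_axis:
  fixes e :: "'a::euclidean_space"
  assumes [measurable]: "g \<in> borel_measurable borel" and e: "norm e = 1" and n: "2 \<le> DIM('a)"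
  shows "(\<integral>\<^sup>+q. g (q \<bullet> e) \<partial>sphere_measure) = ennreal (equator_area TYPE('a)) *
    (\<integral>\<^sup>+s. ennreal ((1 + s\<^sup>2) powr (- real DIM('a) / 2)) * g (cos_of_cot s) \<partial>lborel)"
proof -
  have "(\<integral>\<^sup>+q. g (q \<bullet> e) \<partial>sphere_measure) = (\<integral>\<^sup>+v. (\<integral>\<^sup>+s. ennreal ((1 + s\<^sup>2) powr (- real DIM('a) / 2)) *
      g (cos_of_cot s) \<partial>lborel) \<partial>equator_measure e)"
  proof (subst nn_integral_sphere_meridians[OF _ e n], measurable, rule nn_integral_cong_AE)
    show "AE v in equator_measure e. (\<integral>\<^sup>+s. ennreal ((1 + s\<^sup>2) powr (- real DIM('a) / 2)) *
        g (meridian e v s \<bullet> e) \<partial>lborel) =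
      (\<integral>\<^sup>+s. ennreal ((1 + s\<^sup>2) powr (- real DIM('a) / 2)) * g (cos_of_cot s) \<partial>lborel)"
      using AE_equator_measure[OF e n] by eventually_elim (simp add: inner_meridian[OF e])
  qed
  then show ?thesis by (simp add: emeasure_equator_measure[OF e n] mult.commute)
qed

subsection \<open>The spherical cap inequality\<close>

lemma power_tangent_le:
  fixes r c :: real
  assumes "0 \<le> r" "0 \<le> c" "1 \<le> n"
  shows "n * c ^ (n - 1) * r \<le> r ^ n + (real n - 1) * c ^ n"
proof (cases "c = 0")
  case True
  then show ?thesis using assms by (cases "n = 1") (auto simp: power_0_left)
next
  case False
  then have c: "0 < c" "c ^ n = c ^ (n - 1) * c" using assms by (auto simp flip: power_Suc2)
  have "1 + real n * (r / c - 1) \<le> (1 + (r / c - 1)) ^ n"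
    using assms c by (intro Bernoulli_inequality) auto
  then have "(1 + real n * (r / c - 1)) * c ^ n \<le> (1 + (r / c - 1)) ^ n * c ^ n"
    using c by (intro mult_right_mono) auto
  also have "(1 + (r / c - 1)) ^ n * c ^ n = r ^ n" using c(1) by (simp add: power_divide)
  also have "(1 + real n * (r / c - 1)) * c ^ n = c ^ n + n * c ^ (n - 1) * r - n * c ^ n"
    unfolding c(2) using c(1) by (simp add: field_simps)
  finally show ?thesis by (simp add: algebra_simps)
qed

lemma ennreal_power_tangent_le:
  fixes y :: ennreal and c v :: real
  assumes n: "1 \<le> n" and c: "0 \<le> c" and v: "0 \<le> v"
  shows "ennreal (n * c ^ (n - 1)) * (y * ennreal (v ^ (n - 1))) \<le>
    y ^ n + ennreal ((real n - 1) * c ^ n) * ennreal (v ^ n)"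
proof (cases y)
  case (real r)
  have "n * (c * v) ^ (n - 1) * r \<le> r ^ n + (real n - 1) * (c * v) ^ n"
    using real c v by (intro power_tangent_le n) auto
  then have "ennreal (n * c ^ (n - 1) * (r * v ^ (n - 1))) \<le> ennreal (r ^ n + (real n - 1) * c ^ n * v ^ n)"
    by (intro ennreal_leI) (simp add: power_mult_distrib mult_ac)
  then show ?thesis
    using real c v n by (simp add: ennreal_mult ennreal_plus ennreal_power)
next
  case top
  then show ?thesis using n by (simp add: power_eq_top_ennreal)
qed

text \<open>Hoelder's inequality for the exponents \<open>n\<close> and \<open>n / (n - 1)\<close>, integrated from the tangent of the
  power function at the optimal multiple of \<open>v\<close>.\<close>

lemma nn_integral_power_ge:
  fixes f :: "'a \<Rightarrow> ennreal" and v :: "'a \<Rightarrow> real"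
  assumes [measurable]: "f \<in> borel_measurable M" "v \<in> borel_measurable M"
    and n: "1 \<le> n" and A: "0 < A" and x: "0 \<le> x" and v: "\<And>z. 0 \<le> v z"
    and v_le: "(\<integral>\<^sup>+z. ennreal (v z ^ n) \<partial>M) \<le> ennreal A"
    and f_ge: "ennreal x \<le> (\<integral>\<^sup>+z. f z * ennreal (v z ^ (n - 1)) \<partial>M)"
  shows "ennreal (x ^ n / A ^ (n - 1)) \<le> (\<integral>\<^sup>+z. f z ^ n \<partial>M)"
proof (cases "\<integral>\<^sup>+z. f z ^ n \<partial>M")
  case (real F)
  define c where "c = x / A"
  have c: "0 \<le> c" using A x by (simp add: c_def)
  have tangent: "ennreal (n * c ^ (n - 1)) * (f z * ennreal (v z ^ (n - 1))) \<le>
      f z ^ n + ennreal ((real n - 1) * c ^ n) * ennreal (v z ^ n)" for z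
    by (rule ennreal_power_tangent_le[OF n c v])
  have "ennreal (n * c ^ (n - 1) * x) = ennreal (n * c ^ (n - 1)) * ennreal x"
    using c x by (intro ennreal_mult) auto
  also have "\<dots> \<le> (\<integral>\<^sup>+z. ennreal (n * c ^ (n - 1)) * (f z * ennreal (v z ^ (n - 1))) \<partial>M)"
    using f_ge by (subst nn_integral_cmult) (auto intro: mult_left_mono)
  also have "\<dots> \<le> (\<integral>\<^sup>+z. f z ^ n + ennreal ((real n - 1) * c ^ n) * ennreal (v z ^ n) \<partial>M)"
    by (rule nn_integral_mono) (rule tangent)
  also have "\<dots> = ennreal F + ennreal ((real n - 1) * c ^ n) * (\<integral>\<^sup>+z. ennreal (v z ^ n) \<partial>M)"
    by (subst nn_integral_add) (auto simp: nn_integral_cmult real)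
  also have "\<dots> \<le> ennreal F + ennreal ((real n - 1) * c ^ n) * ennreal A"
    using v_le by (intro add_left_mono mult_left_mono) auto
  also have "\<dots> = ennreal (F + (real n - 1) * c ^ n * A)"
    using real c A n by (simp add: ennreal_mult ennreal_plus)
  finally have "n * c ^ (n - 1) * x \<le> F + (real n - 1) * c ^ n * A"
    using real c A n by (subst (asm) ennreal_le_iff) auto
  moreover have "c ^ n * A = x ^ n / A ^ (n - 1)" "c ^ (n - 1) * x = x ^ n / A ^ (n - 1)"
    using A n by (cases n; simp add: c_def power_divide)+
  ultimately have "n * (x ^ n / A ^ (n - 1)) \<le> F + (real n - 1) * (x ^ n / A ^ (n - 1))"
    by (simp only: mult.assoc)
  then have "x ^ n / A ^ (n - 1) \<le> F" by (simp only: left_diff_distrib mult_1)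
  then show ?thesis using real by (simp add: ennreal_leI)
qed simp

lemma convex_on_power_nonneg: "convex_on {0..} (\<lambda>x::real. x ^ n)"
  by (cases "even n") (auto intro: convex_power_odd convex_on_subset[OF convex_power_even])

lemma ennreal_power_add_le:
  fixes x y :: ennreal
  shows "(x + y) ^ n \<le> 2 ^ (n - 1) * (x ^ n + y ^ n)"
proof (cases "n = 0 \<or> x = top \<or> y = top")
  case True
  then show ?thesis by (cases "n = 0") (auto simp: ennreal_mult_eq_top_iff power_eq_top_ennreal)
next
  case False
  then obtain r t where rt: "x = ennreal r" "y = ennreal t" "0 \<le> r" "0 \<le> t"
    by (metis ennreal_cases)
  have "((1/2) * r + (1/2) * t) ^ n \<le> (1/2) * r ^ n + (1/2) * t ^ n"
    using convex_onD[OF convex_on_power_nonneg, of "1/2" r t n] rt by simp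
  then have "(r + t) ^ n \<le> 2 ^ n * ((r ^ n + t ^ n) / 2)"
    by (simp add: power_divide add_divide_distrib[symmetric] field_simps)
  also have "\<dots> = 2 ^ (n - 1) * (r ^ n + t ^ n)" using False by (cases n) auto
  finally have "ennreal ((r + t) ^ n) \<le> ennreal (2 ^ (n - 1) * (r ^ n + t ^ n))" by (rule ennreal_leI)
  moreover have "ennreal (2 ^ (n - 1)) = 2 ^ (n - 1)"
    by (metis ennreal_numeral ennreal_power zero_le_numeral)
  ultimately show ?thesis
    using rt by (simp add: ennreal_power[symmetric] ennreal_mult ennreal_plus flip: ennreal_power)
qed

lemma nn_integral_hemisphere_even:
  fixes W :: "'a::euclidean_space \<Rightarrow> ennreal"
  assumes [measurable]: "W \<in> borel_measurable borel" and even: "\<And>q. W (- q) = W q"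
  shows "2 * (\<integral>\<^sup>+q. indicator {0<..} (q \<bullet> \<nu>) * W q \<partial>sphere_measure) \<le> (\<integral>\<^sup>+q. W q \<partial>sphere_measure)"
proof -
  have "(\<integral>\<^sup>+q. indicator {0<..} (q \<bullet> \<nu>) * W q \<partial>sphere_measure) =
      (\<integral>\<^sup>+q. indicator {..<0} (q \<bullet> \<nu>) * W q \<partial>sphere_measure)"
    using nn_integral_sphere_uminus[of "\<lambda>q. indicator {..<0} (q \<bullet> \<nu>) * W q"]
    by (simp add: even indicator_def)
  then have "2 * (\<integral>\<^sup>+q. indicator {0<..} (q \<bullet> \<nu>) * W q \<partial>sphere_measure) =
      (\<integral>\<^sup>+q. indicator {0<..} (q \<bullet> \<nu>) * W q + indicator {..<0} (q \<bullet> \<nu>) * W q \<partial>sphere_measure)"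
    by (subst nn_integral_add) (auto simp: mult_2)
  also have "\<dots> \<le> (\<integral>\<^sup>+q. W q \<partial>sphere_measure)"
    by (rule nn_integral_mono) (auto simp: indicator_def)
  finally show ?thesis .
qed

lemma nn_integral_hemisphere_fold_power:
  fixes h :: "'a::euclidean_space \<Rightarrow> ennreal"
  assumes [measurable]: "h \<in> borel_measurable borel" and \<nu>: "norm \<nu> = 1"
  shows "(\<integral>\<^sup>+q. indicator {0<..} (q \<bullet> \<nu>) * (h q + h (reflect \<nu> q)) ^ n \<partial>sphere_measure) \<le>
    2 ^ (n - 1) * (\<integral>\<^sup>+q. h q ^ n \<partial>sphere_measure)"
proof -
  let ?up = "\<lambda>q. indicator {0<..} (q \<bullet> \<nu>) * h q ^ n" and ?down = "\<lambda>q. indicator {..<0} (q \<bullet> \<nu>) * h q ^ n"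
  have "(\<integral>\<^sup>+q. indicator {0<..} (q \<bullet> \<nu>) * (h q + h (reflect \<nu> q)) ^ n \<partial>sphere_measure) \<le>
    (\<integral>\<^sup>+q. 2 ^ (n - 1) * (?up q + ?down (reflect \<nu> q)) \<partial>sphere_measure)"
    using ennreal_power_add_le by (intro nn_integral_mono) (auto simp: indicator_def inner_reflect[OF \<nu>])
  also have "\<dots> = 2 ^ (n - 1) * ((\<integral>\<^sup>+q. ?up q \<partial>sphere_measure) + (\<integral>\<^sup>+q. ?down (reflect \<nu> q) \<partial>sphere_measure))"
    by (simp add: nn_integral_cmult nn_integral_add)
  also have "(\<integral>\<^sup>+q. ?down (reflect \<nu> q) \<partial>sphere_measure) = (\<integral>\<^sup>+q. ?down q \<partial>sphere_measure)"
    by (rule nn_integral_sphere_reflect[OF _ \<nu>]) measurable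
  also have "(\<integral>\<^sup>+q. ?up q \<partial>sphere_measure) + (\<integral>\<^sup>+q. ?down q \<partial>sphere_measure) =
      (\<integral>\<^sup>+q. ?up q + ?down q \<partial>sphere_measure)"
    by (rule nn_integral_add[symmetric]) auto
  also have "\<dots> \<le> (\<integral>\<^sup>+q. h q ^ n \<partial>sphere_measure)"
    by (rule nn_integral_mono) (auto simp: indicator_def)
  finally show ?thesis by (simp add: mult_left_mono)
qed

definition bent_arc :: "'a::real_inner \<Rightarrow> real \<Rightarrow> 'a \<Rightarrow> 'a \<Rightarrow> 'a \<Rightarrow> real \<Rightarrow> real \<Rightarrow> 'a" where
  "bent_arc m t \<nu> a v l = (\<lambda>u. m + t *\<^sub>R great_circle a v (l * u)) +++
     reversepath (\<lambda>u. m + t *\<^sub>R reflect \<nu> (great_circle a v (l * u)))"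

context
  fixes m a v \<nu> :: "'a::euclidean_space" and t l :: real
  assumes av: "norm a = 1" "norm v = 1" "a \<bullet> v = 0" and \<nu>: "norm \<nu> = 1"
    and t: "0 < t" and l: "0 < l" and meet: "great_circle a v l \<bullet> \<nu> = 0"
begin

lemma great_arc_path:
  "path (\<lambda>u. m + t *\<^sub>R great_circle a v (l * u))" "path (\<lambda>u. m + t *\<^sub>R reflect \<nu> (great_circle a v (l * u)))"
  unfolding path_def great_circle_def reflect_def by (intro continuous_intros)+

lemma great_arcs_meet:
  "pathfinish (\<lambda>u. m + t *\<^sub>R great_circle a v (l * u)) =
      pathfinish (\<lambda>u. m + t *\<^sub>R reflect \<nu> (great_circle a v (l * u)))"
  using meet by (simp add: pathfinish_def reflect_def)

lemma bent_arc_path: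
  shows "path (bent_arc m t \<nu> a v l)" "path_image (bent_arc m t \<nu> a v l) \<subseteq> sphere m t"
    "pathstart (bent_arc m t \<nu> a v l) = m + t *\<^sub>R a" "pathfinish (bent_arc m t \<nu> a v l) = m + t *\<^sub>R reflect \<nu> a"
proof -
  show "path (bent_arc m t \<nu> a v l)"
    unfolding bent_arc_def using great_arc_path great_arcs_meet by (intro path_join_imp) auto
  show "path_image (bent_arc m t \<nu> a v l) \<subseteq> sphere m t"
  proof -
    have "path_image (\<lambda>u. m + t *\<^sub>R great_circle a v (l * u)) \<subseteq> sphere m t"
      "path_image (\<lambda>u. m + t *\<^sub>R reflect \<nu> (great_circle a v (l * u))) \<subseteq> sphere m t"
      using t by (auto simp: path_image_def dist_norm norm_great_circle[OF av] norm_reflect[OF \<nu>])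
    then show ?thesis unfolding bent_arc_def by (intro subset_path_image_join) simp_all
  qed
  show "pathstart (bent_arc m t \<nu> a v l) = m + t *\<^sub>R a"
    "pathfinish (bent_arc m t \<nu> a v l) = m + t *\<^sub>R reflect \<nu> a"
    by (simp_all add: bent_arc_def pathstart_def pathfinish_def joinpaths_def reversepath_def great_circle_def)
qed

lemma bent_arc_line_integral:
  assumes \<rho>[measurable]: "\<rho> \<in> borel_measurable borel"
  shows "rectifiable (bent_arc m t \<nu> a v l)"
    "line_integral \<rho> (bent_arc m t \<nu> a v l) = ennreal t *
      (\<integral>\<^sup>+x\<in>{0..l}. \<rho> (m + t *\<^sub>R great_circle a v x) + \<rho> (m + t *\<^sub>R reflect \<nu> (great_circle a v x)) \<partial>lborel)"
proof -
  let ?h = "\<lambda>x. \<rho> (m + t *\<^sub>R great_circle a v x) + \<rho> (m + t *\<^sub>R reflect \<nu> (great_circle a v x))"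
  let ?c = "\<lambda>u. great_circle a v (l * u)" and ?c' = "\<lambda>u. l *\<^sub>R great_circle v (- a) (l * u)"
  have c': "(?c has_vector_derivative ?c' u) (at u)" for u
    by (rule vector_diff_chain_at[unfolded o_def, OF _ great_circle_has_vector_derivative])
       (auto intro!: derivative_eq_intros)
  have "norm (great_circle v (- a) x) = 1" for x
    using av by (intro norm_great_circle) (auto simp: inner_commute)
  then have speed: "norm (t *\<^sub>R ?c' u) = l * t" "norm (t *\<^sub>R reflect \<nu> (?c' u)) = l * t" for u
    using l t by (simp_all add: norm_reflect[OF \<nu>])
  have deriv: "((\<lambda>u. m + t *\<^sub>R ?c u) has_vector_derivative t *\<^sub>R ?c' u) (at u)"
    "((\<lambda>u. m + t *\<^sub>R reflect \<nu> (?c u)) has_vector_derivative t *\<^sub>R reflect \<nu> (?c' u)) (at u)" for u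
    using c' bounded_linear.has_vector_derivative[OF bounded_linear_reflect c', of \<nu>]
    by (auto intro!: derivative_eq_intros)
  note join = line_integral_join_reverse[OF great_arc_path great_arcs_meet _ _ deriv(1) speed(1) deriv(2) speed(2)]
  show "rectifiable (bent_arc m t \<nu> a v l)" unfolding bent_arc_def using l t by (intro join(1)[OF \<rho>]) auto
  have "line_integral \<rho> (bent_arc m t \<nu> a v l) = ennreal (l * t) * (\<integral>\<^sup>+u\<in>{0..1}. ?h (l * u) \<partial>lborel)"
    unfolding bent_arc_def using l t by (intro join(2)[OF \<rho>]) auto
  also have "\<dots> = ennreal t * (ennreal l * (\<integral>\<^sup>+u. ?h (l * u) * indicator {0..l} (l * u) \<partial>lborel))"
    using l t by (simp add: ennreal_mult mult_ac indicator_def zero_le_mult_iff)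
  also have "ennreal l * (\<integral>\<^sup>+u. ?h (l * u) * indicator {0..l} (l * u) \<partial>lborel) = (\<integral>\<^sup>+x\<in>{0..l}. ?h x \<partial>lborel)"
    using l nn_integral_real_affine[of "\<lambda>x. ?h x * indicator {0..l} x" l 0] by simp
  finally show "line_integral \<rho> (bent_arc m t \<nu> a v l) = ennreal t * (\<integral>\<^sup>+x\<in>{0..l}. ?h x \<partial>lborel)" .
qed

end

lemma meridian_integral_ge:
  fixes \<rho> :: "'a::euclidean_space \<Rightarrow> ennreal"
  assumes \<rho>[measurable]: "\<rho> \<in> borel_measurable borel" and t: "0 < t"
    and av: "norm a = 1" "norm v = 1" "a \<bullet> v = 0" and \<nu>: "norm \<nu> = 1" "0 < a \<bullet> \<nu>"
    and adm: "\<And>\<gamma>. path \<gamma> \<Longrightarrow> pathstart \<gamma> = m + t *\<^sub>R a \<Longrightarrow> pathfinish \<gamma> = m + t *\<^sub>R reflect \<nu> a \<Longrightarrow>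
      path_image \<gamma> \<subseteq> sphere m t \<Longrightarrow> rectifiable \<gamma> \<Longrightarrow> 1 \<le> line_integral \<rho> \<gamma>"
  defines "k \<equiv> \<lambda>q. \<rho> (m + t *\<^sub>R q) + \<rho> (m + t *\<^sub>R reflect \<nu> q)"
  shows "ennreal (1 / t) \<le> (\<integral>\<^sup>+s. indicator {0<..} (meridian a v s \<bullet> \<nu>) *
    (k (meridian a v s) * ennreal (1 / (1 + s\<^sup>2))) \<partial>lborel)"
proof -
  have k[measurable]: "k \<in> borel_measurable borel" unfolding k_def by measurable
  define s0 where "s0 = - (v \<bullet> \<nu>) / (a \<bullet> \<nu>)"
  define l where "l = pi/2 - arctan s0"
  have l: "0 < l" using arctan_ubound[of s0] by (simp add: l_def)
  have meet: "great_circle a v l \<bullet> \<nu> = 0"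
    unfolding l_def great_circle_pi_half_minus_arctan meridian_def using \<nu>(2)
    by (simp add: s0_def inner_add_left inner_diff_left)
  have side: "s0 < s \<longleftrightarrow> 0 < meridian a v s \<bullet> \<nu>" for s
    unfolding s0_def pos_divide_less_eq[OF \<nu>(2)] meridian_def
    by (auto simp: inner_add_left zero_less_divide_iff)
  have "1 \<le> line_integral \<rho> (bent_arc m t \<nu> a v l)"
    using bent_arc_path[OF av \<nu>(1) t l meet] bent_arc_line_integral(1)[OF av \<nu>(1) t l meet \<rho>] by (intro adm)
  also have "\<dots> = ennreal t * (\<integral>\<^sup>+x\<in>{0..l}. k (great_circle a v x) \<partial>lborel)"
    unfolding bent_arc_line_integral(2)[OF av \<nu>(1) t l meet \<rho>] k_def ..
  finally have "ennreal (1 / t) * 1 \<le> ennreal (1 / t) *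
      (ennreal t * (\<integral>\<^sup>+x\<in>{0..l}. k (great_circle a v x) \<partial>lborel))"
    by (rule mult_left_mono) simp
  also have "\<dots> = (\<integral>\<^sup>+x\<in>{0..l}. k (great_circle a v x) \<partial>lborel)"
    using t by (simp add: mult.assoc[symmetric] ennreal_mult[symmetric])
  finally show ?thesis
    unfolding l_def nn_integral_great_circle[OF k] by (simp add: indicator_def side)
qed

definition cap_exponent :: "nat \<Rightarrow> real" where
  "cap_exponent n = real n / (2 * (real n - 1))"

definition cap_integral :: "nat \<Rightarrow> real" where
  "cap_integral n = cot_integral (cap_exponent n)"

definition cap_constant :: "'a::euclidean_space itself \<Rightarrow> real" where
  "cap_constant _ = equator_area TYPE('a) / cap_integral DIM('a) ^ (DIM('a) - 1)"

lemma cap_exponent_gt_half: "2 \<le> n \<Longrightarrow> 1/2 < cap_exponent n"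
  by (simp add: cap_exponent_def field_simps)

lemma cap_integral_pos: "2 \<le> n \<Longrightarrow> 0 < cap_integral n"
  unfolding cap_integral_def by (intro cot_integral_pos cap_exponent_gt_half)

lemma cap_constant_pos:
  assumes "2 \<le> DIM('a::euclidean_space)"
  shows "0 < cap_constant TYPE('a)"
  unfolding cap_constant_def using equator_area_pos[OF assms] cap_integral_pos[OF assms] by simp

text \<open>The extremal metric for the family of bent arcs starting at \<open>a\<close> is a power of this weight.\<close>

definition cap_weight :: "'a::euclidean_space \<Rightarrow> 'a \<Rightarrow> real" where
  "cap_weight a q = (1 - (q \<bullet> a)\<^sup>2) powr (- ((real DIM('a) - 2) / (2 * (real DIM('a) - 1))))"

lemma cap_weight_measurable [measurable]: "cap_weight a \<in> borel_measurable borel"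
  unfolding cap_weight_def by measurable

lemma cap_weight_uminus: "cap_weight a (- q) = cap_weight a q"
  by (simp add: cap_weight_def)

lemma cap_weight_power:
  fixes a :: "'a::euclidean_space"
  assumes "q \<bullet> a = cos_of_cot s" "0 < k"
  shows "cap_weight a q ^ k = (1 + s\<^sup>2) powr (real k * ((real DIM('a) - 2) / (2 * (real DIM('a) - 1))))"
  using assms(2) unfolding cap_weight_def assms(1) one_minus_cos_of_cot_sq_powr
  by (simp add: powr_power)

lemma nn_integral_cap_weight:
  fixes a :: "'a::euclidean_space"
  assumes a: "norm a = 1" and n: "2 \<le> DIM('a)"
  shows "(\<integral>\<^sup>+q. ennreal (cap_weight a q ^ DIM('a)) \<partial>sphere_measure) =
      ennreal (equator_area TYPE('a) * cap_integral DIM('a))"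
proof -
  let ?n = "real DIM('a)"
  let ?g = "\<lambda>c. ennreal (((1 - c\<^sup>2) powr (- ((?n - 2) / (2 * (?n - 1))))) ^ DIM('a))"
  have "- ?n / 2 + ?n * ((?n - 2) / (2 * (?n - 1))) = - cap_exponent DIM('a)"
    using n by (simp add: cap_exponent_def field_simps)
  then have "ennreal ((1 + s\<^sup>2) powr (- ?n / 2)) * ?g (cos_of_cot s) =
      ennreal ((1 + s\<^sup>2) powr (- cap_exponent DIM('a)))" for s
    unfolding one_minus_cos_of_cot_sq_powr
    by (simp add: ennreal_mult[symmetric] powr_power powr_add[symmetric])
  then show ?thesis
    using nn_integral_sphere_axis[OF _ a n, of ?g] nn_integral_cot[OF cap_exponent_gt_half[OF n]]
      equator_area_pos[OF n] cap_integral_pos[OF n]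
    by (simp add: cap_weight_def ennreal_mult cap_integral_def)
qed

lemma nn_integral_cap_weight_ge:
  fixes k :: "'a::euclidean_space \<Rightarrow> ennreal"
  assumes k[measurable]: "k \<in> borel_measurable borel" and a: "norm a = 1" and n: "2 \<le> DIM('a)"
    and meridians: "\<And>v. norm v = 1 \<Longrightarrow> a \<bullet> v = 0 \<Longrightarrow>
        ennreal c \<le> (\<integral>\<^sup>+s. k (meridian a v s) * ennreal (1 / (1 + s\<^sup>2)) \<partial>lborel)"
  shows "ennreal (equator_area TYPE('a) * c) \<le>
      (\<integral>\<^sup>+q. k q * ennreal (cap_weight a q ^ (DIM('a) - 1)) \<partial>sphere_measure)"
proof -
  let ?n = "real DIM('a)"
  have "(\<integral>\<^sup>+q. k q * ennreal (cap_weight a q ^ (DIM('a) - 1)) \<partial>sphere_measure) =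
    (\<integral>\<^sup>+v. (\<integral>\<^sup>+s. k (meridian a v s) * ennreal (1 / (1 + s\<^sup>2)) \<partial>lborel) \<partial>equator_measure a)"
  proof (subst nn_integral_sphere_meridians[OF _ a n], measurable, rule nn_integral_cong_AE)
    have "- ?n / 2 + (?n - 1) * ((?n - 2) / (2 * (?n - 1))) = -1" using n by (simp add: field_simps)
    then have "ennreal ((1 + s\<^sup>2) powr (- ?n / 2)) * ennreal (cap_weight a (meridian a v s) ^ (DIM('a) - 1)) =
        ennreal (1 / (1 + s\<^sup>2))"
      if "v \<bullet> a = 0" for v s
      using n cap_weight_power[OF inner_meridian[OF a that], of "DIM('a) - 1" s] powr_minus_divide[of "1 + s\<^sup>2" 1]
      by (simp add: ennreal_mult[symmetric] powr_add[symmetric] of_nat_diff add_nonneg_nonneg)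
    then have meridian: "(\<integral>\<^sup>+s. ennreal ((1 + s\<^sup>2) powr (- ?n / 2)) *
        (k (meridian a v s) * ennreal (cap_weight a (meridian a v s) ^ (DIM('a) - 1))) \<partial>lborel) =
      (\<integral>\<^sup>+s. k (meridian a v s) * ennreal (1 / (1 + s\<^sup>2)) \<partial>lborel)" if "v \<bullet> a = 0" for v
      using that by (intro nn_integral_cong) (simp only: mult.left_commute)
    show "AE v in equator_measure a. (\<integral>\<^sup>+s. ennreal ((1 + s\<^sup>2) powr (- ?n / 2)) *
        (k (meridian a v s) * ennreal (cap_weight a (meridian a v s) ^ (DIM('a) - 1))) \<partial>lborel) =
      (\<integral>\<^sup>+s. k (meridian a v s) * ennreal (1 / (1 + s\<^sup>2)) \<partial>lborel)"
      using AE_equator_measure[OF a n] by eventually_elim (simp only: meridian)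
  qed
  also have "\<dots> \<ge> (\<integral>\<^sup>+v. ennreal c \<partial>equator_measure a)"
  proof (rule nn_integral_mono_AE)
    show "AE v in equator_measure a. ennreal c \<le> (\<integral>\<^sup>+s. k (meridian a v s) * ennreal (1 / (1 + s\<^sup>2)) \<partial>lborel)"
      using AE_equator_measure[OF a n] by eventually_elim (simp add: meridians inner_commute)
  qed
  finally show ?thesis
    using equator_area_pos[OF n] by (simp add: emeasure_equator_measure[OF a n] ennreal_mult'' mult.commute)
qed

lemma nn_integral_cap_weight_hemisphere_le:
  fixes a \<nu> :: "'a::euclidean_space"
  assumes a: "norm a = 1" and n: "2 \<le> DIM('a)"
  shows "(\<integral>\<^sup>+q. indicator {0<..} (q \<bullet> \<nu>) * ennreal (cap_weight a q ^ DIM('a)) \<partial>sphere_measure) \<le>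
    ennreal (equator_area TYPE('a) * cap_integral DIM('a) / 2)"
proof -
  let ?m = "equator_area TYPE('a) * cap_integral DIM('a)"
  have "2 * (\<integral>\<^sup>+q. indicator {0<..} (q \<bullet> \<nu>) * ennreal (cap_weight a q ^ DIM('a)) \<partial>sphere_measure) \<le> ennreal ?m"
    unfolding nn_integral_cap_weight[OF a n, symmetric]
    by (rule nn_integral_hemisphere_even) (auto simp: cap_weight_uminus)
  also have "\<dots> = 2 * ennreal (?m / 2)"
    using equator_area_pos[OF n] cap_integral_pos[OF n] ennreal_mult[of 2 "?m / 2"] by simp
  finally show ?thesis by (simp add: ennreal_mult_le_mult_iff)
qed

lemma nn_integral_hemisphere_power_ge:
  fixes k :: "'a::euclidean_space \<Rightarrow> ennreal" and a \<nu> :: 'a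
  assumes [measurable]: "k \<in> borel_measurable borel" and a: "norm a = 1" and n: "2 \<le> DIM('a)" and x: "0 \<le> x"
    and first_moment: "ennreal x \<le>
      (\<integral>\<^sup>+q. indicator {0<..} (q \<bullet> \<nu>) * k q * ennreal (cap_weight a q ^ (DIM('a) - 1)) \<partial>sphere_measure)"
  shows "ennreal (x ^ DIM('a) / (equator_area TYPE('a) * cap_integral DIM('a) / 2) ^ (DIM('a) - 1)) \<le>
    (\<integral>\<^sup>+q. indicator {0<..} (q \<bullet> \<nu>) * k q ^ DIM('a) \<partial>sphere_measure)"
proof -
  let ?n = "DIM('a)"
  let ?f = "\<lambda>q. indicator {0<..} (q \<bullet> \<nu>) * k q" and ?w = "\<lambda>q. indicator {0<..} (q \<bullet> \<nu>) * cap_weight a q"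
  have "ennreal (?w q ^ ?n) = indicator {0<..} (q \<bullet> \<nu>) * ennreal (cap_weight a q ^ ?n)" for q
    using n by (auto simp: indicator_def power_0_left)
  then have w: "(\<integral>\<^sup>+q. ennreal (?w q ^ ?n) \<partial>sphere_measure) \<le>
      ennreal (equator_area TYPE('a) * cap_integral ?n / 2)"
    using nn_integral_cap_weight_hemisphere_le[OF a n, of \<nu>] by (simp only:)
  have "?f q * ennreal (cap_weight a q ^ (?n - 1)) = ?f q * ennreal (?w q ^ (?n - 1))" for q
    by (auto simp: indicator_def)
  then have f: "ennreal x \<le> (\<integral>\<^sup>+q. ?f q * ennreal (?w q ^ (?n - 1)) \<partial>sphere_measure)"
    using first_moment by (simp only:)
  have "ennreal (x ^ ?n / (equator_area TYPE('a) * cap_integral ?n / 2) ^ (?n - 1)) \<le>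
      (\<integral>\<^sup>+q. ?f q ^ ?n \<partial>sphere_measure)"
    using equator_area_pos[OF n] cap_integral_pos[OF n] n x
    by (intro nn_integral_power_ge[OF _ _ _ _ _ _ w f]) (auto simp: cap_weight_def)
  also have "\<dots> = (\<integral>\<^sup>+q. indicator {0<..} (q \<bullet> \<nu>) * k q ^ ?n \<partial>sphere_measure)"
    using n by (intro nn_integral_cong) (auto simp: indicator_def power_0_left)
  finally show ?thesis .
qed

text \<open>Any two points of a sphere are joined by great circle arcs from the first one to the equator of
  points equidistant to both, followed by the reflected arcs. The directions opposite to each other
  contribute arcs which together make up half a great circle, so the average over all directions does
  not depend on the two points; this yields the sharp constant.\<close>

lemma spherical_cap_inequality:
  fixes \<rho> :: "'a::euclidean_space \<Rightarrow> ennreal" and a b m :: 'a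
  assumes dim: "2 \<le> DIM('a)" and \<rho>[measurable]: "\<rho> \<in> borel_measurable borel"
    and t: "0 < t" and ab: "norm a = 1" "norm b = 1" "a \<noteq> b"
    and adm: "\<And>\<gamma>. path \<gamma> \<Longrightarrow> pathstart \<gamma> = m + t *\<^sub>R a \<Longrightarrow> pathfinish \<gamma> = m + t *\<^sub>R b \<Longrightarrow>
      path_image \<gamma> \<subseteq> sphere m t \<Longrightarrow> rectifiable \<gamma> \<Longrightarrow> 1 \<le> line_integral \<rho> \<gamma>"
  shows "ennreal (cap_constant TYPE('a) / t ^ DIM('a)) \<le> (\<integral>\<^sup>+q. \<rho> (m + t *\<^sub>R q) ^ DIM('a) \<partial>sphere_measure)"
proof -
  define n where "n = DIM('a)"
  define \<kappa> where "\<kappa> = equator_area TYPE('a)"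
  define I where "I = cap_integral DIM('a)"
  have pos: "0 < \<kappa>" "0 < I" "0 < n"
    using equator_area_pos[OF dim] cap_integral_pos[OF dim] dim by (auto simp: \<kappa>_def I_def n_def)
  obtain \<nu> where \<nu>: "norm \<nu> = 1" "0 < a \<bullet> \<nu>" "reflect \<nu> a = b"
    using reflection_swapping_unit_vectors[OF ab] .
  define h where "h q = \<rho> (m + t *\<^sub>R q)" for q
  have [measurable]: "h \<in> borel_measurable borel" unfolding h_def by measurable
  have "ennreal (\<kappa> * (1 / t)) \<le>
      (\<integral>\<^sup>+q. indicator {0<..} (q \<bullet> \<nu>) * (h q + h (reflect \<nu> q)) *
        ennreal (cap_weight a q ^ (n - 1)) \<partial>sphere_measure)"
    unfolding \<kappa>_def n_def
  proof (rule nn_integral_cap_weight_ge[OF _ ab(1) dim])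
    fix v assume "norm v = 1" "a \<bullet> v = 0"
    then show "ennreal (1 / t) \<le> (\<integral>\<^sup>+s. indicator {0<..} (meridian a v s \<bullet> \<nu>) *
        (h (meridian a v s) + h (reflect \<nu> (meridian a v s))) * ennreal (1 / (1 + s\<^sup>2)) \<partial>lborel)"
      using meridian_integral_ge[OF \<rho> t ab(1) _ _ \<nu>(1,2), of v m] adm \<nu>(3) by (simp add: h_def mult.assoc)
  qed measurable
  then have "ennreal ((\<kappa> * (1 / t)) ^ n / (\<kappa> * I / 2) ^ (n - 1)) \<le>
      (\<integral>\<^sup>+q. indicator {0<..} (q \<bullet> \<nu>) * (h q + h (reflect \<nu> q)) ^ n \<partial>sphere_measure)"
    using pos t unfolding n_def \<kappa>_def I_def by (intro nn_integral_hemisphere_power_ge[OF _ ab(1) dim]) auto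
  also have "\<dots> \<le> 2 ^ (n - 1) * (\<integral>\<^sup>+q. h q ^ n \<partial>sphere_measure)"
    by (rule nn_integral_hemisphere_fold_power[OF _ \<nu>(1)]) measurable
  also have "(\<kappa> * (1 / t)) ^ n / (\<kappa> * I / 2) ^ (n - 1) = 2 ^ (n - 1) * (\<kappa> / I ^ (n - 1) / t ^ n)"
    using pos t by (cases n) (auto simp: field_simps)
  also have "ennreal (2 ^ (n - 1) * (\<kappa> / I ^ (n - 1) / t ^ n)) = 2 ^ (n - 1) * ennreal (\<kappa> / I ^ (n - 1) / t ^ n)"
    using pos t by (subst ennreal_mult) (auto simp flip: ennreal_power)
  finally show ?thesis
    by (simp add: ennreal_mult_le_mult_iff power_eq_top_ennreal h_def n_def \<kappa>_def I_def cap_constant_def)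
qed

subsection \<open>The lower bound for the modulus metric\<close>

lemma nn_integral_power_ge_log:
  fixes \<rho> :: "'a::euclidean_space \<Rightarrow> ennreal" and m :: 'a
  assumes \<rho>[measurable]: "\<rho> \<in> borel_measurable borel" and r: "0 < r1" "r1 < r2" and C: "0 \<le> C"
    and spheres: "\<And>t. r1 < t \<Longrightarrow> t < r2 \<Longrightarrow> ennreal (C / t ^ DIM('a)) \<le>
        (\<integral>\<^sup>+q. \<rho> (m + t *\<^sub>R q) ^ DIM('a) \<partial>sphere_measure)"
  shows "ennreal (C * ln (r2 / r1)) \<le> (\<integral>\<^sup>+p. \<rho> p ^ DIM('a) \<partial>lborel)"
proof -
  let ?n = "DIM('a)"
  let ?F = "\<lambda>\<xi> q. ennreal (exp \<xi> ^ ?n) * \<rho> (m + exp \<xi> *\<^sub>R q) ^ ?n"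
  have "ennreal (C * ln (r2 / r1)) = (\<integral>\<^sup>+\<xi>. ennreal C * indicator {ln r1<..<ln r2} \<xi> \<partial>lborel)"
    using r C by (simp add: nn_integral_cmult ennreal_mult ln_div)
  also have "\<dots> \<le> (\<integral>\<^sup>+\<xi>. (\<integral>\<^sup>+q. ?F \<xi> q \<partial>sphere_measure) \<partial>lborel)"
  proof (rule nn_integral_mono)
    fix \<xi> :: real
    have "ennreal C \<le> (\<integral>\<^sup>+q. ?F \<xi> q \<partial>sphere_measure)" if "ln r1 < \<xi>" "\<xi> < ln r2"
    proof -
      have "r1 < exp \<xi>" "exp \<xi> < r2" using that r by (metis exp_less_cancel_iff exp_ln order_less_trans)+
      then have "ennreal (exp \<xi> ^ ?n) * ennreal (C / exp \<xi> ^ ?n) \<le>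
          ennreal (exp \<xi> ^ ?n) * (\<integral>\<^sup>+q. \<rho> (m + exp \<xi> *\<^sub>R q) ^ ?n \<partial>sphere_measure)"
        by (intro mult_left_mono spheres) auto
      then show ?thesis using C by (simp add: ennreal_mult[symmetric] nn_integral_cmult)
    qed
    then show "ennreal C * indicator {ln r1<..<ln r2} \<xi> \<le> (\<integral>\<^sup>+q. ?F \<xi> q \<partial>sphere_measure)"
      by (auto simp: indicator_def)
  qed
  also have "\<dots> = (\<integral>\<^sup>+p. radial_weight p * ?F (ln (norm p)) (sgn p) \<partial>lborel)"
    by (rule nn_integral_polar[symmetric]) measurable
  also have "\<dots> = (\<integral>\<^sup>+p. \<rho> (m + p) ^ ?n \<partial>lborel)"
  proof (rule nn_integral_cong_AE)
    show "AE p in lborel. radial_weight p * ?F (ln (norm p)) (sgn p) = \<rho> (m + p) ^ ?n"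
      using AE_lborel_singleton[of "0::'a"]
    proof eventually_elim
      case (elim p)
      then have "exp (ln (norm p)) = norm p" "norm p *\<^sub>R sgn p = p" by (auto simp: sgn_div_norm)
      moreover have "radial_weight p * ennreal (norm p ^ ?n) = 1"
        using elim by (simp add: radial_weight_def ennreal_mult[symmetric])
      ultimately show ?case by (simp add: mult.assoc[symmetric])
    qed
  qed
  also have "\<dots> = (\<integral>\<^sup>+p. \<rho> p ^ ?n \<partial>lborel)"
    by (rule nn_integral_lborel_translate) measurable
  finally show ?thesis .
qed

lemma modulus_ge_log:
  fixes E F D :: "(real ^ 'n) set" and m :: "real ^ 'n"
  assumes n: "2 \<le> CARD('n)" and r: "0 < r1" "r1 < r2"
    and E: "\<And>t. r1 < t \<Longrightarrow> t < r2 \<Longrightarrow> E \<inter> sphere m t \<noteq> {}"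
    and F: "\<And>t. r1 < t \<Longrightarrow> t < r2 \<Longrightarrow> F \<inter> sphere m t \<noteq> {}"
    and D: "\<And>t. r1 < t \<Longrightarrow> t < r2 \<Longrightarrow> sphere m t \<subseteq> D"
  shows "ennreal (cap_constant TYPE(real ^ 'n) * ln (r2 / r1)) \<le> modulus (joining_curves E F D)"
  unfolding modulus_def
proof (rule INF_greatest)
  fix \<rho> :: "real ^ 'n \<Rightarrow> ennreal" assume "\<rho> \<in> {\<rho>. admissible (joining_curves E F D) \<rho>}"
  then have \<rho>: "\<rho> \<in> borel_measurable borel"
    and adm: "\<And>\<gamma>. \<gamma> \<in> joining_curves E F D \<Longrightarrow> rectifiable \<gamma> \<Longrightarrow> 1 \<le> line_integral \<rho> \<gamma>"
    by (auto simp: admissible_def)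
  have dim: "2 \<le> DIM(real ^ 'n)" using n by simp
  have "ennreal (cap_constant TYPE(real ^ 'n) * ln (r2 / r1)) \<le> (\<integral>\<^sup>+p. \<rho> p ^ DIM(real ^ 'n) \<partial>lborel)"
  proof (rule nn_integral_power_ge_log[OF \<rho> r])
    show "0 \<le> cap_constant TYPE(real ^ 'n)" using cap_constant_pos[OF dim] by simp
    fix t assume t: "r1 < t" "t < r2"
    then have t0: "0 < t" using r by simp
    obtain x y where xy: "x \<in> E" "x \<in> sphere m t" "y \<in> F" "y \<in> sphere m t"
      using E[OF t] F[OF t] by blast
    define a b where "a = (1 / t) *\<^sub>R (x - m)" and "b = (1 / t) *\<^sub>R (y - m)"
    have ab: "norm a = 1" "norm b = 1" "m + t *\<^sub>R a = x" "m + t *\<^sub>R b = y"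
      using xy t0 by (auto simp: a_def b_def dist_norm norm_minus_commute)
    have "x \<noteq> y"
    proof
      assume "x = y"
      then have "(\<lambda>_. x) \<in> joining_curves E F D"
        using xy D[OF t] by (auto simp: joining_curves_def pathstart_def pathfinish_def path_def)
      from adm[OF this] show False by (simp add: line_integral_const \<rho>)
    qed
    then have "a \<noteq> b" using ab by metis
    then show "ennreal (cap_constant TYPE(real ^ 'n) / t ^ DIM(real ^ 'n)) \<le>
        (\<integral>\<^sup>+q. \<rho> (m + t *\<^sub>R q) ^ DIM(real ^ 'n) \<partial>sphere_measure)"
    proof (rule spherical_cap_inequality[OF dim \<rho> t0 ab(1,2)])
      fix \<gamma> assume \<gamma>: "path \<gamma>" "pathstart \<gamma> = m + t *\<^sub>R a" "pathfinish \<gamma> = m + t *\<^sub>R b"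
        "path_image \<gamma> \<subseteq> sphere m t" "rectifiable \<gamma>"
      have "\<gamma> ` {0<..<1} \<subseteq> path_image \<gamma>" unfolding path_image_def by (intro image_mono) auto
      then have "\<gamma> \<in> joining_curves E F D"
        using \<gamma> D[OF t] xy ab by (auto simp: joining_curves_def)
      then show "1 \<le> line_integral \<rho> \<gamma>" using \<gamma> by (intro adm)
    qed
  qed
  then show "ennreal (cap_constant TYPE(real ^ 'n) * ln (r2 / r1)) \<le> (\<integral>\<^sup>+p. \<rho> p ^ CARD('n) \<partial>lborel)" by simp
qed

lemma tends_to_boundary_leaves_compact:
  fixes D :: "'a::euclidean_space set"
  assumes "tends_to_boundary \<gamma> D" "open D" "compact K" "K \<subseteq> D"
  shows "\<forall>\<^sub>F t in at_left 1. \<gamma> t \<notin> K"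
proof -
  let ?U = "- (Some ` K) :: 'a option set"
  have "closedin euclidean K" "compactin euclidean K" using assms by (auto simp: compact_imp_closed)
  then have "openin extended_space (insert None (Some ` (topspace euclidean - K)))"
    unfolding openin_Alexandroff_compactification by blast
  moreover have "insert None (Some ` (topspace euclidean - K)) = ?U"
  proof (rule set_eqI)
    fix z :: "'a option"
    show "z \<in> insert None (Some ` (topspace euclidean - K)) \<longleftrightarrow> z \<in> ?U" by (cases z) auto
  qed
  ultimately have U: "openin extended_space ?U" by simp
  have "openin extended_space (Some ` D)"
    unfolding openin_Alexandroff_compactification using assms(2) by auto
  then have "Some ` D \<subseteq> extended_space interior_of (Some ` D)" by (simp add: interior_of_openin)
  then have "extended_boundary D \<subseteq> - (Some ` D)"
    by (auto simp: extended_boundary_def frontier_of_def)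
  then have "extended_boundary D \<subseteq> ?U" using assms(4) by auto
  with assms(1) U have "\<forall>\<^sub>F t in at_left 1. Some (\<gamma> t) \<in> ?U" unfolding tends_to_boundary_def by blast
  then show ?thesis by eventually_elim auto
qed

lemma curve_to_boundary_meets_sphere:
  fixes D :: "'a::euclidean_space set"
  assumes C: "C \<in> curves_to_boundary D z" and "open D" "cball m t \<subseteq> D" "dist m z < t"
  shows "C \<inter> sphere m t \<noteq> {}"
proof -
  obtain \<gamma> where \<gamma>: "C = \<gamma> ` {0..<1}" "continuous_on {0..<1} \<gamma>" "\<gamma> 0 = z" "tends_to_boundary \<gamma> D"
    using C by (auto simp: curves_to_boundary_def)
  have "\<forall>\<^sub>F s in at_left 1. \<gamma> s \<notin> cball m t"
    using tends_to_boundary_leaves_compact[OF \<gamma>(4) assms(2) compact_cball assms(3)] .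
  moreover have "\<forall>\<^sub>F s in at_left (1::real). s \<in> {0<..<1}"
    using eventually_at_left_real[of 0 1] by simp
  ultimately have "\<forall>\<^sub>F s in at_left (1::real). s \<in> {0<..<1} \<and> \<gamma> s \<notin> cball m t" by eventually_elim auto
  then obtain s where s: "0 < s" "s < 1" "\<gamma> s \<notin> cball m t"
    using eventually_happens[of _ "at_left (1::real)"] by (auto simp: trivial_limit_at_left_real)
  have "continuous_on {0..s} (\<lambda>x. dist m (\<gamma> x))"
    using s by (intro continuous_intros continuous_on_subset[OF \<gamma>(2)]) auto
  then obtain x where "0 \<le> x" "x \<le> s" "dist m (\<gamma> x) = t"
    using IVT'[of "\<lambda>x. dist m (\<gamma> x)" 0 t s] s assms(4) \<gamma>(3) by auto
  then have "\<gamma> x \<in> C \<inter> sphere m t" using \<gamma>(1) s by auto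
  then show ?thesis by blast
qed

lemma lambda_mod_ge_log:
  fixes D :: "(real ^ 'n) set"
  assumes n: "2 \<le> CARD('n)" and D: "open D" "ball x d \<subseteq> D" and xy: "x \<noteq> y" "dist x y < d"
  shows "ennreal (cap_constant TYPE(real ^ 'n) * ln (2 * (d / dist x y) - 1)) \<le> lambda_mod D x y"
  unfolding lambda_mod_def
proof (rule INF_greatest, clarify)
  fix Cx Cy assume C: "Cx \<in> curves_to_boundary D x" "Cy \<in> curves_to_boundary D y"
  define r where "r = dist x y"
  define m where "m = midpoint x y"
  have r: "0 < r" "r < d" using xy by (auto simp: r_def)
  have m: "dist m x = r / 2" "dist m y = r / 2" by (auto simp: m_def r_def dist_midpoint)
  have inside: "cball m t \<subseteq> D" if "t < d - r / 2" for t
  proof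
    fix p assume "p \<in> cball m t"
    then have "dist x p < d" using dist_triangle[of x p m] m that by (auto simp: dist_commute)
    then show "p \<in> D" using D(2) by auto
  qed
  have "ennreal (cap_constant TYPE(real ^ 'n) * ln ((d - r/2) / (r/2))) \<le> modulus (joining_curves Cx Cy D)"
  proof (rule modulus_ge_log[OF n])
    fix t assume t: "r / 2 < t" "t < d - r / 2"
    show "Cx \<inter> sphere m t \<noteq> {}" "Cy \<inter> sphere m t \<noteq> {}"
      using curve_to_boundary_meets_sphere[OF _ D(1) inside[OF t(2)]] C t(1) m by auto
    show "sphere m t \<subseteq> D" using inside[OF t(2)] by auto
  qed (use r in auto)
  moreover have "(d - r/2) / (r/2) = 2 * (d / dist x y) - 1" using r by (simp add: r_def[symmetric] field_simps)
  ultimately show "ennreal (cap_constant TYPE(real ^ 'n) * ln (2 * (d / dist x y) - 1)) \<le>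
      modulus (joining_curves Cx Cy D)" by simp
qed

subsection \<open>Spheroidal coordinates\<close>

text \<open>For a point at distance \<open>T\<close> from \<open>0\<close> and angle \<open>arccos c\<close> to a unit vector \<open>e\<close>, \<open>focal_dist T c\<close> is its
  distance to \<open>e\<close>, and \<open>spheroidal_cos T c\<close> is the cosine of the angular coordinate of the prolate
  spheroidal system with foci \<open>0\<close> and \<open>e\<close>.\<close>

definition focal_dist :: "real \<Rightarrow> real \<Rightarrow> real" where
  "focal_dist T c = sqrt (T\<^sup>2 + 1 - 2 * T * c)"

definition spheroidal_cos :: "real \<Rightarrow> real \<Rightarrow> real" where
  "spheroidal_cos T c = T - focal_dist T c"

lemma spheroidal_measurable [measurable]:
  "(\<lambda>(T, c). focal_dist T c) \<in> borel_measurable (borel \<Otimes>\<^sub>M borel)"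
  "(\<lambda>(T, c). spheroidal_cos T c) \<in> borel_measurable (borel \<Otimes>\<^sub>M borel)"
  unfolding focal_dist_def spheroidal_cos_def by measurable

lemma focal_dist_sq:
  assumes "\<bar>c\<bar> \<le> 1"
  shows "(focal_dist T c)\<^sup>2 = T\<^sup>2 + 1 - 2 * T * c" "(focal_dist T c)\<^sup>2 = (T - c)\<^sup>2 + (1 - c\<^sup>2)"
proof -
  have "c\<^sup>2 \<le> 1" using assms by (simp add: abs_square_le_1)
  moreover have square: "T\<^sup>2 + 1 - 2 * T * c = (T - c)\<^sup>2 + (1 - c\<^sup>2)"
    by (simp add: power2_eq_square algebra_simps)
  ultimately have "0 \<le> T\<^sup>2 + 1 - 2 * T * c" unfolding square by simp
  then show "(focal_dist T c)\<^sup>2 = T\<^sup>2 + 1 - 2 * T * c" by (simp add: focal_dist_def)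
  with square show "(focal_dist T c)\<^sup>2 = (T - c)\<^sup>2 + (1 - c\<^sup>2)" by simp
qed

lemma focal_dist_nonneg: "\<bar>c\<bar> \<le> 1 \<Longrightarrow> 0 \<le> focal_dist T c"
  using focal_dist_sq[of c T] by (metis focal_dist_def real_sqrt_ge_zero zero_le_power2)

lemma focal_dist_ge:
  assumes "\<bar>c\<bar> \<le> 1"
  shows "T - c \<le> focal_dist T c" "sqrt (1 - c\<^sup>2) \<le> focal_dist T c"
proof -
  have "c\<^sup>2 \<le> 1" using assms by (simp add: abs_square_le_1)
  then show "T - c \<le> focal_dist T c" "sqrt (1 - c\<^sup>2) \<le> focal_dist T c"
    using focal_dist_sq(2)[OF assms, of T] focal_dist_nonneg[OF assms, of T]
    by (auto intro: power2_le_imp_le)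
qed

lemma focal_dist_bounds:
  assumes "\<bar>c\<bar> \<le> 1" "0 < T"
  shows "\<bar>T - 1\<bar> \<le> focal_dist T c" "focal_dist T c \<le> T + 1"
proof -
  have "T * c \<le> T" "- T \<le> T * c"
    using assms mult_left_mono[of "-1" c T] by (simp_all add: mult_left_le abs_le_iff)
  then have "\<bar>T - 1\<bar>\<^sup>2 \<le> (focal_dist T c)\<^sup>2" "(focal_dist T c)\<^sup>2 \<le> (T + 1)\<^sup>2"
    unfolding focal_dist_sq(1)[OF assms(1)] by (simp_all add: power2_eq_square algebra_simps)
  then show "\<bar>T - 1\<bar> \<le> focal_dist T c" "focal_dist T c \<le> T + 1"
    using focal_dist_nonneg[OF assms(1), of T] assms(2) by (auto intro: power2_le_imp_le)
qed

lemma spheroidal_cos_bounds: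
  assumes "\<bar>c\<bar> \<le> 1" "0 < T"
  shows "-1 \<le> spheroidal_cos T c" "spheroidal_cos T c \<le> 1"
  using focal_dist_bounds[OF assms] by (auto simp: spheroidal_cos_def)

lemma one_minus_spheroidal_cos_sq:
  assumes "\<bar>c\<bar> \<le> 1"
  shows "1 - (spheroidal_cos T c)\<^sup>2 = 2 * T * (c - spheroidal_cos T c)"
  using focal_dist_sq(1)[OF assms, of T] by (simp add: spheroidal_cos_def power2_eq_square algebra_simps)

lemma spheroidal_cos_near_cos:
  assumes "\<bar>c\<bar> \<le> 1" "0 < T"
  shows "spheroidal_cos T c \<le> c" "c - spheroidal_cos T c \<le> 1 / (2 * T)"
proof -
  show "spheroidal_cos T c \<le> c" using focal_dist_ge(1)[OF assms(1), of T] by (simp add: spheroidal_cos_def)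
  have "2 * T * (c - spheroidal_cos T c) \<le> 1"
    using one_minus_spheroidal_cos_sq[OF assms(1), of T] zero_le_power2[of "spheroidal_cos T c"] by linarith
  then show "c - spheroidal_cos T c \<le> 1 / (2 * T)" using assms by (simp add: field_simps)
qed

lemma spheroidal_cos_ends: "0 < T \<Longrightarrow> spheroidal_cos T (-1) = -1" "1 \<le> T \<Longrightarrow> spheroidal_cos T 1 = 1"
proof -
  have squares: "T\<^sup>2 + 1 - 2 * T * (-1) = (T + 1)\<^sup>2" "T\<^sup>2 + 1 - 2 * T * 1 = (T - 1)\<^sup>2"
    by (simp_all add: power2_eq_square algebra_simps)
  show "0 < T \<Longrightarrow> spheroidal_cos T (-1) = -1" "1 \<le> T \<Longrightarrow> spheroidal_cos T 1 = 1"
    unfolding spheroidal_cos_def focal_dist_def squares by auto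
qed

lemma focal_dist_pos:
  assumes "\<bar>c\<bar> \<le> 1" "0 < T" "spheroidal_cos T c < 1"
  shows "0 < focal_dist T c"
proof (rule ccontr)
  assume "\<not> 0 < focal_dist T c"
  then have "focal_dist T c = 0" using focal_dist_nonneg[OF assms(1), of T] by linarith
  then show False using focal_dist_bounds(1)[OF assms(1,2)] assms(3) by (simp add: spheroidal_cos_def)
qed

lemma one_minus_cos_sq_eq_focal:
  assumes "\<bar>c\<bar> \<le> 1"
  shows "1 - c\<^sup>2 = (focal_dist T c - (T - c)) * (focal_dist T c + (T - c))"
  using focal_dist_sq(2)[OF assms, of T] by (simp add: power2_eq_square algebra_simps)

lemma one_minus_spheroidal_cos_sq_eq_focal:
  assumes "\<bar>c\<bar> \<le> 1"
  shows "1 - (spheroidal_cos T c)\<^sup>2 = 2 * T * (focal_dist T c - (T - c))"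
  using one_minus_spheroidal_cos_sq[OF assms, of T] by (simp add: spheroidal_cos_def algebra_simps)

lemma one_minus_cos_sq_le_spheroidal:
  assumes "\<bar>c\<bar> \<le> 1" "0 < T"
  shows "T * (1 - c\<^sup>2) \<le> (1 - (spheroidal_cos T c)\<^sup>2) * focal_dist T c"
proof -
  let ?d = "focal_dist T c" let ?a = "T - c"
  have a: "?a \<le> ?d" by (rule focal_dist_ge[OF assms(1)])
  have "T * (1 - c\<^sup>2) = T * ((?d - ?a) * (?d + ?a))"
    using one_minus_cos_sq_eq_focal[OF assms(1), of T] by simp
  also have "\<dots> \<le> T * ((?d - ?a) * (2 * ?d))" using a assms(2) by (intro mult_left_mono) auto
  also have "\<dots> = (1 - (spheroidal_cos T c)\<^sup>2) * ?d"
    unfolding one_minus_spheroidal_cos_sq_eq_focal[OF assms(1)] by simp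
  finally show ?thesis .
qed

text \<open>The left hand side is \<open>focal_dist T c\<close> squared times the squared norm of the gradient of the
  coordinate \<open>spheroidal_cos\<close>, split into its parts orthogonal and parallel to the position vector.\<close>

lemma spheroidal_gradient_identity:
  assumes "\<bar>c\<bar> \<le> 1"
  shows "T\<^sup>2 * (1 - c\<^sup>2) + ((1 - (spheroidal_cos T c)\<^sup>2) / 2)\<^sup>2 =
      T * focal_dist T c * (1 - (spheroidal_cos T c)\<^sup>2)"
proof -
  have half: "2 * T * u / 2 = T * u" for u by simp
  show ?thesis
    unfolding one_minus_cos_sq_eq_focal[OF assms, of T] one_minus_spheroidal_cos_sq_eq_focal[OF assms] half
    by (simp add: power2_eq_square algebra_simps)
qed

lemma spheroidal_cos_strict:
  assumes "\<bar>c\<bar> < 1" "0 < T"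
  shows "-1 < spheroidal_cos T c" "spheroidal_cos T c < 1" "0 < focal_dist T c"
proof -
  have c: "\<bar>c\<bar> \<le> 1" "c\<^sup>2 < 1" using assms(1) by (auto simp: abs_square_less_1)
  have "0 < T * (1 - c\<^sup>2)" using c assms by simp
  then have "0 < (1 - (spheroidal_cos T c)\<^sup>2) * focal_dist T c"
    using one_minus_cos_sq_le_spheroidal[OF c(1) assms(2)] by linarith
  with focal_dist_nonneg[OF c(1), of T] have "(spheroidal_cos T c)\<^sup>2 < 1" "0 < focal_dist T c"
    by (auto simp: zero_less_mult_iff)
  then show "-1 < spheroidal_cos T c" "spheroidal_cos T c < 1" "0 < focal_dist T c"
    by (auto simp: abs_square_less_1 abs_less_iff)
qed

lemma one_minus_cos_sq_eq_spheroidal: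
  assumes "\<bar>c\<bar> < 1" "0 < T"
  defines "y \<equiv> spheroidal_cos T c"
  shows "1 - c\<^sup>2 = (1 - y\<^sup>2) * ((2 * T - y)\<^sup>2 - 1) / (4 * T\<^sup>2)" "1 < 2 * T - y"
proof -
  note strict = spheroidal_cos_strict[OF assms(1,2), folded y_def]
  have c: "c = y + (1 - y\<^sup>2) / (2 * T)"
    using one_minus_spheroidal_cos_sq[of c T] assms by (simp add: field_simps)
  have minus: "1 - c = (1 - y) * (2 * T - 1 - y) / (2 * T)"
    by (subst c) (use assms(2) in \<open>simp add: field_simps power2_eq_square\<close>)
  have plus: "1 + c = (1 + y) * (2 * T + 1 - y) / (2 * T)"
    by (subst c) (use assms(2) in \<open>simp add: field_simps power2_eq_square\<close>)
  have "0 < (1 - y) * (2 * T - 1 - y) / (2 * T)" unfolding minus[symmetric] using assms(1) by simp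
  then show "1 < 2 * T - y" using strict assms(2) by (simp add: zero_less_divide_iff zero_less_mult_iff)
  have "1 - c\<^sup>2 = (1 - c) * (1 + c)" by (simp add: power2_eq_square algebra_simps)
  also have "\<dots> = (1 - y\<^sup>2) * ((2 * T - y)\<^sup>2 - 1) / (4 * T\<^sup>2)"
    unfolding minus plus by (simp add: power2_eq_square field_simps)
  finally show "1 - c\<^sup>2 = (1 - y\<^sup>2) * ((2 * T - y)\<^sup>2 - 1) / (4 * T\<^sup>2)" .
qed

lemma spheroidal_cos_has_real_derivative:
  assumes "0 < T"
  shows "((\<lambda>s. spheroidal_cos T (cos_of_cot s)) has_real_derivative
     T / focal_dist T (cos_of_cot s) * (1 + s\<^sup>2) powr (- 3/2)) (at s)"
proof -
  have "0 < T\<^sup>2 + 1 - 2 * T * cos_of_cot s"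
    using spheroidal_cos_strict(3)[OF abs_cos_of_cot_less assms, of s] by (simp add: focal_dist_def)
  then have "(spheroidal_cos T has_real_derivative T / focal_dist T (cos_of_cot s)) (at (cos_of_cot s))"
    unfolding spheroidal_cos_def focal_dist_def
    by (auto intro!: derivative_eq_intros simp: field_simps)
  from DERIV_chain2[OF this cos_of_cot_has_derivative] show ?thesis .
qed

subsection \<open>The energy of the spheroidal potential\<close>

text \<open>The potential with values 1 and 0 on the rays \<open>c = -1\<close> and \<open>T \<ge> 1, c = 1\<close> is a function of
  \<open>spheroidal_cos\<close> with derivative proportional to \<open>ring_density\<close>; \<open>spheroidal_slope\<close> is \<open>T\<close> times the norm
  of its gradient.\<close>

definition ring_density :: "nat \<Rightarrow> real \<Rightarrow> real" where
  "ring_density n y = (1 - y\<^sup>2) powr (cap_exponent n - 3/2)"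

definition spheroidal_slope :: "nat \<Rightarrow> real \<Rightarrow> real \<Rightarrow> real" where
  "spheroidal_slope n T c =
     1 / cap_integral n * (1 - (spheroidal_cos T c)\<^sup>2) powr (cap_exponent n - 1) * sqrt (T / focal_dist T c)"

definition sphere_energy :: "nat \<Rightarrow> real \<Rightarrow> ennreal" where
  "sphere_energy n T = (\<integral>\<^sup>+s. ennreal ((1 + s\<^sup>2) powr (- real n / 2)) *
     ennreal (spheroidal_slope n T (cos_of_cot s) ^ n) \<partial>lborel)"

definition focal_kernel :: "real \<Rightarrow> real \<Rightarrow> ennreal" where
  "focal_kernel T y = indicator {1<..} (2 * T - y) * ennreal (2 * T / sqrt ((2 * T - y)\<^sup>2 - 1))"

lemma ring_density_measurable [measurable]: "ring_density n \<in> borel_measurable borel"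
  unfolding ring_density_def by measurable

lemma spheroidal_slope_measurable [measurable]:
  "(\<lambda>(T, c). spheroidal_slope n T c) \<in> borel_measurable (borel \<Otimes>\<^sub>M borel)"
  unfolding spheroidal_slope_def by measurable

lemma sphere_energy_measurable [measurable]: "sphere_energy n \<in> borel_measurable borel"
  unfolding sphere_energy_def by measurable

lemma focal_kernel_measurable [measurable]:
  "(\<lambda>(T, y). focal_kernel T y) \<in> borel_measurable (borel \<Otimes>\<^sub>M borel)"
  unfolding focal_kernel_def by measurable

lemma ring_density_nonneg: "0 \<le> ring_density n y"
  by (simp add: ring_density_def)

lemma spheroidal_slope_nonneg:
  assumes "2 \<le> n" "0 < T" "\<bar>c\<bar> \<le> 1"
  shows "0 \<le> spheroidal_slope n T c"
  unfolding spheroidal_slope_def using cap_integral_pos[OF assms(1)] focal_dist_nonneg[OF assms(3)] assms(2)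
  by simp

lemma nn_integral_ring_density:
  assumes "2 \<le> n"
  shows "(\<integral>\<^sup>+y\<in>{-1<..<1}. ennreal (ring_density n y) \<partial>lborel) = ennreal (cap_integral n)"
proof -
  have "(\<integral>\<^sup>+y\<in>{-1<..<1}. ennreal (ring_density n y) \<partial>lborel) =
    (\<integral>\<^sup>+s. ennreal (ring_density n (cos_of_cot s)) * ennreal ((1 + s\<^sup>2) powr (- 3/2)) \<partial>lborel)"
    by (subst nn_integral_substitution_UNIV[OF _ cos_of_cot_has_derivative])
       (auto intro!: continuous_intros simp: range_cos_of_cot)
  also have "\<dots> = (\<integral>\<^sup>+s. ennreal ((1 + s\<^sup>2) powr (- cap_exponent n)) \<partial>lborel)"
    by (simp add: ring_density_def one_minus_cos_of_cot_sq_powr ennreal_mult[symmetric] powr_add[symmetric])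
  also have "\<dots> = ennreal (cap_integral n)"
    unfolding cap_integral_def by (rule nn_integral_cot[OF cap_exponent_gt_half[OF assms]])
  finally show ?thesis .
qed

lemma spheroidal_slope_power_le:
  assumes n: "2 \<le> n" and c: "\<bar>c\<bar> < 1" and T: "0 < T"
  defines "y \<equiv> spheroidal_cos T c" and "x \<equiv> (1 - c\<^sup>2) * (T / focal_dist T c)"
  shows "(1 - c\<^sup>2) powr (real n / 2) * spheroidal_slope n T c ^ n \<le>
    1 / cap_integral n ^ n * (x * (1 - y\<^sup>2) powr (cap_exponent n - 1))"
proof -
  note strict = spheroidal_cos_strict[OF c T, folded y_def]
  have c2: "0 < 1 - c\<^sup>2" using c by (simp add: abs_square_less_1)
  have y2: "0 < 1 - y\<^sup>2" using strict by (simp add: abs_square_less_1 abs_less_iff)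
  have x: "0 < x" using c2 T strict(3) by (simp add: x_def)
  have x_le: "x \<le> 1 - y\<^sup>2"
    using one_minus_cos_sq_le_spheroidal[of c T] c T strict(3) by (simp add: x_def y_def[symmetric] field_simps)
  have "sqrt (T / focal_dist T c) ^ n = (T / focal_dist T c) powr (real n / 2)"
    using T strict(3) by (simp add: powr_half_sqrt[symmetric] powr_power)
  moreover have "((1 - y\<^sup>2) powr (cap_exponent n - 1)) ^ n = (1 - y\<^sup>2) powr (real n * (cap_exponent n - 1))"
    using y2 by (simp add: powr_power mult.commute)
  moreover have "x powr (real n / 2) = (1 - c\<^sup>2) powr (real n / 2) * (T / focal_dist T c) powr (real n / 2)"
    unfolding x_def by (rule powr_mult)
  ultimately have "(1 - c\<^sup>2) powr (real n / 2) * spheroidal_slope n T c ^ n =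
      1 / cap_integral n ^ n * (x powr (real n / 2) * (1 - y\<^sup>2) powr (real n * (cap_exponent n - 1)))"
    unfolding spheroidal_slope_def y_def[symmetric] by (simp add: power_mult_distrib power_divide)
  also have "x powr (real n / 2) = x * x powr ((real n - 2) / 2)"
    using x powr_add[of x 1 "(real n - 2) / 2"] by (simp add: diff_divide_distrib)
  also have "1 / cap_integral n ^ n * (x * x powr ((real n - 2) / 2) *
      (1 - y\<^sup>2) powr (real n * (cap_exponent n - 1))) \<le>
      1 / cap_integral n ^ n * (x * (1 - y\<^sup>2) powr ((real n - 2) / 2) *
        (1 - y\<^sup>2) powr (real n * (cap_exponent n - 1)))"
    using x x_le n cap_integral_pos[OF n] by (intro mult_left_mono mult_right_mono powr_mono2) auto
  also have "x * (1 - y\<^sup>2) powr ((real n - 2) / 2) * (1 - y\<^sup>2) powr (real n * (cap_exponent n - 1)) =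
      x * (1 - y\<^sup>2) powr ((real n - 2) / 2 + real n * (cap_exponent n - 1))"
    by (simp add: powr_add)
  also have "(real n - 2) / 2 + real n * (cap_exponent n - 1) = cap_exponent n - 1"
    using n by (simp add: cap_exponent_def field_simps)
  finally show ?thesis .
qed

lemma ring_density_focal_kernel:
  assumes c: "\<bar>c\<bar> < 1" and T: "0 < T"
  defines "y \<equiv> spheroidal_cos T c" and "x \<equiv> (1 - c\<^sup>2) * (T / focal_dist T c)"
  shows "ennreal (ring_density n y) * focal_kernel T y * ennreal (T / focal_dist T c * (1 - c\<^sup>2) powr (3/2)) =
    ennreal (x * (1 - y\<^sup>2) powr (cap_exponent n - 1))"
proof -
  note strict = spheroidal_cos_strict[OF c T, folded y_def]
  note eq = one_minus_cos_sq_eq_spheroidal[OF c T, folded y_def]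
  have c2: "0 < 1 - c\<^sup>2" using c by (simp add: abs_square_less_1)
  have y2: "0 < 1 - y\<^sup>2" using strict by (simp add: abs_square_less_1 abs_less_iff)
  have kernel: "2 * T / sqrt ((2 * T - y)\<^sup>2 - 1) = sqrt (1 - y\<^sup>2) / sqrt (1 - c\<^sup>2)"
  proof -
    have q: "0 < (2 * T - y)\<^sup>2 - 1" using eq(2) by (simp add: power2_eq_square) (metis less_1_mult)
    have "(1 - y\<^sup>2) / (1 - c\<^sup>2) = (2 * T)\<^sup>2 / ((2 * T - y)\<^sup>2 - 1)"
      using y2 q T unfolding eq(1) by (simp add: power2_eq_square)
    moreover have "sqrt ((2 * T)\<^sup>2) = 2 * T" using T by (intro real_sqrt_unique) auto
    ultimately show ?thesis by (metis real_sqrt_divide)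
  qed
  have "(1 - c\<^sup>2) powr (3/2) = (1 - c\<^sup>2) * sqrt (1 - c\<^sup>2)"
    using c2 powr_add[of "1 - c\<^sup>2" 1 "1/2"] by (simp add: powr_half_sqrt)
  moreover have "(1 - y\<^sup>2) powr (cap_exponent n - 1) = sqrt (1 - y\<^sup>2) * ring_density n y"
    using y2 powr_add[of "1 - y\<^sup>2" "1/2" "cap_exponent n - 3/2"] by (simp add: powr_half_sqrt ring_density_def)
  ultimately have "ring_density n y * (2 * T / sqrt ((2 * T - y)\<^sup>2 - 1)) *
      (T / focal_dist T c * (1 - c\<^sup>2) powr (3/2)) =
      x * (1 - y\<^sup>2) powr (cap_exponent n - 1)"
    unfolding kernel using c2 by (simp add: x_def)
  moreover have "focal_kernel T y = ennreal (2 * T / sqrt ((2 * T - y)\<^sup>2 - 1))"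
    using eq(2) by (simp add: focal_kernel_def)
  moreover have "0 \<le> T / focal_dist T c * (1 - c\<^sup>2) powr (3/2)" "0 \<le> 2 * T / sqrt ((2 * T - y)\<^sup>2 - 1)"
    using T strict(3) unfolding kernel using y2 c2 by auto
  ultimately show ?thesis
    using ring_density_nonneg[of n y] by (simp only: ennreal_mult[symmetric] mult_nonneg_nonneg)
qed

lemma sphere_energy_integrand_le:
  fixes s :: real
  assumes n: "2 \<le> n" and T: "0 < T"
  defines "c \<equiv> cos_of_cot s"
  shows "ennreal ((1 + s\<^sup>2) powr (- real n / 2)) * ennreal (spheroidal_slope n T c ^ n) \<le>
    ennreal (1 / cap_integral n ^ n) * (ennreal (ring_density n (spheroidal_cos T c)) *
      focal_kernel T (spheroidal_cos T c) *
      indicator {-1<..<1} (spheroidal_cos T c) * ennreal (T / focal_dist T c * (1 + s\<^sup>2) powr (- 3/2)))"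
proof -
  let ?f = "\<lambda>y. ennreal (ring_density n y) * focal_kernel T y * indicator {-1<..<1} y"
  have c: "\<bar>c\<bar> < 1" unfolding c_def by (rule abs_cos_of_cot_less)
  have s: "(1 + s\<^sup>2) powr (- p) = (1 - c\<^sup>2) powr p" for p
    unfolding c_def by (rule one_minus_cos_of_cot_sq_powr[symmetric])
  let ?x = "(1 - c\<^sup>2) * (T / focal_dist T c)" and ?y = "spheroidal_cos T c"
  have "ennreal ((1 - c\<^sup>2) powr (real n / 2) * spheroidal_slope n T c ^ n) \<le>
      ennreal (1 / cap_integral n ^ n * (?x * (1 - ?y\<^sup>2) powr (cap_exponent n - 1)))"
    by (rule ennreal_leI) (rule spheroidal_slope_power_le[OF n c T])
  also have "\<dots> = ennreal (1 / cap_integral n ^ n) * ennreal (?x * (1 - ?y\<^sup>2) powr (cap_exponent n - 1))"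
    using cap_integral_pos[OF n] by (intro ennreal_mult') auto
  also have "\<dots> = ennreal (1 / cap_integral n ^ n) * (?f ?y * ennreal (T / focal_dist T c * (1 - c\<^sup>2) powr (3/2)))"
    using spheroidal_cos_strict[OF c T] ring_density_focal_kernel[OF c T] by simp
  finally show ?thesis
    using s[of "real n / 2"] s[of "3/2"] spheroidal_slope_nonneg[OF n T, of c] c
    by (simp add: ennreal_mult)
qed

lemma sphere_energy_le:
  assumes n: "2 \<le> n" and T: "0 < T"
  shows "sphere_energy n T \<le> ennreal (1 / cap_integral n ^ n) *
    (\<integral>\<^sup>+y\<in>{-1<..<1}. ennreal (ring_density n y) * focal_kernel T y \<partial>lborel)"
proof -
  let ?f = "\<lambda>y. ennreal (ring_density n y) * focal_kernel T y * indicator {-1<..<1} y"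
  let ?g = "\<lambda>s. spheroidal_cos T (cos_of_cot s)"
  let ?g' = "\<lambda>s. T / focal_dist T (cos_of_cot s) * (1 + s\<^sup>2) powr (- 3/2)"
  have "sphere_energy n T \<le> (\<integral>\<^sup>+s. ennreal (1 / cap_integral n ^ n) * (?f (?g s) * ennreal (?g' s)) \<partial>lborel)"
    unfolding sphere_energy_def by (rule nn_integral_mono) (rule sphere_energy_integrand_le[OF n T])
  also have "\<dots> = ennreal (1 / cap_integral n ^ n) * (\<integral>\<^sup>+s. ?f (?g s) * ennreal (?g' s) \<partial>lborel)"
    by (rule nn_integral_cmult) measurable
  also have "(\<integral>\<^sup>+s. ?f (?g s) * ennreal (?g' s) \<partial>lborel) = (\<integral>\<^sup>+y\<in>range ?g. ?f y \<partial>lborel)"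
  proof (rule nn_integral_substitution_UNIV)
    have pos: "0 < focal_dist T (cos_of_cot s)" for s by (rule spheroidal_cos_strict(3)[OF abs_cos_of_cot_less T])
    show "(?g has_real_derivative ?g' s) (at s)" for s by (rule spheroidal_cos_has_real_derivative[OF T])
    show "0 \<le> ?g' s" for s using pos[of s] T by simp
    have "continuous_on UNIV (\<lambda>s. focal_dist T (cos_of_cot s))"
      unfolding focal_dist_def by (intro continuous_intros)
    then show "continuous_on UNIV ?g'"
      using pos by (intro continuous_intros) (auto simp: less_le)
  qed measurable
  also have "\<dots> \<le> (\<integral>\<^sup>+y. ?f y \<partial>lborel)"
    by (rule nn_integral_mono) (auto simp: indicator_def)
  finally show ?thesis by (simp add: mult_left_mono)
qed

lemma cap_integral_power_cancel:
  assumes n: "2 \<le> n"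
  shows "ennreal (1 / cap_integral n ^ n) * ennreal (cap_integral n) = ennreal (1 / cap_integral n ^ (n - 1))"
proof -
  have "1 / cap_integral n ^ n * cap_integral n = 1 / cap_integral n ^ (n - 1)"
    using n cap_integral_pos[OF n] by (cases n) auto
  then show ?thesis using cap_integral_pos[OF n] by (simp add: ennreal_mult[symmetric])
qed

lemma focal_kernel_le:
  assumes T: "2 \<le> T" and y: "-1 < y" "y < 1"
  shows "focal_kernel T y \<le> ennreal (3/2)"
proof -
  have "(2 * T - 1)\<^sup>2 \<le> (2 * T - y)\<^sup>2" using T y by (intro power_mono) auto
  then have "4 * T * (T - 1) \<le> (2 * T - y)\<^sup>2 - 1" by (simp add: power2_eq_square algebra_simps)
  moreover have "4 * T * (T / 2) \<le> 4 * T * (T - 1)" using T by (intro mult_left_mono) auto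
  moreover have "(4/3 * T)\<^sup>2 \<le> 4 * T * (T / 2)" by (simp add: power2_eq_square)
  ultimately have "(4/3 * T)\<^sup>2 \<le> (2 * T - y)\<^sup>2 - 1" by linarith
  then have "4/3 * T \<le> sqrt ((2 * T - y)\<^sup>2 - 1)" by (rule real_le_rsqrt)
  moreover from this T have "0 < sqrt ((2 * T - y)\<^sup>2 - 1)" by linarith
  ultimately have "2 * T / sqrt ((2 * T - y)\<^sup>2 - 1) \<le> 3/2" by (subst pos_divide_le_eq) auto
  then show ?thesis by (auto simp: focal_kernel_def indicator_def intro: ennreal_leI)
qed

lemma sphere_energy_le_const:
  assumes n: "2 \<le> n" and T: "2 \<le> T"
  shows "sphere_energy n T \<le> ennreal (3/2 * (1 / cap_integral n ^ (n - 1)))"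
proof -
  have "sphere_energy n T \<le> ennreal (1 / cap_integral n ^ n) *
      (\<integral>\<^sup>+y\<in>{-1<..<1}. ennreal (ring_density n y) * focal_kernel T y \<partial>lborel)"
    using T by (intro sphere_energy_le[OF n]) auto
  also have "\<dots> \<le> ennreal (1 / cap_integral n ^ n) *
      (\<integral>\<^sup>+y. ennreal (ring_density n y) * indicator {-1<..<1} y * ennreal (3/2) \<partial>lborel)"
    using focal_kernel_le[OF T] by (intro mult_left_mono nn_integral_mono)
      (auto simp: indicator_def intro!: mult_left_mono)
  also have "\<dots> = ennreal (1 / cap_integral n ^ n) * ennreal (cap_integral n) * ennreal (3/2)"
    by (subst nn_integral_multc) (auto simp: nn_integral_ring_density[OF n] mult.assoc)
  also have "\<dots> = ennreal (3/2 * (1 / cap_integral n ^ (n - 1)))"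
    unfolding cap_integral_power_cancel[OF n] using cap_integral_pos[OF n]
    by (subst ennreal_mult[symmetric]) (auto simp: mult.commute)
  finally show ?thesis .
qed

lemma arcosh_le_ln_double:
  fixes w :: real
  assumes "1 \<le> w"
  shows "arcosh w \<le> ln (2 * w)"
proof -
  have "sqrt (w\<^sup>2 - 1) \<le> w" using assms by (intro real_le_lsqrt) auto
  moreover have "0 < w + sqrt (w\<^sup>2 - 1)" using assms by (intro add_pos_nonneg) (auto intro: one_le_power)
  ultimately show ?thesis using assms by (subst arcosh_real_def) auto
qed

lemma integral_focal_antiderivative:
  fixes y :: real
  defines "f \<equiv> \<lambda>\<xi>. 2 * exp \<xi> / sqrt ((2 * exp \<xi> - y)\<^sup>2 - 1)" and "F \<equiv> \<lambda>\<xi>. arcosh (2 * exp \<xi> - y)"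
  assumes start: "2 * exp \<xi>0 - y = 1" and "\<xi>0 < X"
  shows "set_integrable lborel (einterval \<xi>0 X) f" "(LBINT \<xi>=\<xi>0..X. f \<xi>) = F X"
proof -
  have above: "1 < 2 * exp \<xi> - y" if "\<xi>0 < \<xi>" for \<xi> using start that exp_less_mono[OF that] by linarith
  have radicand: "0 < (2 * exp \<xi> - y)\<^sup>2 - 1" if "\<xi>0 < \<xi>" for \<xi>
    using one_less_power[OF above[OF that], of 2] by simp
  have deriv: "DERIV F \<xi> :> f \<xi>" if "\<xi>0 < \<xi>" for \<xi>
    unfolding F_def f_def
    by (rule DERIV_cong[OF DERIV_chain2[of arcosh, OF arcosh_real_has_field_derivative]])
       (use above[OF that] in \<open>auto intro!: derivative_eq_intros\<close>)
  have cont: "isCont f \<xi>" if "\<xi>0 < \<xi>" for \<xi>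
    unfolding f_def using radicand[OF that] by (intro continuous_intros) auto
  have nonneg: "0 \<le> f \<xi>" if "\<xi>0 < \<xi>" for \<xi> using radicand[OF that] by (simp add: f_def)
  have "((\<lambda>\<xi>. 2 * exp \<xi> - y) \<longlongrightarrow> 2 * exp \<xi>0 - y) (at_right \<xi>0)" by (intro tendsto_intros)
  moreover have "\<forall>\<^sub>F \<xi> in at_right \<xi>0. 1 \<le> 2 * exp \<xi> - y"
    using above by (auto simp: eventually_at_right_field intro!: exI[of _ "\<xi>0 + 1"] less_imp_le)
  ultimately have "(F \<longlongrightarrow> arcosh 1) (at_right \<xi>0)"
    unfolding F_def start by (intro tendsto_arcosh_strong) auto
  then have "(F \<longlongrightarrow> 0) (at_right \<xi>0)" by simp
  then have lower_end: "((F \<circ> real_of_ereal) \<longlongrightarrow> 0) (at_right (ereal \<xi>0))"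
    by (simp only: ereal_tendsto_simps)
  have "(F \<longlongrightarrow> F X) (at_left X)"
    using DERIV_isCont[OF deriv[OF assms(4)]] by (simp add: isCont_def filterlim_at_split)
  then have upper_end: "((F \<circ> real_of_ereal) \<longlongrightarrow> F X) (at_left (ereal X))"
    by (simp only: ereal_tendsto_simps)
  note FTC = interval_integral_FTC_nonneg[where F = F and f = f, OF _ _ _ _ lower_end upper_end]
  show "set_integrable lborel (einterval \<xi>0 X) f"
    by (rule FTC(1)) (use assms(4) deriv cont nonneg in \<open>auto intro!: AE_I2\<close>)
  have "(LBINT \<xi>=\<xi>0..X. f \<xi>) = F X - 0"
    by (rule FTC(2)) (use assms(4) deriv cont nonneg in \<open>auto intro!: AE_I2\<close>)
  then show "(LBINT \<xi>=\<xi>0..X. f \<xi>) = F X" by simp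
qed

lemma nn_integral_focal_kernel:
  assumes y: "-1 < y" "y < 1"
  shows "(\<integral>\<^sup>+\<xi>\<in>{..X}. focal_kernel (exp \<xi>) y \<partial>lborel) \<le> ennreal (ln (4 * exp X + 2))"
proof -
  define \<xi>0 where "\<xi>0 = ln ((1 + y) / 2)"
  have "exp \<xi>0 = (1 + y) / 2" using y by (simp add: \<xi>0_def)
  then have start: "2 * exp \<xi>0 - y = 1" by simp
  have iff: "1 < 2 * exp \<xi> - y \<longleftrightarrow> \<xi>0 < \<xi>" for \<xi>
  proof -
    have "1 < 2 * exp \<xi> - y \<longleftrightarrow> exp \<xi>0 < exp \<xi>" using start by linarith
    then show ?thesis by simp
  qed
  show ?thesis
  proof (cases "\<xi>0 < X")
    case False
    then have "(\<integral>\<^sup>+\<xi>\<in>{..X}. focal_kernel (exp \<xi>) y \<partial>lborel) = (\<integral>\<^sup>+_. 0 \<partial>(lborel :: real measure))"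
      by (intro nn_integral_cong) (auto simp: focal_kernel_def indicator_def iff)
    then show ?thesis by simp
  next
    case True
    let ?f = "\<lambda>\<xi>. 2 * exp \<xi> / sqrt ((2 * exp \<xi> - y)\<^sup>2 - 1)"
    note antiderivative = integral_focal_antiderivative[OF start True]
    have f_nonneg: "0 \<le> ?f \<xi>" if "\<xi>0 < \<xi>" for \<xi>
      using one_le_power[of "2 * exp \<xi> - y" 2] iff[of \<xi>] that by simp
    have "(\<integral>\<^sup>+\<xi>\<in>{..X}. focal_kernel (exp \<xi>) y \<partial>lborel) =
        (\<integral>\<^sup>+\<xi>. ennreal (indicator (einterval \<xi>0 X) \<xi> *\<^sub>R ?f \<xi>) \<partial>lborel)"
    proof (rule nn_integral_cong_AE)
      show "AE \<xi> in lborel. focal_kernel (exp \<xi>) y * indicator {..X} \<xi> =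
          ennreal (indicator (einterval \<xi>0 X) \<xi> *\<^sub>R ?f \<xi>)"
        using AE_lborel_singleton[of X]
        by eventually_elim (auto simp: focal_kernel_def indicator_def einterval_iff iff)
    qed
    also have "\<dots> = ennreal (LBINT \<xi>=\<xi>0..X. ?f \<xi>)"
      using antiderivative(1) True f_nonneg unfolding interval_lebesgue_integral_def set_lebesgue_integral_def
      by (subst nn_integral_eq_integral) (auto simp: set_integrable_def indicator_def einterval_iff)
    also have "\<dots> = ennreal (arcosh (2 * exp X - y))" unfolding antiderivative(2) ..
    also have "\<dots> \<le> ennreal (ln (2 * (2 * exp X - y)))"
      using iff[of X] True by (intro ennreal_leI arcosh_le_ln_double) auto
    also have "\<dots> \<le> ennreal (ln (4 * exp X + 2))"
      using iff[of X] True y by (intro ennreal_leI) auto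
    finally show ?thesis .
  qed
qed

lemma sphere_energy_integral:
  assumes n: "2 \<le> n"
  shows "(\<integral>\<^sup>+\<xi>\<in>{..X}. sphere_energy n (exp \<xi>) \<partial>lborel) \<le>
      ennreal (1 / cap_integral n ^ (n - 1) * ln (4 * exp X + 2))"
proof -
  let ?h = "\<lambda>y. ennreal (ring_density n y) * indicator {-1<..<1} y"
  let ?a = "ennreal (1 / cap_integral n ^ n)"
  have "(\<integral>\<^sup>+\<xi>\<in>{..X}. sphere_energy n (exp \<xi>) \<partial>lborel) \<le>
    (\<integral>\<^sup>+\<xi>. (\<integral>\<^sup>+y. ?a * ?h y * (focal_kernel (exp \<xi>) y * indicator {..X} \<xi>) \<partial>lborel) \<partial>lborel)"
  proof (rule nn_integral_mono)
    fix \<xi> :: real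
    have "(\<integral>\<^sup>+y. ?a * ?h y * (focal_kernel (exp \<xi>) y * indicator {..X} \<xi>) \<partial>lborel) =
        (\<integral>\<^sup>+y. (?a * indicator {..X} \<xi>) *
          (ennreal (ring_density n y) * focal_kernel (exp \<xi>) y * indicator {-1<..<1} y) \<partial>lborel)"
      by (simp only: mult_ac)
    also have "\<dots> = ?a * (\<integral>\<^sup>+y\<in>{-1<..<1}. ennreal (ring_density n y) * focal_kernel (exp \<xi>) y \<partial>lborel) *
        indicator {..X} \<xi>"
      by (subst nn_integral_cmult) (measurable, simp only: mult_ac)
    finally show "sphere_energy n (exp \<xi>) * indicator {..X} \<xi> \<le>
        (\<integral>\<^sup>+y. ?a * ?h y * (focal_kernel (exp \<xi>) y * indicator {..X} \<xi>) \<partial>lborel)"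
      using sphere_energy_le[OF n exp_gt_zero] by (simp add: mult_right_mono)
  qed
  also have "\<dots> = (\<integral>\<^sup>+y. (\<integral>\<^sup>+\<xi>. ?a * ?h y * (focal_kernel (exp \<xi>) y * indicator {..X} \<xi>) \<partial>lborel) \<partial>lborel)"
    by (rule lborel_pair.Fubini') measurable
  also have "\<dots> = (\<integral>\<^sup>+y. ?a * ?h y * (\<integral>\<^sup>+\<xi>\<in>{..X}. focal_kernel (exp \<xi>) y \<partial>lborel) \<partial>lborel)"
    by (simp add: nn_integral_cmult)
  also have "\<dots> \<le> (\<integral>\<^sup>+y. ?a * ?h y * ennreal (ln (4 * exp X + 2)) \<partial>lborel)"
    using nn_integral_focal_kernel by (intro nn_integral_mono) (auto simp: indicator_def intro!: mult_left_mono)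
  also have "\<dots> = ?a * ennreal (cap_integral n) * ennreal (ln (4 * exp X + 2))"
    by (simp add: nn_integral_cmult nn_integral_multc nn_integral_ring_density[OF n])
  also have "\<dots> = ennreal (1 / cap_integral n ^ (n - 1) * ln (4 * exp X + 2))"
    unfolding cap_integral_power_cancel[OF n] using cap_integral_pos[OF n]
    by (subst ennreal_mult) (auto intro: ln_ge_zero simp: add_increasing)
  finally show ?thesis .
qed

subsection \<open>The spheroidal potential\<close>

definition ring_potential :: "nat \<Rightarrow> real \<Rightarrow> real" where
  "ring_potential n y = 1 / cap_integral n * integral {y..1} (ring_density n)"

lemma ring_density_integrable:
  assumes "2 \<le> n"
  shows "ring_density n integrable_on {-1..1}" "integral {-1..1} (ring_density n) = cap_integral n"
proof -
  have "ennreal (indicator {-1..1} y * ring_density n y) = ennreal (ring_density n y) * indicator {-1<..<1} y"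
    for y
    by (cases "y = -1 \<or> y = 1") (auto simp: indicator_def ring_density_def)
  then have nn: "(\<integral>\<^sup>+y. ennreal (indicator {-1..1} y * ring_density n y) \<partial>lborel) = ennreal (cap_integral n)"
    using nn_integral_ring_density[OF assms] by simp
  then have "set_integrable lborel {-1..1} (ring_density n)"
    unfolding set_integrable_def real_scaleR_def
    by (intro integrableI_nonneg) (auto simp: ring_density_nonneg)
  moreover have "(LINT y|lborel. indicator {-1..1} y * ring_density n y) = cap_integral n"
    using nn cap_integral_pos[OF assms] by (subst integral_eq_nn_integral) (auto simp: ring_density_nonneg)
  ultimately show "ring_density n integrable_on {-1..1}" "integral {-1..1} (ring_density n) = cap_integral n"
    using set_borel_integral_eq_integral[of "{-1..1}" "ring_density n"] by (auto simp: set_lebesgue_integral_def)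
qed

lemma ring_potential_ends:
  assumes "2 \<le> n"
  shows "ring_potential n (-1) = 1" "ring_potential n 1 = 0"
  using cap_integral_pos[OF assms] by (auto simp: ring_potential_def ring_density_integrable[OF assms])

lemma continuous_on_ring_potential:
  assumes "2 \<le> n"
  shows "continuous_on {-1..1} (ring_potential n)"
  unfolding ring_potential_def
  by (intro continuous_intros indefinite_integral_continuous_1' ring_density_integrable[OF assms])

lemma ring_potential_antimono:
  assumes "2 \<le> n" "-1 \<le> y" "y \<le> y'" "y' \<le> 1"
  shows "ring_potential n y' \<le> ring_potential n y"
  unfolding ring_potential_def using cap_integral_pos[OF assms(1)] assms
  by (intro mult_left_mono integral_subset_le)
     (auto intro: integrable_on_subinterval[OF ring_density_integrable(1)] simp: ring_density_nonneg)

lemma ring_potential_range: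
  assumes "2 \<le> n" "y \<in> {-1..1}"
  shows "ring_potential n y \<in> {0..1}"
  using ring_potential_antimono[of n "-1" y] ring_potential_antimono[of n y 1] ring_potential_ends[of n] assms
  by auto

lemma ring_potential_has_derivative:
  assumes n: "2 \<le> n" and y: "-1 < y" "y < 1"
  shows "(ring_potential n has_real_derivative - (1 / cap_integral n) * ring_density n y) (at y)"
proof -
  have "0 < 1 - y\<^sup>2" using y by (simp add: abs_square_less_1 abs_less_iff)
  then have cont: "isCont (ring_density n) y"
    unfolding ring_density_def by (intro continuous_intros) auto
  have interior: "at y within {-1..1} = at y"
    by (rule at_within_Icc_at[OF y])
  have "((\<lambda>u. integral {-1..u} (ring_density n)) has_vector_derivative ring_density n y) (at y within {-1..1} - {})"
    by (rule integral_has_vector_derivative_continuous_at[OF ring_density_integrable(1)[OF n] _ _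
        continuous_at_imp_continuous_at_within[OF cont]])
       (use y in auto)
  then have "((\<lambda>u. integral {-1..u} (ring_density n)) has_real_derivative ring_density n y) (at y)"
    unfolding Diff_empty interior has_real_derivative_iff_has_vector_derivative .
  then have deriv: "((\<lambda>u. 1 / cap_integral n * (cap_integral n - integral {-1..u} (ring_density n)))
      has_real_derivative
      1 / cap_integral n * (0 - ring_density n y)) (at y)"
    by (rule DERIV_cmult[OF DERIV_diff[OF DERIV_const]])
  have "\<forall>\<^sub>F u in nhds y. u \<in> {-1<..<1}" using y by (intro eventually_nhds_in_open) auto
  then have "\<forall>\<^sub>F u in nhds y. ring_potential n u =
      1 / cap_integral n * (cap_integral n - integral {-1..u} (ring_density n))"
  proof eventually_elim
    case (elim u)
    then have "integral {-1..u} (ring_density n) + integral {u..1} (ring_density n) = cap_integral n"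
      using Henstock_Kurzweil_Integration.integral_combine[of "-1" u 1 "ring_density n"]
        ring_density_integrable[OF n] by auto
    then show ?case by (simp add: ring_potential_def)
  qed
  from DERIV_cong_ev[OF refl this refl] deriv show ?thesis by simp
qed

lemma ring_potential_small_oscillation:
  assumes "2 \<le> n" "0 < \<delta>"
  obtains \<omega> where "\<omega> > 0"
    "\<And>y y'. y \<in> {-1..1} \<Longrightarrow> y' \<in> {-1..1} \<Longrightarrow> \<bar>y - y'\<bar> < \<omega> \<Longrightarrow> \<bar>ring_potential n y - ring_potential n y'\<bar> < \<delta>"
proof -
  have "uniformly_continuous_on {-1..1} (ring_potential n)"
    by (rule compact_uniformly_continuous[OF continuous_on_ring_potential[OF assms(1)]]) simp
  then show thesis using that assms(2) unfolding uniformly_continuous_on_def dist_real_def by metis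
qed

subsection \<open>A slowly rotating axis\<close>

definition axis_cos :: "'a::real_inner \<Rightarrow> 'a \<Rightarrow> real \<Rightarrow> 'a \<Rightarrow> real" where
  "axis_cos e0 e1 \<epsilon> z = sgn z \<bullet> great_circle e0 e1 (\<epsilon> * ln (norm z))"

lemma great_circle_quarter_turn: "great_circle v (- a) x = great_circle a v (x + pi/2)"
  by (simp add: great_circle_def sin_add cos_add algebra_simps)

lemma abs_axis_cos_le:
  assumes "norm e0 = 1" "norm e1 = 1" "e0 \<bullet> e1 = 0"
  shows "\<bar>axis_cos e0 e1 \<epsilon> z\<bar> \<le> 1"
  using Cauchy_Schwarz_ineq2[of "sgn z" "great_circle e0 e1 (\<epsilon> * ln (norm z))"] norm_great_circle[OF assms]
  by (auto simp: axis_cos_def norm_sgn split: if_splits)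

lemma sgn_has_derivative:
  fixes z :: "'a::real_inner"
  assumes "z \<noteq> 0"
  shows "(sgn has_derivative (\<lambda>h. (h - (sgn z \<bullet> h) *\<^sub>R sgn z) /\<^sub>R norm z)) (at z)"
proof -
  have "((\<lambda>z. z /\<^sub>R norm z) has_derivative
      (\<lambda>h. h /\<^sub>R norm z + (- (inverse (norm z) * (sgn z \<bullet> h) * inverse (norm z))) *\<^sub>R z)) (at z)"
    using assms by (auto intro!: derivative_eq_intros has_derivative_norm simp: inner_commute fun_eq_iff)
  then show ?thesis
    by (simp add: sgn_div_norm[abs_def] scaleR_diff_right mult_ac)
qed

lemma ln_norm_has_derivative:
  fixes z :: "'a::real_inner"
  assumes "z \<noteq> 0"
  shows "((\<lambda>z. ln (norm z)) has_derivative (\<lambda>h. (sgn z \<bullet> h) / norm z)) (at z)"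
  using DERIV_compose_FDERIV[OF DERIV_ln_divide has_derivative_norm[OF assms]] assms
  by (simp add: inner_commute)

lemma axis_cos_has_derivative:
  fixes z e0 e1 :: "'a::real_inner" and \<epsilon> :: real
  assumes z: "z \<noteq> 0"
  defines "E \<equiv> great_circle e0 e1 (\<epsilon> * ln (norm z))" and "E' \<equiv> great_circle e1 (- e0) (\<epsilon> * ln (norm z))"
  shows "(axis_cos e0 e1 \<epsilon> has_derivative
    (\<lambda>h. ((E - axis_cos e0 e1 \<epsilon> z *\<^sub>R sgn z + (\<epsilon> * (sgn z \<bullet> E')) *\<^sub>R sgn z) \<bullet> h) / norm z)) (at z)"
proof -
  have "((\<lambda>z. great_circle e0 e1 (\<epsilon> * ln (norm z))) has_derivative
      (\<lambda>h. (\<epsilon> * ((sgn z \<bullet> h) / norm z)) *\<^sub>R E')) (at z)"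
    unfolding E'_def
    by (rule has_derivative_compose[OF has_derivative_mult_right[OF ln_norm_has_derivative[OF z]]
        great_circle_has_vector_derivative[unfolded has_vector_derivative_def]])
  from has_derivative_inner[OF sgn_has_derivative[OF z] this]
  have "(axis_cos e0 e1 \<epsilon> has_derivative (\<lambda>h. sgn z \<bullet> ((\<epsilon> * ((sgn z \<bullet> h) / norm z)) *\<^sub>R E') +
      ((h - (sgn z \<bullet> h) *\<^sub>R sgn z) /\<^sub>R norm z) \<bullet> E)) (at z)"
    unfolding axis_cos_def[abs_def] E_def .
  then show ?thesis
    by (rule has_derivative_eq_rhs)
       (auto simp: fun_eq_iff axis_cos_def E_def[symmetric] inner_add_left inner_diff_left inner_commute
         divide_inverse algebra_simps)
qed

lemma spheroidal_cos_compose_has_derivative: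
  assumes T: "(T has_derivative T') (at z)" "T z \<noteq> 0" and c: "(c has_derivative c') (at z)" "\<bar>c z\<bar> \<le> 1"
    and D: "0 < focal_dist (T z) (c z)"
  shows "((\<lambda>z. spheroidal_cos (T z) (c z)) has_derivative
    (\<lambda>h. T z / focal_dist (T z) (c z) * c' h +
      (1 - (spheroidal_cos (T z) (c z))\<^sup>2) / (2 * focal_dist (T z) (c z)) * (T' h / T z))) (at z)"
proof -
  let ?D = "focal_dist (T z) (c z)"
  have "0 < (T z)\<^sup>2 + 1 - 2 * T z * c z" using D by (simp add: focal_dist_def)
  then have "((\<lambda>z. spheroidal_cos (T z) (c z)) has_derivative
      (\<lambda>h. T' h - (2 * T z * T' h - 2 * (T z * c' h + T' h * c z)) * (inverse ?D / 2))) (at z)"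
    unfolding spheroidal_cos_def focal_dist_def
    by (auto intro!: derivative_eq_intros T(1) c(1) simp: fun_eq_iff algebra_simps)
  moreover have "T' h - (2 * T z * T' h - 2 * (T z * c' h + T' h * c z)) * (inverse ?D / 2) =
      T z / ?D * c' h + (1 - (spheroidal_cos (T z) (c z))\<^sup>2) / (2 * ?D) * (T' h / T z)" for h
    unfolding one_minus_spheroidal_cos_sq_eq_focal[OF c(2)] using T(2) D by (simp add: field_simps)
  ultimately show ?thesis by simp
qed

text \<open>\<open>twist_factor b T\<close> bounds the factor by which rotating the axis at speed at most \<open>b\<close> increases the
  gradient of the coordinate \<open>spheroidal_cos\<close>; far from the focus it is \<open>1 + O(b\<^sup>2)\<close>.\<close>

definition twist_factor :: "real \<Rightarrow> real \<Rightarrow> real" where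
  "twist_factor b T = (if T \<le> 1 + 1 / b then sqrt (1 + 2 * b) else sqrt (1 + 2 * b\<^sup>2))"

definition twisted_slope :: "nat \<Rightarrow> real \<Rightarrow> real \<Rightarrow> real \<Rightarrow> real" where
  "twisted_slope n b T c = twist_factor b T * spheroidal_slope n T c"

lemma twist_factor_measurable [measurable]: "twist_factor b \<in> borel_measurable borel"
  unfolding twist_factor_def by measurable

lemma twisted_slope_measurable [measurable]:
  "(\<lambda>(T, c). twisted_slope n b T c) \<in> borel_measurable (borel \<Otimes>\<^sub>M borel)"
  unfolding twisted_slope_def by measurable

lemma twist_factor_pos: "0 < b \<Longrightarrow> 0 < twist_factor b T"
  by (auto simp: twist_factor_def intro: add_pos_nonneg)

lemma twisted_slope_nonneg:
  assumes "2 \<le> n" "0 < b" "0 < T" "\<bar>c\<bar> \<le> 1"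
  shows "0 \<le> twisted_slope n b T c"
  unfolding twisted_slope_def
  using twist_factor_pos[OF assms(2), of T] spheroidal_slope_nonneg[OF assms(1,3,4)] by simp

lemma twist_factor_sq_ge:
  assumes b: "0 < b" "b \<le> 1" "\<bar>\<epsilon>\<bar> \<le> b" and c: "\<bar>c\<bar> \<le> 1" and T: "0 < T" and D: "0 < focal_dist T c"
  shows "1 + \<bar>\<epsilon>\<bar> * (sqrt (1 - c\<^sup>2) / focal_dist T c) + \<epsilon>\<^sup>2 \<le> (twist_factor b T)\<^sup>2"
proof -
  let ?q = "sqrt (1 - c\<^sup>2) / focal_dist T c"
  have "0 \<le> 1 - c\<^sup>2" using c by (simp add: abs_square_le_1)
  then have q: "0 \<le> ?q" "?q \<le> 1" using D focal_dist_ge(2)[OF c, of T] by (auto simp: divide_le_eq)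
  have sq: "\<epsilon>\<^sup>2 \<le> b\<^sup>2" using b by (metis abs_ge_zero power2_abs power_mono)
  have "b\<^sup>2 \<le> b" using b by (simp add: power2_eq_square mult_left_le)
  show ?thesis
  proof (cases "T \<le> 1 + 1 / b")
    case True
    have "\<bar>\<epsilon>\<bar> * ?q \<le> b * 1" using b q by (intro mult_mono) auto
    with True b sq \<open>b\<^sup>2 \<le> b\<close> show ?thesis by (simp add: twist_factor_def)
  next
    case False
    then have "1 / b < focal_dist T c" using focal_dist_bounds(1)[OF c T] by linarith
    then have "1 / focal_dist T c < b" using b D by (simp add: field_simps)
    moreover have "?q \<le> 1 / focal_dist T c" using D by (intro divide_right_mono) auto
    ultimately have "\<bar>\<epsilon>\<bar> * ?q \<le> b * b" using b q by (intro mult_mono) auto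
    then show ?thesis using False sq by (simp add: twist_factor_def power2_eq_square)
  qed
qed

lemma twisted_gradient_sq_le:
  fixes \<epsilon> c b T \<mu> :: real
  assumes c: "\<bar>c\<bar> \<le> 1" and b: "0 < b" "b \<le> 1" "\<bar>\<epsilon>\<bar> \<le> b" and T: "0 < T" and D: "0 < focal_dist T c"
    and \<mu>: "\<bar>\<mu>\<bar> \<le> \<bar>\<epsilon>\<bar> * sqrt (1 - c\<^sup>2)"
  defines "f \<equiv> T / focal_dist T c" and "Y \<equiv> 1 - (spheroidal_cos T c)\<^sup>2"
  shows "f\<^sup>2 * (1 - c\<^sup>2) + (f * \<mu> + Y / (2 * focal_dist T c))\<^sup>2 \<le> Y * f * (twist_factor b T)\<^sup>2"
proof -
  let ?D = "focal_dist T c"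
  define G where "G = Y / (2 * ?D)"
  define s where "s = sqrt (1 - c\<^sup>2)"
  have s: "0 \<le> s" "s\<^sup>2 = 1 - c\<^sup>2" using c by (auto simp: s_def abs_square_le_1)
  have f: "0 < f" using T D by (simp add: f_def)
  have "\<bar>spheroidal_cos T c\<bar> \<le> 1" using spheroidal_cos_bounds[OF c T] by auto
  then have Y: "0 \<le> Y" by (simp add: Y_def abs_square_le_1)
  have "f\<^sup>2 * s\<^sup>2 + (f * \<mu> + G)\<^sup>2 = (f\<^sup>2 * s\<^sup>2 + G\<^sup>2) + 2 * f * G * \<mu> + f\<^sup>2 * \<mu>\<^sup>2"
    by (simp add: power2_eq_square algebra_simps)
  also have "f\<^sup>2 * s\<^sup>2 + G\<^sup>2 = Y * f"
  proof -
    have "f\<^sup>2 * s\<^sup>2 + G\<^sup>2 = (T\<^sup>2 * (1 - c\<^sup>2) + (Y / 2)\<^sup>2) / ?D\<^sup>2"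
      unfolding s(2) by (simp add: f_def G_def power_divide add_divide_distrib power_mult_distrib)
    also have "\<dots> = T * ?D * Y / ?D\<^sup>2" unfolding Y_def spheroidal_gradient_identity[OF c] ..
    also have "\<dots> = Y * f" using D by (simp add: f_def power2_eq_square)
    finally show ?thesis .
  qed
  also have "Y * f + 2 * f * G * \<mu> + f\<^sup>2 * \<mu>\<^sup>2 \<le> Y * f + Y * f * (\<bar>\<epsilon>\<bar> * (s / ?D)) + Y * f * \<epsilon>\<^sup>2"
  proof (intro add_mono order_refl)
    have "f * Y / ?D * \<mu> \<le> f * Y / ?D * (\<bar>\<epsilon>\<bar> * s)"
      using \<mu> f Y D by (intro mult_left_mono) (auto simp: s_def)
    then show "2 * f * G * \<mu> \<le> Y * f * (\<bar>\<epsilon>\<bar> * (s / ?D))" by (simp add: G_def mult_ac)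
    have "f * s\<^sup>2 \<le> Y"
      using one_minus_cos_sq_le_spheroidal[OF c T] D by (simp add: f_def s(2) Y_def pos_divide_le_eq)
    then have "f * \<epsilon>\<^sup>2 * (f * s\<^sup>2) \<le> f * \<epsilon>\<^sup>2 * Y" using f by (intro mult_left_mono) auto
    moreover have "\<bar>\<mu>\<bar>\<^sup>2 \<le> (\<bar>\<epsilon>\<bar> * s)\<^sup>2" using \<mu> unfolding s_def by (intro power_mono) auto
    then have "f\<^sup>2 * \<mu>\<^sup>2 \<le> f\<^sup>2 * (\<epsilon>\<^sup>2 * s\<^sup>2)" by (intro mult_left_mono) (auto simp: power_mult_distrib)
    ultimately show "f\<^sup>2 * \<mu>\<^sup>2 \<le> Y * f * \<epsilon>\<^sup>2" by (simp add: power2_eq_square mult_ac)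
  qed
  also have "\<dots> = Y * f * (1 + \<bar>\<epsilon>\<bar> * (s / ?D) + \<epsilon>\<^sup>2)" by (simp add: algebra_simps)
  also have "\<dots> \<le> Y * f * (twist_factor b T)\<^sup>2"
    using twist_factor_sq_ge[OF b c T D] Y f unfolding s_def by (intro mult_left_mono) auto
  finally show ?thesis unfolding s(2) G_def .
qed

lemma abs_inner_orthonormal_le:
  fixes \<zeta> E E' :: "'a::real_inner"
  assumes "norm \<zeta> = 1" "norm E = 1" "norm E' = 1" "E \<bullet> E' = 0"
  shows "\<bar>\<zeta> \<bullet> E'\<bar> \<le> sqrt (1 - (\<zeta> \<bullet> E)\<^sup>2)"
proof -
  have "0 \<le> (norm (\<zeta> - (\<zeta> \<bullet> E) *\<^sub>R E - (\<zeta> \<bullet> E') *\<^sub>R E'))\<^sup>2" by simp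
  also have "\<dots> = 1 - (\<zeta> \<bullet> E)\<^sup>2 - (\<zeta> \<bullet> E')\<^sup>2"
    using assms unfolding power2_norm_eq_inner
    by (simp add: norm_eq_1 inner_diff_left inner_diff_right inner_commute power2_eq_square algebra_simps)
  finally show ?thesis by (intro real_le_rsqrt) simp
qed

lemma norm_twisted_gradient_le:
  fixes \<zeta> E E' :: "'a::real_inner" and \<epsilon> c \<sigma> b T :: real
  assumes unit: "norm \<zeta> = 1" "norm E = 1" "norm E' = 1" "E \<bullet> E' = 0"
    and c: "c = \<zeta> \<bullet> E" and \<sigma>: "\<sigma>\<^sup>2 = 1" and b: "0 < b" "b \<le> 1" "\<bar>\<epsilon>\<bar> \<le> b"
    and T: "0 < T" and D: "0 < focal_dist T (\<sigma> * c)"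
  defines "f \<equiv> T / focal_dist T (\<sigma> * c)" and "Y \<equiv> 1 - (spheroidal_cos T (\<sigma> * c))\<^sup>2"
  shows "norm (f *\<^sub>R (E - c *\<^sub>R \<zeta> + (\<epsilon> * (\<zeta> \<bullet> E')) *\<^sub>R \<zeta>) + (Y / (2 * focal_dist T (\<sigma> * c))) *\<^sub>R \<zeta>)
    \<le> sqrt (Y * f) * twist_factor b T"
proof -
  let ?\<mu> = "\<epsilon> * (\<zeta> \<bullet> E')" and ?G = "Y / (2 * focal_dist T (\<sigma> * c))"
  have "\<bar>c\<bar> \<le> 1" using Cauchy_Schwarz_ineq2[of \<zeta> E] unit by (simp add: c)
  then have \<sigma>c: "(\<sigma> * c)\<^sup>2 = c\<^sup>2" "\<bar>\<sigma> * c\<bar> \<le> 1" using \<sigma> by (auto simp: power_mult_distrib power2_eq_1_iff)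
  have \<mu>: "\<bar>?\<mu>\<bar> \<le> \<bar>\<epsilon>\<bar> * sqrt (1 - (\<sigma> * c)\<^sup>2)"
    unfolding \<sigma>c(1) unfolding c abs_mult by (intro mult_left_mono abs_inner_orthonormal_le unit) auto
  have "(norm (f *\<^sub>R (E - c *\<^sub>R \<zeta> + ?\<mu> *\<^sub>R \<zeta>) + ?G *\<^sub>R \<zeta>))\<^sup>2 = f\<^sup>2 * (1 - c\<^sup>2) + (f * ?\<mu> + ?G)\<^sup>2"
    unfolding power2_norm_eq_inner using unit c
    by (simp add: norm_eq_1 inner_diff_left inner_diff_right inner_add_left inner_add_right inner_commute
        power2_eq_square algebra_simps)
  also have "\<dots> \<le> Y * f * (twist_factor b T)\<^sup>2"
    using twisted_gradient_sq_le[OF \<sigma>c(2) b T D \<mu>] unfolding \<sigma>c(1) f_def Y_def .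
  finally have "norm (f *\<^sub>R (E - c *\<^sub>R \<zeta> + ?\<mu> *\<^sub>R \<zeta>) + ?G *\<^sub>R \<zeta>) \<le> sqrt (Y * f * (twist_factor b T)\<^sup>2)"
    by (rule real_le_rsqrt)
  then show ?thesis using twist_factor_pos[OF b(1), of T] by (simp add: real_sqrt_mult)
qed

lemma slope_le_ring_potential_compose:
  fixes C :: "'a::real_inner \<Rightarrow> real"
  assumes n: "2 \<le> n" and C: "(C has_derivative (\<lambda>h. (v \<bullet> h) / t)) (at z)" "-1 < C z" "C z < 1"
    and v: "norm v \<le> sqrt ((1 - (C z)\<^sup>2) * q) * m" and t: "0 < t"
  shows "slope_le (\<lambda>z. ring_potential n (C z))
    (m * (1 / cap_integral n * (1 - (C z)\<^sup>2) powr (cap_exponent n - 1) * sqrt q) / t) z UNIV"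
proof (rule slope_le_has_derivative)
  let ?Y = "1 - (C z)\<^sup>2"
  define d where "d = 1 / cap_integral n * ring_density n (C z)"
  have Y: "0 < ?Y" using C by (simp add: abs_square_less_1 abs_less_iff)
  have d: "0 \<le> d" using cap_integral_pos[OF n] ring_density_nonneg[of n "C z"] by (simp add: d_def)
  show "((\<lambda>z. ring_potential n (C z)) has_derivative (\<lambda>h. (v \<bullet> h) / t * (- d))) (at z)"
    using DERIV_compose_FDERIV[OF ring_potential_has_derivative[OF n C(2,3)] C(1)] by (simp add: d_def)
  fix h
  have "\<bar>v \<bullet> h\<bar> \<le> norm v * norm h" by (rule Cauchy_Schwarz_ineq2)
  also have "\<dots> \<le> sqrt (?Y * q) * m * norm h" by (rule mult_right_mono[OF v norm_ge_zero])
  finally have "\<bar>v \<bullet> h\<bar> * (d / t) \<le> sqrt (?Y * q) * m * norm h * (d / t)"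
    using d t by (intro mult_right_mono) auto
  also have "\<dots> = m * (1 / cap_integral n * (sqrt ?Y * ring_density n (C z)) * sqrt q) / t * norm h"
    by (simp add: d_def real_sqrt_mult mult_ac)
  also have "sqrt ?Y * ring_density n (C z) = ?Y powr (cap_exponent n - 1)"
    using Y powr_add[of ?Y "1/2" "cap_exponent n - 3/2"] by (simp add: ring_density_def powr_half_sqrt)
  finally show "norm ((v \<bullet> h) / t * (- d)) \<le>
      m * (1 / cap_integral n * ?Y powr (cap_exponent n - 1) * sqrt q) / t * norm h"
    using d t by (simp add: abs_mult mult_ac)
qed

text \<open>The signs \<open>\<sigma> = 1\<close> and \<open>\<sigma> = - 1\<close> belong to the spheroidal coordinates with foci at \<open>0\<close> and at \<open>\<infinity>\<close>.\<close>

lemma slope_le_twisted_ring_potential: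
  fixes z e0 e1 :: "'a::euclidean_space" and \<sigma> \<epsilon> b :: real
  defines "c \<equiv> axis_cos e0 e1 \<epsilon>"
  assumes frame: "norm e0 = 1" "norm e1 = 1" "e0 \<bullet> e1 = 0" and n: "2 \<le> n" and b: "0 < b" "b \<le> 1" "\<bar>\<epsilon>\<bar> \<le> b"
    and z: "z \<noteq> 0" and \<sigma>: "\<sigma>\<^sup>2 = 1"
    and T: "(T has_derivative (\<lambda>h. \<sigma> * T z * (sgn z \<bullet> h) / norm z)) (at z)" "0 < T z"
    and inside: "-1 < spheroidal_cos (T z) (\<sigma> * c z)" "spheroidal_cos (T z) (\<sigma> * c z) < 1"
  shows "slope_le (\<lambda>z. ring_potential n (\<sigma> * spheroidal_cos (T z) (\<sigma> * c z)))
    (twisted_slope n b (T z) (\<sigma> * c z) / norm z) z UNIV"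
proof -
  let ?E = "great_circle e0 e1 (\<epsilon> * ln (norm z))" and ?E' = "great_circle e1 (- e0) (\<epsilon> * ln (norm z))"
  let ?D = "focal_dist (T z) (\<sigma> * c z)" and ?y = "spheroidal_cos (T z) (\<sigma> * c z)"
  let ?w = "?E - c z *\<^sub>R sgn z + (\<epsilon> * (sgn z \<bullet> ?E')) *\<^sub>R sgn z"
  let ?v = "(T z / ?D) *\<^sub>R ?w + ((1 - ?y\<^sup>2) / (2 * ?D)) *\<^sub>R sgn z"
  have \<sigma>_cases: "\<sigma> = 1 \<or> \<sigma> = - 1" using \<sigma> by (simp add: power2_eq_1_iff)
  then have \<sigma>c: "\<bar>\<sigma> * c z\<bar> \<le> 1" using abs_axis_cos_le[OF frame] by (auto simp: c_def)
  have D: "0 < ?D" using focal_dist_pos[OF \<sigma>c T(2) inside(2)] .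
  have "((\<lambda>z. \<sigma> * c z) has_derivative (\<lambda>h. \<sigma> * ((?w \<bullet> h) / norm z))) (at z)"
    unfolding c_def by (rule has_derivative_mult_right[OF axis_cos_has_derivative[OF z]])
  from spheroidal_cos_compose_has_derivative[OF T(1) _ this \<sigma>c D] T(2)
  have "((\<lambda>z. \<sigma> * spheroidal_cos (T z) (\<sigma> * c z)) has_derivative (\<lambda>h. \<sigma> * (T z / ?D * (\<sigma> * ((?w \<bullet> h) / norm z)) +
      (1 - ?y\<^sup>2) / (2 * ?D) * (\<sigma> * T z * (sgn z \<bullet> h) / norm z / T z)))) (at z)"
    by (intro has_derivative_mult_right) auto
  moreover have "\<sigma> * (f * (\<sigma> * ((w \<bullet> h) / r)) + G * (\<sigma> * T z * (x \<bullet> h) / r / T z)) =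
      ((f *\<^sub>R w + G *\<^sub>R x) \<bullet> h) / r"
    for f r G and w x h :: 'a
    using \<sigma>_cases T(2) by (auto simp: inner_add_left add_divide_distrib)
  ultimately have deriv: "((\<lambda>z. \<sigma> * spheroidal_cos (T z) (\<sigma> * c z)) has_derivative (\<lambda>h. (?v \<bullet> h) / norm z)) (at z)"
    by (simp only:)
  have "norm ?v \<le> sqrt ((1 - ?y\<^sup>2) * (T z / ?D)) * twist_factor b (T z)"
  proof (rule norm_twisted_gradient_le[OF _ _ _ _ _ \<sigma> b T(2) D])
    show "norm ?E = 1" "norm ?E' = 1" "?E \<bullet> ?E' = 0"
      unfolding great_circle_quarter_turn using norm_great_circle[OF frame] inner_great_circle[OF frame]
      by simp_all
  qed (use z in \<open>auto simp: norm_sgn c_def axis_cos_def\<close>)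
  moreover have "(\<sigma> * ?y)\<^sup>2 = ?y\<^sup>2" using \<sigma> by (simp add: power_mult_distrib)
  ultimately show ?thesis
    using slope_le_ring_potential_compose[OF n deriv, of "T z / ?D" "twist_factor b (T z)"] inside z \<sigma>_cases
    by (auto simp: twisted_slope_def spheroidal_slope_def)
qed

subsection \<open>Gluing two spheroidal potentials\<close>

locale glued_potential =
  fixes e0 e1 :: "'a::euclidean_space" and \<epsilon> b L k \<delta> :: real
  assumes frame: "norm e0 = 1" "norm e1 = 1" "e0 \<bullet> e1 = 0" and dim: "2 \<le> DIM('a)"
    and b: "0 < b" "b \<le> 1" "\<bar>\<epsilon>\<bar> \<le> b" and L: "0 < L" and k: "0 < k" "k \<le> L" and \<delta>: "0 < \<delta>"
    and small_oscillation: "\<And>y y'. y \<in> {-1..1} \<Longrightarrow> y' \<in> {-1..1} \<Longrightarrow> \<bar>y - y'\<bar> \<le> (1 + exp k) / (2 * exp L) \<Longrightarrow>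
      \<bar>ring_potential DIM('a) y - ring_potential DIM('a) y'\<bar> < \<delta>"
begin

abbreviation "pole_cos \<equiv> axis_cos e0 e1 \<epsilon>"

definition inner_coord :: "'a \<Rightarrow> real" where
  "inner_coord z = spheroidal_cos (norm z) (pole_cos z)"

definition outer_coord :: "'a \<Rightarrow> real" where
  "outer_coord z = - spheroidal_cos (exp (2 * L) / norm z) (- pole_cos z)"

definition inner_potential :: "'a \<Rightarrow> real" where
  "inner_potential z = ring_potential DIM('a) (inner_coord z)"

definition outer_potential :: "'a \<Rightarrow> real" where
  "outer_potential z = ring_potential DIM('a) (outer_coord z)"

definition cutoff :: "'a \<Rightarrow> real" where
  "cutoff z = max 0 (\<delta> / k * (ln (norm z) - L))"

text \<open>Lowering the inner potential by the oscillation bound \<open>\<delta>\<close> while the radius grows by the factor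
  \<open>exp k\<close> makes the maximum pass continuously from the inner to the outer potential. Since \<open>ln 0 = 0\<close>,
  the origin belongs to the inner region.\<close>

definition potential :: "'a \<Rightarrow> real" where
  "potential z = (if ln (norm z) \<le> L + k then max (outer_potential z) (inner_potential z - cutoff z)
     else outer_potential z)"

definition shell_slope :: "real \<Rightarrow> real \<Rightarrow> real" where
  "shell_slope \<xi> c = max
     (if \<xi> \<le> L + k then twisted_slope DIM('a) b (exp \<xi>) c + (if L \<le> \<xi> then \<delta> / k else 0) else 0)
     (if L \<le> \<xi> then twisted_slope DIM('a) b (exp (2 * L - \<xi>)) (- c) else 0)"

definition potential_slope :: "'a \<Rightarrow> real" where
  "potential_slope z = shell_slope (ln (norm z)) (pole_cos z) / norm z"

lemma abs_pole_cos_le: "\<bar>pole_cos z\<bar> \<le> 1" "\<bar>- pole_cos z\<bar> \<le> 1"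
  using abs_axis_cos_le[OF frame] by auto

lemma outer_radius_pos: "z \<noteq> 0 \<Longrightarrow> 0 < exp (2 * L) / norm z"
  by simp

lemma coords_at_0: "inner_coord 0 = -1" "outer_coord 0 = 1"
  by (simp_all add: inner_coord_def outer_coord_def spheroidal_cos_def focal_dist_def)

lemma coords_range: "inner_coord z \<in> {-1..1}" "outer_coord z \<in> {-1..1}"
proof -
  have "inner_coord z \<in> {-1..1} \<and> outer_coord z \<in> {-1..1}"
  proof (cases "z = 0")
    case False
    then show ?thesis
      using spheroidal_cos_bounds[OF abs_pole_cos_le(1), of "norm z" z]
        spheroidal_cos_bounds[OF abs_pole_cos_le(2) outer_radius_pos, of z z]
      by (auto simp: inner_coord_def outer_coord_def)
  qed (simp add: coords_at_0)
  then show "inner_coord z \<in> {-1..1}" "outer_coord z \<in> {-1..1}" by auto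
qed

lemma coords_close:
  assumes "z \<noteq> 0"
  shows "inner_coord z \<le> outer_coord z"
    "outer_coord z - inner_coord z \<le> 1 / (2 * norm z) + norm z / (2 * exp (2 * L))"
proof -
  have norm: "0 < norm z" using assms by simp
  note inner = spheroidal_cos_near_cos[OF abs_pole_cos_le(1)[of z] norm]
    and outer = spheroidal_cos_near_cos[OF abs_pole_cos_le(2)[of z] outer_radius_pos[OF assms]]
  show "inner_coord z \<le> outer_coord z" using inner(1) outer(1) by (simp add: inner_coord_def outer_coord_def)
  show "outer_coord z - inner_coord z \<le> 1 / (2 * norm z) + norm z / (2 * exp (2 * L))"
    using inner(2) outer(2) by (simp add: inner_coord_def outer_coord_def)
qed

lemma potentials_range: "inner_potential z \<in> {0..1}" "outer_potential z \<in> {0..1}"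
  unfolding inner_potential_def outer_potential_def by (intro ring_potential_range[OF dim] coords_range)+

lemma outer_potential_le_inner: "outer_potential z \<le> inner_potential z"
proof -
  have "inner_coord z \<le> outer_coord z" using coords_close(1) coords_at_0 by (cases "z = 0") auto
  then show ?thesis
    unfolding inner_potential_def outer_potential_def using coords_range[of z]
    by (intro ring_potential_antimono[OF dim]) auto
qed

lemma cutoff_nonneg: "0 \<le> cutoff z"
  by (simp add: cutoff_def)

lemma potential_inner: "ln (norm z) \<le> L \<Longrightarrow> potential z = inner_potential z"
proof -
  assume "ln (norm z) \<le> L"
  then have "\<delta> / k * (ln (norm z) - L) \<le> 0" using \<delta> k by (intro mult_nonneg_nonpos) auto
  then show ?thesis using \<open>ln (norm z) \<le> L\<close> k outer_potential_le_inner[of z]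
    by (simp add: potential_def cutoff_def)
qed

lemma inner_potential_less_outer_at_rim:
  assumes "ln (norm z) = L + k"
  shows "inner_potential z - cutoff z < outer_potential z"
proof -
  have z: "z \<noteq> 0" using assms L k by auto
  then have norm: "norm z = exp L * exp k" using exp_ln[of "norm z"] by (simp add: assms exp_add)
  have "exp L * 1 \<le> exp L * exp k" using k by (intro mult_left_mono) auto
  then have "1 / (2 * norm z) \<le> 1 / (2 * exp L)" unfolding norm by (intro divide_left_mono) auto
  moreover have "norm z / (2 * exp (2 * L)) = exp k / (2 * exp L)"
    using exp_add[of L L] by (simp add: norm field_simps)
  ultimately have "\<bar>inner_coord z - outer_coord z\<bar> \<le> (1 + exp k) / (2 * exp L)"
    using coords_close[OF z] by (simp add: add_divide_distrib)
  then have "\<bar>inner_potential z - outer_potential z\<bar> < \<delta>"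
    unfolding inner_potential_def outer_potential_def by (intro small_oscillation coords_range)
  moreover have "cutoff z = \<delta>" using assms \<delta> k by (simp add: cutoff_def)
  ultimately show ?thesis by linarith
qed

lemma isCont_pole_cos: "z \<noteq> 0 \<Longrightarrow> isCont pole_cos z"
  by (rule has_derivative_continuous[OF axis_cos_has_derivative])

lemma isCont_inner_coord: "isCont inner_coord z"
proof (cases "z = 0")
  case True
  have "\<bar>inner_coord q - (-1)\<bar> \<le> 2 * norm q" for q
  proof (cases "q = 0")
    case False
    then show ?thesis
      using focal_dist_bounds[OF abs_pole_cos_le(1), of "norm q" q]
      by (auto simp: inner_coord_def spheroidal_cos_def)
  qed (simp add: coords_at_0)
  moreover have "((\<lambda>q::'a. 2 * norm q) \<longlongrightarrow> 0) (at 0)"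
    by (auto intro!: tendsto_eq_intros)
  ultimately have "((\<lambda>q. inner_coord q - (-1)) \<longlongrightarrow> 0) (at 0)"
    by (intro Lim_null_comparison[of "\<lambda>q. inner_coord q - (-1)" "\<lambda>q. 2 * norm q"]) auto
  then have "(inner_coord \<longlongrightarrow> -1) (at 0)" by (rule LIM_zero_cancel)
  then show ?thesis using True by (simp add: isCont_def coords_at_0)
next
  case False
  then show ?thesis
    unfolding inner_coord_def[abs_def] spheroidal_cos_def focal_dist_def
    using isCont_pole_cos by (intro continuous_intros)
qed

lemma isCont_outer_coord: "z \<noteq> 0 \<Longrightarrow> isCont outer_coord z"
  unfolding outer_coord_def[abs_def] spheroidal_cos_def focal_dist_def
  using isCont_pole_cos by (intro continuous_intros) auto

lemma isCont_ring_potential_compose: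
  assumes "isCont C z" "\<And>q. C q \<in> {-1..1}"
  shows "isCont (\<lambda>q. ring_potential DIM('a) (C q)) z"
  using continuous_on_tendsto_compose[OF continuous_on_ring_potential[OF dim], of C "C z" "at z"] assms
  by (simp add: isCont_def)

lemma isCont_potentials:
  "isCont inner_potential z" "z \<noteq> 0 \<Longrightarrow> isCont outer_potential z"
  unfolding inner_potential_def[abs_def] outer_potential_def[abs_def]
  by (intro isCont_ring_potential_compose isCont_inner_coord isCont_outer_coord coords_range; assumption)+

lemma isCont_cutoff: "z \<noteq> 0 \<Longrightarrow> isCont cutoff z"
  unfolding cutoff_def[abs_def] by (intro continuous_intros) auto

lemma ln_norm_iff:
  fixes z :: 'a
  assumes "0 < x"
  shows "ln (norm z) < x \<longleftrightarrow> norm z < exp x" "ln (norm z) \<le> x \<longleftrightarrow> norm z \<le> exp x"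
  using exp_less_cancel_iff[of "ln (norm z)" x] exp_le_cancel_iff[of "ln (norm z)" x] assms
  by (cases "z = 0"; simp)+

lemma eventually_potential_inner:
  assumes "ln (norm z) < L"
  shows "\<forall>\<^sub>F q in nhds z. potential q = inner_potential q"
proof -
  have "\<forall>\<^sub>F q in nhds z. q \<in> ball 0 (exp L)"
    using assms L by (intro eventually_nhds_in_open) (auto simp: ln_norm_iff)
  then show ?thesis
    by eventually_elim (use L in \<open>auto intro!: potential_inner less_imp_le simp: ln_norm_iff\<close>)
qed

lemma eventually_potential_middle:
  assumes "ln (norm z) < L + k"
  shows "\<forall>\<^sub>F q in nhds z. potential q = max (outer_potential q) (inner_potential q - cutoff q)"
proof -
  have "\<forall>\<^sub>F q in nhds z. q \<in> ball 0 (exp (L + k))"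
    using assms L k by (intro eventually_nhds_in_open) (auto simp: ln_norm_iff)
  then show ?thesis
  proof eventually_elim
    case (elim q)
    then have "ln (norm q) < L + k" using L k by (subst ln_norm_iff) auto
    then show ?case by (simp add: potential_def)
  qed
qed

lemma eventually_potential_outer:
  assumes "L + k \<le> ln (norm z)"
  shows "\<forall>\<^sub>F q in nhds z. potential q = outer_potential q"
proof (cases "ln (norm z) = L + k")
  case True
  define gap where "gap q = outer_potential q - (inner_potential q - cutoff q)" for q
  have "z \<noteq> 0" using True L k by auto
  then have "isCont gap z"
    unfolding gap_def[abs_def] using isCont_potentials isCont_cutoff by (intro continuous_intros) auto
  then have "(gap \<longlongrightarrow> gap z) (nhds z)" unfolding isCont_def tendsto_at_iff_tendsto_nhds .
  moreover have "0 < gap z" using inner_potential_less_outer_at_rim[OF True] by (simp add: gap_def)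
  ultimately have "\<forall>\<^sub>F q in nhds z. 0 < gap q" by (rule order_tendstoD(1))
  then show ?thesis by eventually_elim (auto simp: potential_def gap_def)
next
  case False
  then have "\<not> norm z \<le> exp (L + k)" using assms L k ln_norm_iff(2)[of "L + k" z] by simp
  then have "\<forall>\<^sub>F q in nhds z. q \<in> - cball 0 (exp (L + k))" by (intro eventually_nhds_in_open) auto
  then show ?thesis
    by eventually_elim (use L k in \<open>auto simp: potential_def ln_norm_iff\<close>)
qed

lemma continuous_on_potential: "continuous_on UNIV potential"
proof (intro continuous_at_imp_continuous_on ballI)
  fix z :: 'a
  consider (inner) "ln (norm z) < L" | (middle) "L \<le> ln (norm z)" "ln (norm z) < L + k"
    | (outer) "L + k \<le> ln (norm z)"
    by linarith
  then show "isCont potential z"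
  proof cases
    case inner
    then show ?thesis using isCont_cong[OF eventually_potential_inner] isCont_potentials(1) by blast
  next
    case middle
    then have "z \<noteq> 0" using L by auto
    then have "isCont (\<lambda>q. max (outer_potential q) (inner_potential q - cutoff q)) z"
      using isCont_potentials isCont_cutoff by (intro continuous_intros) auto
    then show ?thesis using isCont_cong[OF eventually_potential_middle] middle by blast
  next
    case outer
    then have "z \<noteq> 0" using L k by auto
    then show ?thesis using isCont_cong[OF eventually_potential_outer[OF outer]] isCont_potentials(2) by blast
  qed
qed

lemma potential_eq_1:
  assumes "norm z \<le> exp (2 * L)" "z \<noteq> 0 \<Longrightarrow> pole_cos z = -1"
  shows "potential z = 1"
proof (cases "z = 0")
  case True
  then show ?thesis
    using potential_inner[of z] L by (simp add: inner_potential_def coords_at_0 ring_potential_ends[OF dim])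
next
  case False
  then have "outer_coord z = -1"
    using assms spheroidal_cos_ends(2)[of "exp (2 * L) / norm z"] by (simp add: outer_coord_def)
  then have "outer_potential z = 1" by (simp add: outer_potential_def ring_potential_ends[OF dim])
  then show ?thesis using potentials_range(1)[of z] cutoff_nonneg[of z] by (auto simp: potential_def)
qed

lemma potential_eq_0:
  assumes "1 \<le> norm z" "pole_cos z = 1"
  shows "potential z = 0"
proof -
  have "z \<noteq> 0" using assms by auto
  then have "inner_coord z = 1" "outer_coord z = 1"
    using assms spheroidal_cos_ends(1)[OF outer_radius_pos] spheroidal_cos_ends(2)[of "norm z"]
    by (auto simp: inner_coord_def outer_coord_def)
  then show ?thesis
    using cutoff_nonneg[of z]
    by (auto simp: potential_def inner_potential_def outer_potential_def ring_potential_ends[OF dim])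
qed

lemma slope_le_inner_potential:
  assumes z: "z \<noteq> 0" and inside: "-1 < inner_coord z" "inner_coord z < 1"
  shows "slope_le inner_potential (twisted_slope DIM('a) b (norm z) (pole_cos z) / norm z) z UNIV"
proof -
  have "(norm has_derivative (\<lambda>h. 1 * norm z * (sgn z \<bullet> h) / norm z)) (at z)"
    using has_derivative_norm[OF z] z by (simp add: inner_commute)
  from slope_le_twisted_ring_potential[OF frame dim b z _ this] show ?thesis
    using z inside by (simp add: inner_potential_def[abs_def] inner_coord_def)
qed

lemma slope_le_outer_potential:
  assumes z: "z \<noteq> 0" and inside: "-1 < outer_coord z" "outer_coord z < 1"
  shows "slope_le outer_potential
        (twisted_slope DIM('a) b (exp (2 * L) / norm z) (- pole_cos z) / norm z) z UNIV"
proof -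
  have "((\<lambda>z. exp (2 * L) / norm z) has_derivative (\<lambda>h. -1 * (exp (2 * L) / norm z) * (sgn z \<bullet> h) / norm z)) (at z)"
    using z by (auto intro!: derivative_eq_intros has_derivative_norm simp: fun_eq_iff inner_commute field_simps)
  from slope_le_twisted_ring_potential[OF frame dim b z _ this] show ?thesis
    using z inside by (simp add: outer_potential_def[abs_def] outer_coord_def)
qed

lemma slope_le_cutoff: "z \<noteq> 0 \<Longrightarrow> slope_le cutoff (\<delta> / k / norm z) z UNIV"
  unfolding cutoff_def[abs_def]
proof (intro slope_le_max slope_le_const)
  assume z: "z \<noteq> 0"
  show "0 \<le> \<delta> / k / norm z" using \<delta> k by simp
  have "\<bar>sgn z \<bullet> h\<bar> \<le> norm h" for h using Cauchy_Schwarz_ineq2[of "sgn z" h] z by (simp add: norm_sgn)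
  then have bound: "norm (\<delta> / k * ((sgn z \<bullet> h) / norm z - 0)) \<le> \<delta> / k / norm z * norm h" for h
    using \<delta> k by (simp add: abs_mult divide_right_mono mult_left_mono)
  show "slope_le (\<lambda>q. \<delta> / k * (ln (norm q) - L)) (\<delta> / k / norm z) z UNIV"
    by (rule slope_le_has_derivative[OF has_derivative_mult_right[OF has_derivative_diff[OF
        ln_norm_has_derivative[OF z] has_derivative_const]] bound])
qed

lemma slope_le_potential_middle:
  assumes between: "0 < potential z" "potential z < 1" and middle: "L \<le> ln (norm z)" "ln (norm z) < L + k"
  shows "slope_le potential (potential_slope z) z UNIV"
proof -
  have z: "z \<noteq> 0" using middle L by auto
  then have norm: "0 < norm z" "exp (ln (norm z)) = norm z" "exp (2 * L - ln (norm z)) = exp (2 * L) / norm z"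
    by (auto simp: exp_diff)
  have "exp 0 \<le> exp (ln (norm z))" "exp (ln (norm z)) \<le> exp (2 * L)"
    unfolding exp_le_cancel_iff using middle L k by auto
  then have "1 \<le> norm z" "norm z \<le> exp (2 * L)" unfolding norm(2) exp_zero .
  then have "pole_cos z \<noteq> 1" "pole_cos z \<noteq> -1" using potential_eq_0[of z] potential_eq_1[of z] between by auto
  then have c: "\<bar>pole_cos z\<bar> < 1" "\<bar>- pole_cos z\<bar> < 1" using abs_pole_cos_le[of z] by auto
  have "slope_le (\<lambda>q. inner_potential q - cutoff q)
      (twisted_slope DIM('a) b (norm z) (pole_cos z) / norm z + \<delta> / k / norm z) z UNIV"
    using spheroidal_cos_strict[OF c(1) norm(1)] z
    by (intro slope_le_diff slope_le_inner_potential slope_le_cutoff) (auto simp: inner_coord_def)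
  moreover have "slope_le outer_potential
        (twisted_slope DIM('a) b (exp (2 * L) / norm z) (- pole_cos z) / norm z) z UNIV"
    using spheroidal_cos_strict[OF c(2) outer_radius_pos[OF z]] z
    by (intro slope_le_outer_potential) (auto simp: outer_coord_def)
  moreover have "twisted_slope DIM('a) b (norm z) (pole_cos z) / norm z + \<delta> / k / norm z \<le> potential_slope z"
    "twisted_slope DIM('a) b (exp (2 * L) / norm z) (- pole_cos z) / norm z \<le> potential_slope z"
    unfolding add_divide_distrib[symmetric] potential_slope_def shell_slope_def using middle norm
    by (auto intro!: divide_right_mono)
  ultimately have "slope_le (\<lambda>q. max (outer_potential q) (inner_potential q - cutoff q)) (potential_slope z) z UNIV"
    by (intro slope_le_max) (auto elim: slope_le_mono)
  then show ?thesis using slope_le_cong[OF eventually_potential_middle[OF middle(2)]] by blast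
qed

lemma slope_le_potential:
  assumes between: "0 < potential z" "potential z < 1"
  shows "slope_le potential (potential_slope z) z UNIV"
proof -
  note ends = ring_potential_ends[OF dim]
  have z: "z \<noteq> 0" using between potential_eq_1[of 0] by auto
  then have norm: "exp (ln (norm z)) = norm z" "exp (2 * L - ln (norm z)) = exp (2 * L) / norm z"
    by (auto simp: exp_diff)
  consider (inner) "ln (norm z) < L" | (middle) "L \<le> ln (norm z)" "ln (norm z) < L + k"
    | (outer) "L + k \<le> ln (norm z)"
    by linarith
  then show ?thesis
  proof cases
    case inner
    have "inner_coord z \<noteq> -1" "inner_coord z \<noteq> 1"
      using between inner ends by (auto simp: potential_inner inner_potential_def)
    then have "slope_le inner_potential (twisted_slope DIM('a) b (norm z) (pole_cos z) / norm z) z UNIV"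
      using coords_range(1)[of z] by (intro slope_le_inner_potential[OF z]) auto
    moreover have "twisted_slope DIM('a) b (norm z) (pole_cos z) / norm z \<le> potential_slope z"
      using inner k norm by (auto simp: potential_slope_def shell_slope_def intro!: divide_right_mono)
    ultimately show ?thesis using slope_le_cong[OF eventually_potential_inner[OF inner]] slope_le_mono by blast
  next
    case middle
    then show ?thesis by (rule slope_le_potential_middle[OF between])
  next
    case outer
    have "potential z = outer_potential z"
      using eventually_nhds_x_imp_x[OF eventually_potential_outer[OF outer]] .
    then have "outer_coord z \<noteq> -1" "outer_coord z \<noteq> 1" using between ends by (auto simp: outer_potential_def)
    then have "slope_le outer_potential
        (twisted_slope DIM('a) b (exp (2 * L) / norm z) (- pole_cos z) / norm z) z UNIV"
      using coords_range(2)[of z] by (intro slope_le_outer_potential[OF z]) auto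
    moreover have "twisted_slope DIM('a) b (exp (2 * L) / norm z) (- pole_cos z) / norm z \<le> potential_slope z"
      using outer k norm by (auto simp: potential_slope_def shell_slope_def intro!: divide_right_mono)
    ultimately show ?thesis using slope_le_cong[OF eventually_potential_outer[OF outer]] slope_le_mono by blast
  qed
qed

end

subsection \<open>The energy of the glued potential\<close>

definition twisted_energy :: "nat \<Rightarrow> real \<Rightarrow> real \<Rightarrow> ennreal" where
  "twisted_energy n b T = (\<integral>\<^sup>+s. ennreal ((1 + s\<^sup>2) powr (- real n / 2)) *
     ennreal (twisted_slope n b T (cos_of_cot s) ^ n) \<partial>lborel)"

definition twist_bound :: "nat \<Rightarrow> real \<Rightarrow> real" where
  "twist_bound n b = sqrt (1 + 2 * b) ^ n"

definition half_energy :: "nat \<Rightarrow> real \<Rightarrow> real \<Rightarrow> real" where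
  "half_energy n b X = twist_bound n (b\<^sup>2) * ln (4 * exp X + 2) +
     (twist_bound n b - twist_bound n (b\<^sup>2)) * ln (4 * (1 + 1 / b) + 2)"

text \<open>The parameter \<open>\<theta>\<close> weighs the two summands of the slope in the transition shell of logarithmic width \<open>k\<close>.\<close>

definition transition_energy :: "nat \<Rightarrow> real \<Rightarrow> real \<Rightarrow> real \<Rightarrow> real \<Rightarrow> real" where
  "transition_energy n b k \<delta> \<theta> = k * (twist_bound n (b\<^sup>2) / (1 - \<theta>) ^ (n - 1) * (3/2) +
     (\<delta> / k) ^ n / \<theta> ^ (n - 1) * (cot_integral (real n / 2) * cap_integral n ^ (n - 1)))"

lemma power_add_le_convex:
  fixes x y \<theta> :: real
  assumes "0 \<le> x" "0 \<le> y" "0 < \<theta>" "\<theta> < 1" "1 \<le> n"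
  shows "(x + y) ^ n \<le> x ^ n / (1 - \<theta>) ^ (n - 1) + y ^ n / \<theta> ^ (n - 1)"
proof -
  have "((1 - \<theta>) * (x / (1 - \<theta>)) + \<theta> * (y / \<theta>)) ^ n \<le> (1 - \<theta>) * (x / (1 - \<theta>)) ^ n + \<theta> * (y / \<theta>) ^ n"
    using convex_onD[OF convex_on_power_nonneg[of n], of \<theta> "x / (1 - \<theta>)" "y / \<theta>"] assms by simp
  moreover have "w * (x / w) ^ n = x ^ n / w ^ (n - 1)" if "0 < w" for w x :: real
    using assms(5) that by (cases n) (auto simp: power_divide)
  ultimately show ?thesis using assms by simp
qed

lemma twisted_energy_measurable [measurable]: "twisted_energy n b \<in> borel_measurable borel"
  unfolding twisted_energy_def by measurable

lemma twist_bound_mono: "0 \<le> b \<Longrightarrow> b \<le> b' \<Longrightarrow> twist_bound n b \<le> twist_bound n b'"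
  by (simp add: twist_bound_def power_mono)

lemma twist_bound_nonneg: "0 \<le> b \<Longrightarrow> 0 \<le> twist_bound n b"
  by (simp add: twist_bound_def)

lemma half_energy_nonneg:
  assumes "0 < b" "b \<le> 1"
  shows "0 \<le> half_energy n b X"
proof -
  have "0 \<le> ln (4 * exp X + 2)" "0 \<le> ln (4 * (1 + 1 / b) + 2)"
    using assms by (auto intro!: ln_ge_zero add_increasing)
  moreover have "b\<^sup>2 \<le> b" using assms by (simp add: power2_eq_square mult_left_le)
  then have "twist_bound n (b\<^sup>2) \<le> twist_bound n b" by (intro twist_bound_mono) auto
  ultimately show ?thesis unfolding half_energy_def using twist_bound_nonneg[of "b\<^sup>2" n] by simp
qed

lemma transition_energy_nonneg:
  assumes "2 \<le> n" "0 < k" "0 < \<delta>" "0 < \<theta>" "\<theta> < 1"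
  shows "0 \<le> transition_energy n b k \<delta> \<theta>"
  unfolding transition_energy_def
  using assms twist_bound_nonneg[of "b\<^sup>2" n] cot_integral_pos[of "real n / 2"] cap_integral_pos[OF assms(1)]
  by simp

lemma twisted_energy_eq:
  assumes "2 \<le> n" "0 < b" "0 < T"
  shows "twisted_energy n b T = ennreal (twist_factor b T ^ n) * sphere_energy n T"
proof -
  have "ennreal (twisted_slope n b T (cos_of_cot s) ^ n) =
      ennreal (twist_factor b T ^ n) * ennreal (spheroidal_slope n T (cos_of_cot s) ^ n)" for s
    unfolding twisted_slope_def power_mult_distrib using twist_factor_pos[OF assms(2), of T]
    by (intro ennreal_mult)
       (auto intro!: zero_le_power spheroidal_slope_nonneg assms less_imp_le[OF abs_cos_of_cot_less])
  then show ?thesis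
    unfolding twisted_energy_def sphere_energy_def by (subst nn_integral_cmult[symmetric]) (simp_all add: mult_ac)
qed

lemma twisted_energy_le_const:
  assumes n: "2 \<le> n" and b: "0 < b" and T: "2 \<le> T" "1 + 1 / b < T"
  shows "twisted_energy n b T \<le> ennreal (twist_bound n (b\<^sup>2) * (3/2 * (1 / cap_integral n ^ (n - 1))))"
proof -
  have "twist_factor b T ^ n = twist_bound n (b\<^sup>2)" using T by (simp add: twist_factor_def twist_bound_def)
  then have "twisted_energy n b T = ennreal (twist_bound n (b\<^sup>2)) * sphere_energy n T"
    using twisted_energy_eq[OF n b, of T] T by simp
  also have "\<dots> \<le> ennreal (twist_bound n (b\<^sup>2)) * ennreal (3/2 * (1 / cap_integral n ^ (n - 1)))"
    by (intro mult_left_mono sphere_energy_le_const n T) simp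
  also have "\<dots> = ennreal (twist_bound n (b\<^sup>2) * (3/2 * (1 / cap_integral n ^ (n - 1))))"
    using twist_bound_nonneg[of "b\<^sup>2" n] cap_integral_pos[OF n] by (subst ennreal_mult) auto
  finally show ?thesis .
qed

lemma twisted_energy_integral:
  assumes n: "2 \<le> n" and b: "0 < b" "b \<le> 1"
  shows "(\<integral>\<^sup>+\<xi>\<in>{..X}. twisted_energy n b (exp \<xi>) \<partial>lborel) \<le>
    ennreal (1 / cap_integral n ^ (n - 1) * half_energy n b X)"
proof -
  let ?near = "twist_bound n b" and ?far = "twist_bound n (b\<^sup>2)" and ?I = "1 / cap_integral n ^ (n - 1)"
  define T0 where "T0 = 1 + 1 / b"
  have T0: "0 < T0" using b by (simp add: T0_def add_pos_pos)
  have "b\<^sup>2 \<le> b" using b by (simp add: power2_eq_square mult_left_le)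
  then have bounds: "0 \<le> ?far" "?far \<le> ?near" by (auto intro: twist_bound_nonneg twist_bound_mono)
  have logs: "0 \<le> ln (4 * T0 + 2)" "0 \<le> ln (4 * exp X + 2)" using T0 by (auto intro!: ln_ge_zero add_increasing)
  have "(\<integral>\<^sup>+\<xi>\<in>{..X}. twisted_energy n b (exp \<xi>) \<partial>lborel) \<le>
     (\<integral>\<^sup>+\<xi>. ennreal ?far * (sphere_energy n (exp \<xi>) * indicator {..X} \<xi>) +
       ennreal (?near - ?far) * (sphere_energy n (exp \<xi>) * indicator {..ln T0} \<xi>) \<partial>lborel)"
  proof (rule nn_integral_mono)
    fix \<xi> :: real
    have iff: "exp \<xi> \<le> T0 \<longleftrightarrow> \<xi> \<le> ln T0" using T0 by (metis exp_le_cancel_iff exp_ln)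
    have "ennreal (twist_factor b (exp \<xi>) ^ n) = ennreal ?far + ennreal (?near - ?far) * indicator {..ln T0} \<xi>"
    proof (cases "\<xi> \<le> ln T0")
      case True
      then have "twist_factor b (exp \<xi>) ^ n = ?far + (?near - ?far)"
        using iff by (simp add: twist_factor_def twist_bound_def T0_def)
      then show ?thesis using True bounds by (simp add: ennreal_plus[symmetric] del: ennreal_plus)
    qed (use iff in \<open>simp add: twist_factor_def twist_bound_def T0_def\<close>)
    then show "twisted_energy n b (exp \<xi>) * indicator {..X} \<xi> \<le>
        ennreal ?far * (sphere_energy n (exp \<xi>) * indicator {..X} \<xi>) +
       ennreal (?near - ?far) * (sphere_energy n (exp \<xi>) * indicator {..ln T0} \<xi>)"
      unfolding twisted_energy_eq[OF n b(1) exp_gt_zero] by (auto simp: indicator_def distrib_right)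
  qed
  also have "\<dots> = ennreal ?far * (\<integral>\<^sup>+\<xi>\<in>{..X}. sphere_energy n (exp \<xi>) \<partial>lborel) +
      ennreal (?near - ?far) * (\<integral>\<^sup>+\<xi>\<in>{..ln T0}. sphere_energy n (exp \<xi>) \<partial>lborel)"
    by (subst nn_integral_add) (auto simp: nn_integral_cmult)
  also have "\<dots> \<le> ennreal ?far * ennreal (?I * ln (4 * exp X + 2)) +
      ennreal (?near - ?far) * ennreal (?I * ln (4 * exp (ln T0) + 2))"
    by (intro add_mono mult_left_mono sphere_energy_integral n) auto
  also have "\<dots> = ennreal (?far * (?I * ln (4 * exp X + 2)) + (?near - ?far) * (?I * ln (4 * T0 + 2)))"
    using bounds logs cap_integral_pos[OF n] T0
    by (simp add: ennreal_mult[symmetric] ennreal_plus[symmetric] del: ennreal_plus)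
  also have "?far * (?I * ln (4 * exp X + 2)) + (?near - ?far) * (?I * ln (4 * T0 + 2)) = ?I * half_energy n b X"
    unfolding half_energy_def T0_def distrib_left by (simp only: mult_ac)
  finally show ?thesis .
qed

context glued_potential
begin

definition shell_energy :: "real \<Rightarrow> ennreal" where
  "shell_energy \<xi> = (\<integral>\<^sup>+s. ennreal ((1 + s\<^sup>2) powr (- real DIM('a) / 2)) *
     ennreal (shell_slope \<xi> (cos_of_cot s) ^ DIM('a)) \<partial>lborel)"

lemma shell_slope_measurable [measurable]: "(\<lambda>(\<xi>, c). shell_slope \<xi> c) \<in> borel_measurable (borel \<Otimes>\<^sub>M borel)"
  unfolding shell_slope_def by measurable

lemma potential_slope_measurable [measurable]: "potential_slope \<in> borel_measurable borel"
  unfolding potential_slope_def[abs_def] axis_cos_def by measurable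

lemma shell_slope_nonneg: "\<bar>c\<bar> \<le> 1 \<Longrightarrow> 0 \<le> shell_slope \<xi> c"
  unfolding shell_slope_def using twisted_slope_nonneg[OF dim b(1) exp_gt_zero] \<delta> k
  by (auto simp: le_max_iff_disj)

lemma potential_slope_nonneg: "0 \<le> potential_slope z"
  unfolding potential_slope_def using shell_slope_nonneg[OF abs_pole_cos_le(1)] by simp

lemma energy_eq_shell_energy:
  "(\<integral>\<^sup>+z. ennreal (potential_slope z) ^ DIM('a) \<partial>lborel) =
    ennreal (equator_area TYPE('a)) * (\<integral>\<^sup>+\<xi>. shell_energy \<xi> \<partial>lborel)"
proof -
  let ?n = "DIM('a)" and ?pole = "\<lambda>\<xi>. great_circle e0 e1 (\<epsilon> * \<xi>)"
  let ?F = "\<lambda>\<xi> q. ennreal (shell_slope \<xi> (q \<bullet> ?pole \<xi>) ^ ?n)"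
  have "ennreal (potential_slope z) ^ ?n = radial_weight z * ?F (ln (norm z)) (sgn z)" for z
  proof -
    have slope: "0 \<le> shell_slope (ln (norm z)) (pole_cos z)" by (rule shell_slope_nonneg[OF abs_pole_cos_le(1)])
    have "ennreal (potential_slope z) ^ ?n = ennreal ((shell_slope (ln (norm z)) (pole_cos z) / norm z) ^ ?n)"
      using slope by (simp add: potential_slope_def ennreal_power)
    also have "\<dots> = ennreal (1 / norm z ^ ?n) * ennreal (shell_slope (ln (norm z)) (pole_cos z) ^ ?n)"
      using slope by (subst ennreal_mult[symmetric]) (auto simp: power_divide)
    finally show ?thesis by (simp add: radial_weight_def axis_cos_def)
  qed
  then have "(\<integral>\<^sup>+z. ennreal (potential_slope z) ^ ?n \<partial>lborel) = (\<integral>\<^sup>+\<xi>. (\<integral>\<^sup>+q. ?F \<xi> q \<partial>sphere_measure) \<partial>lborel)"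
    by (simp only:) (rule nn_integral_polar, measurable)
  also have "\<dots> = (\<integral>\<^sup>+\<xi>. ennreal (equator_area TYPE('a)) * shell_energy \<xi> \<partial>lborel)"
  proof (rule nn_integral_cong)
    fix \<xi> :: real
    show "(\<integral>\<^sup>+q. ?F \<xi> q \<partial>sphere_measure) = ennreal (equator_area TYPE('a)) * shell_energy \<xi>"
      unfolding shell_energy_def
      by (rule nn_integral_sphere_axis[OF _ norm_great_circle[OF frame] dim]) measurable
  qed
  also have "\<dots> = ennreal (equator_area TYPE('a)) * (\<integral>\<^sup>+\<xi>. shell_energy \<xi> \<partial>lborel)"
    unfolding shell_energy_def by (rule nn_integral_cmult) measurable
  finally show ?thesis .
qed

lemma twisted_energy_reflect:
  "(\<integral>\<^sup>+s. ennreal ((1 + s\<^sup>2) powr (- real DIM('a) / 2)) *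
     ennreal (twisted_slope DIM('a) b T (- cos_of_cot s) ^ DIM('a)) \<partial>lborel) = twisted_energy DIM('a) b T"
  unfolding twisted_energy_def
  using nn_integral_real_reflect[of "\<lambda>s. ennreal ((1 + s\<^sup>2) powr (- real DIM('a) / 2)) *
     ennreal (twisted_slope DIM('a) b T (cos_of_cot s) ^ DIM('a))" 0]
  by (simp add: cos_of_cot_minus)

lemma shell_energy_inner:
  assumes "\<xi> < L"
  shows "shell_energy \<xi> = twisted_energy DIM('a) b (exp \<xi>)"
proof -
  have "shell_slope \<xi> (cos_of_cot s) = twisted_slope DIM('a) b (exp \<xi>) (cos_of_cot s)" for s
    using assms k twisted_slope_nonneg[OF dim b(1) exp_gt_zero less_imp_le[OF abs_cos_of_cot_less]]
    by (simp add: shell_slope_def)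
  then show ?thesis by (simp add: shell_energy_def twisted_energy_def)
qed

lemma shell_energy_outer:
  assumes "L + k < \<xi>"
  shows "shell_energy \<xi> = twisted_energy DIM('a) b (exp (2 * L - \<xi>))"
proof -
  have "\<bar>- cos_of_cot s\<bar> \<le> 1" for s using less_imp_le[OF abs_cos_of_cot_less[of s]] by simp
  from twisted_slope_nonneg[OF dim b(1) exp_gt_zero this]
  have "shell_slope \<xi> (cos_of_cot s) = twisted_slope DIM('a) b (exp (2 * L - \<xi>)) (- cos_of_cot s)" for s
    using assms k by (simp add: shell_slope_def)
  then show ?thesis unfolding shell_energy_def by (simp only: twisted_energy_reflect)
qed

lemma shell_slope_power_middle:
  assumes \<xi>: "L \<le> \<xi>" "\<xi> \<le> L + k" and \<theta>: "0 < \<theta>" "\<theta> < 1" and c: "\<bar>c\<bar> \<le> 1"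
  shows "shell_slope \<xi> c ^ DIM('a) \<le> 1 / (1 - \<theta>) ^ (DIM('a) - 1) * twisted_slope DIM('a) b (exp \<xi>) c ^ DIM('a) +
    (\<delta> / k) ^ DIM('a) / \<theta> ^ (DIM('a) - 1) + twisted_slope DIM('a) b (exp (2 * L - \<xi>)) (- c) ^ DIM('a)"
proof -
  let ?n = "DIM('a)"
  let ?A = "twisted_slope ?n b (exp \<xi>) c" and ?B = "twisted_slope ?n b (exp (2 * L - \<xi>)) (- c)"
  have nonneg: "0 \<le> ?A" "0 \<le> ?B" using c by (auto intro!: twisted_slope_nonneg dim b(1))
  have "shell_slope \<xi> c = max (?A + \<delta> / k) ?B" using \<xi> by (simp add: shell_slope_def)
  then have "shell_slope \<xi> c ^ ?n \<le> (?A + \<delta> / k) ^ ?n + ?B ^ ?n" using nonneg \<delta> k by (auto simp: max_def)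
  moreover have "(?A + \<delta> / k) ^ ?n \<le> ?A ^ ?n / (1 - \<theta>) ^ (?n - 1) + (\<delta> / k) ^ ?n / \<theta> ^ (?n - 1)"
    using nonneg \<delta> k \<theta> dim by (intro power_add_le_convex) auto
  ultimately show ?thesis by simp
qed

lemma shell_energy_middle:
  assumes \<xi>: "L \<le> \<xi>" "\<xi> \<le> L + k" and \<theta>: "0 < \<theta>" "\<theta> < 1"
  shows "shell_energy \<xi> \<le> ennreal (1 / (1 - \<theta>) ^ (DIM('a) - 1)) * twisted_energy DIM('a) b (exp \<xi>) +
    ennreal ((\<delta> / k) ^ DIM('a) / \<theta> ^ (DIM('a) - 1)) * ennreal (cot_integral (real DIM('a) / 2)) +
    twisted_energy DIM('a) b (exp (2 * L - \<xi>))"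
proof -
  let ?n = "DIM('a)"
  let ?\<alpha> = "1 / (1 - \<theta>) ^ (?n - 1)" and ?\<beta> = "(\<delta> / k) ^ ?n / \<theta> ^ (?n - 1)"
  let ?w = "\<lambda>s. ennreal ((1 + s\<^sup>2) powr (- real ?n / 2))"
  let ?A = "\<lambda>s. twisted_slope ?n b (exp \<xi>) (cos_of_cot s) ^ ?n"
  let ?B = "\<lambda>s. twisted_slope ?n b (exp (2 * L - \<xi>)) (- cos_of_cot s) ^ ?n"
  have "shell_energy \<xi> \<le> (\<integral>\<^sup>+s. ennreal ?\<alpha> * (?w s * ennreal (?A s)) + ennreal ?\<beta> * ?w s +
      ?w s * ennreal (?B s) \<partial>lborel)"
    unfolding shell_energy_def
  proof (rule nn_integral_mono)
    fix s :: real
    have c: "\<bar>cos_of_cot s\<bar> \<le> 1" using abs_cos_of_cot_less by (rule less_imp_le)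
    then have nonneg: "0 \<le> ?A s" "0 \<le> ?B s" by (auto intro!: twisted_slope_nonneg dim b(1) zero_le_power)
    have coeffs: "0 \<le> ?\<alpha>" "0 \<le> ?\<beta>" using \<theta> \<delta> k by auto
    have "ennreal (shell_slope \<xi> (cos_of_cot s) ^ ?n) \<le> ennreal (?\<alpha> * ?A s + ?\<beta> + ?B s)"
      by (rule ennreal_leI[OF shell_slope_power_middle[OF \<xi> \<theta> c]])
    also have "\<dots> = ennreal ?\<alpha> * ennreal (?A s) + ennreal ?\<beta> + ennreal (?B s)"
      by (simp only: ennreal_plus ennreal_mult coeffs nonneg add_nonneg_nonneg mult_nonneg_nonneg)
    finally have "?w s * ennreal (shell_slope \<xi> (cos_of_cot s) ^ ?n) \<le>
        ?w s * (ennreal ?\<alpha> * ennreal (?A s) + ennreal ?\<beta> + ennreal (?B s))"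
      by (rule mult_left_mono) simp
    then show "?w s * ennreal (shell_slope \<xi> (cos_of_cot s) ^ ?n) \<le>
        ennreal ?\<alpha> * (?w s * ennreal (?A s)) + ennreal ?\<beta> * ?w s + ?w s * ennreal (?B s)"
      by (simp only: distrib_left mult_ac)
  qed
  also have "\<dots> = ennreal ?\<alpha> * (\<integral>\<^sup>+s. ?w s * ennreal (?A s) \<partial>lborel) + ennreal ?\<beta> * (\<integral>\<^sup>+s. ?w s \<partial>lborel) +
      (\<integral>\<^sup>+s. ?w s * ennreal (?B s) \<partial>lborel)"
    by (subst nn_integral_add, measurable, subst nn_integral_add, measurable, simp add: nn_integral_cmult)
  also have "(\<integral>\<^sup>+s. ?w s \<partial>lborel) = ennreal (cot_integral (real ?n / 2))"
    using nn_integral_cot[of "real ?n / 2"] dim by simp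
  finally show ?thesis unfolding twisted_energy_reflect twisted_energy_def[symmetric] .
qed

lemma shell_energy_middle_le_const:
  assumes \<xi>: "L \<le> \<xi>" "\<xi> \<le> L + k" and \<theta>: "0 < \<theta>" "\<theta> < 1" and L_large: "2 \<le> exp L" "1 + 1 / b < exp L"
  shows "shell_energy \<xi> \<le> ennreal (transition_energy DIM('a) b k \<delta> \<theta> / (k * cap_integral DIM('a) ^ (DIM('a) - 1))) +
    twisted_energy DIM('a) b (exp (2 * L - \<xi>))"
proof -
  let ?n = "DIM('a)"
  let ?\<alpha> = "1 / (1 - \<theta>) ^ (?n - 1)" and ?\<beta> = "(\<delta> / k) ^ ?n / \<theta> ^ (?n - 1)"
  let ?far = "twist_bound ?n (b\<^sup>2) * (3/2 * (1 / cap_integral ?n ^ (?n - 1)))"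
  have "2 \<le> exp \<xi>" "1 + 1 / b < exp \<xi>" using exp_le_cancel_iff[of L \<xi>] \<xi> L_large by linarith+
  then have "twisted_energy ?n b (exp \<xi>) \<le> ennreal ?far" by (intro twisted_energy_le_const dim b(1))
  then have "ennreal ?\<alpha> * twisted_energy ?n b (exp \<xi>) + ennreal ?\<beta> * ennreal (cot_integral (real ?n / 2)) \<le>
      ennreal ?\<alpha> * ennreal ?far + ennreal ?\<beta> * ennreal (cot_integral (real ?n / 2))"
    by (intro add_mono mult_left_mono) auto
  also have "\<dots> = ennreal (?\<alpha> * ?far + ?\<beta> * cot_integral (real ?n / 2))"
  proof -
    have "0 \<le> ?\<alpha>" "0 \<le> ?far" "0 \<le> ?\<beta>" "0 \<le> cot_integral (real ?n / 2)"
      using \<theta> \<delta> k twist_bound_nonneg[of "b\<^sup>2" ?n] cap_integral_pos[OF dim] cot_integral_pos[of "real ?n / 2"] dim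
      by auto
    then show ?thesis by (simp only: ennreal_mult ennreal_plus mult_nonneg_nonneg)
  qed
  also have "?\<alpha> * ?far + ?\<beta> * cot_integral (real ?n / 2) =
      transition_energy ?n b k \<delta> \<theta> / (k * cap_integral ?n ^ (?n - 1))"
    using k cap_integral_pos[OF dim] by (simp add: transition_energy_def field_simps)
  finally show ?thesis
    using shell_energy_middle[OF \<xi> \<theta>] by (meson add_right_mono order_trans)
qed

lemma shell_energy_le:
  assumes \<theta>: "0 < \<theta>" "\<theta> < 1" and L_large: "2 \<le> exp L" "1 + 1 / b < exp L"
  shows "shell_energy \<xi> \<le> twisted_energy DIM('a) b (exp \<xi>) * indicator {..L} \<xi> +
    ennreal (transition_energy DIM('a) b k \<delta> \<theta> / (k * cap_integral DIM('a) ^ (DIM('a) - 1))) *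
      indicator {L..L + k} \<xi> +
    twisted_energy DIM('a) b (exp (2 * L - \<xi>)) * indicator {..L} (2 * L - \<xi>)"
proof -
  consider (inner) "\<xi> < L" | (middle) "L \<le> \<xi>" "\<xi> \<le> L + k" | (outer) "L + k < \<xi>" by linarith
  then show ?thesis
  proof cases
    case inner
    then show ?thesis by (simp add: shell_energy_inner)
  next
    case middle
    from shell_energy_middle_le_const[OF this \<theta> L_large] show ?thesis
      by (rule order_trans) (use middle in \<open>simp add: indicator_def\<close>)
  next
    case outer
    then show ?thesis using k by (simp add: shell_energy_outer)
  qed
qed

lemma energy_le:
  assumes \<theta>: "0 < \<theta>" "\<theta> < 1" and L_large: "2 \<le> exp L" "1 + 1 / b < exp L"
  shows "(\<integral>\<^sup>+z. ennreal (potential_slope z) ^ DIM('a) \<partial>lborel) \<le>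
    ennreal (cap_constant TYPE('a) * (2 * half_energy DIM('a) b L + transition_energy DIM('a) b k \<delta> \<theta>))"
proof -
  let ?n = "DIM('a)"
  define J where "J = cap_integral ?n ^ (?n - 1)"
  define H where "H = half_energy ?n b L"
  define Z where "Z = transition_energy ?n b k \<delta> \<theta>"
  have pos: "0 < J" "0 \<le> H" "0 \<le> Z" "0 < equator_area TYPE('a)"
    using cap_integral_pos[OF dim] half_energy_nonneg[OF b(1,2)]
      transition_energy_nonneg[OF dim k(1) \<delta> \<theta>] equator_area_pos[OF dim]
    by (auto simp: J_def H_def Z_def)
  let ?half = "\<lambda>\<xi>. twisted_energy ?n b (exp \<xi>) * indicator {..L} \<xi>"
  have half: "(\<integral>\<^sup>+\<xi>. ?half \<xi> \<partial>lborel) \<le> ennreal (H / J)"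
    using twisted_energy_integral[OF dim b(1,2), of L] by (simp add: H_def J_def)
  have "(\<integral>\<^sup>+\<xi>. shell_energy \<xi> \<partial>lborel) \<le>
      (\<integral>\<^sup>+\<xi>. ?half \<xi> + ennreal (Z / (k * J)) * indicator {L..L + k} \<xi> + ?half (2 * L - \<xi>) \<partial>lborel)"
    unfolding Z_def J_def by (intro nn_integral_mono shell_energy_le \<theta> L_large)
  also have "\<dots> = (\<integral>\<^sup>+\<xi>. ?half \<xi> \<partial>lborel) + ennreal (Z / (k * J)) * ennreal k + (\<integral>\<^sup>+\<xi>. ?half (2 * L - \<xi>) \<partial>lborel)"
    using k by (subst nn_integral_add, measurable, subst nn_integral_add, measurable, simp add: nn_integral_cmult)
  also have "(\<integral>\<^sup>+\<xi>. ?half (2 * L - \<xi>) \<partial>lborel) = (\<integral>\<^sup>+\<xi>. ?half \<xi> \<partial>lborel)"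
    by (rule nn_integral_real_reflect) measurable
  also have "(\<integral>\<^sup>+\<xi>. ?half \<xi> \<partial>lborel) + ennreal (Z / (k * J)) * ennreal k + (\<integral>\<^sup>+\<xi>. ?half \<xi> \<partial>lborel) \<le>
      ennreal (H / J) + ennreal (Z / (k * J)) * ennreal k + ennreal (H / J)"
    by (intro add_mono half order_refl)
  also have "\<dots> = ennreal (H / J + Z / (k * J) * k + H / J)"
    using pos k by (simp add: ennreal_mult[symmetric] ennreal_plus[symmetric] del: ennreal_plus)
  also have "H / J + Z / (k * J) * k + H / J = (2 * H + Z) / J" using k by (simp add: add_divide_distrib)
  finally have "(\<integral>\<^sup>+z. ennreal (potential_slope z) ^ ?n \<partial>lborel) \<le>
      ennreal (equator_area TYPE('a)) * ennreal ((2 * H + Z) / J)"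
    unfolding energy_eq_shell_energy by (rule mult_left_mono) simp
  also have "\<dots> = ennreal (cap_constant TYPE('a) * (2 * H + Z))"
    using pos by (subst ennreal_mult[symmetric]) (auto simp: cap_constant_def J_def)
  finally show ?thesis unfolding H_def Z_def .
qed

end

subsection \<open>Curves to the boundary\<close>

lemma openin_extended_space_Some:
  assumes "openin extended_space U"
  shows "open {p. Some p \<in> U}"
proof -
  have "{p. Some p \<in> Some ` V} = V" "{p. Some p \<in> insert None (Some ` (UNIV - V))} = - V" for V :: "'a set"
    by auto
  then show ?thesis using assms unfolding openin_Alexandroff_compactification by auto
qed

lemma openin_extended_space_None:
  assumes "openin extended_space U" "None \<in> U"
  obtains C where "compact C" "\<And>p. p \<notin> C \<Longrightarrow> Some p \<in> U"
  using assms unfolding openin_Alexandroff_compactification by auto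

lemma tends_to_boundary_limit:
  fixes \<gamma> :: "real \<Rightarrow> 'a::euclidean_space"
  assumes \<gamma>: "\<gamma> ` {0..<1} \<subseteq> D"
    and limit: "\<And>U. openin extended_space U \<Longrightarrow> q \<in> U \<Longrightarrow> \<forall>\<^sub>F t in at_left 1. Some (\<gamma> t) \<in> U"
    and q: "q \<notin> Some ` D"
  shows "tends_to_boundary \<gamma> D"
proof -
  have "\<exists>p\<in>Some ` D. p \<in> U" if "q \<in> U" "openin extended_space U" for U
  proof -
    have "\<forall>\<^sub>F t in at_left (1::real). t \<in> {0<..<1}" using eventually_at_left_real[of 0 1] by simp
    with limit[OF that(2,1)] have "\<forall>\<^sub>F t in at_left 1. Some (\<gamma> t) \<in> U \<and> t \<in> {0<..<1}" by eventually_elim auto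
    then obtain t where "Some (\<gamma> t) \<in> U" "t \<in> {0<..<1}"
      using eventually_happens[of _ "at_left (1::real)"] by (auto simp: trivial_limit_at_left_real)
    moreover from this have "\<gamma> t \<in> D" using \<gamma> by auto
    ultimately show ?thesis by blast
  qed
  moreover have "q \<in> topspace extended_space" by (cases q) auto
  ultimately have "q \<in> extended_space closure_of (Some ` D)" unfolding in_closure_of by auto
  then have "q \<in> extended_boundary D"
    using q interior_of_subset[of extended_space "Some ` D"] unfolding extended_boundary_def frontier_of_def
    by blast
  then show ?thesis using limit unfolding tends_to_boundary_def by blast
qed

lemma curves_to_boundaryI:
  assumes "continuous_on {0..<1} \<gamma>" "\<gamma> ` {0..<1} \<subseteq> D" "tends_to_boundary \<gamma> D"
  shows "\<gamma> ` {0..<1} \<in> curves_to_boundary D (\<gamma> 0)"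
  unfolding curves_to_boundary_def using assms by blast

lemma first_exit_time:
  fixes g :: "real \<Rightarrow> 'a::topological_space"
  assumes D: "open D" and g: "continuous_on {0..S} g" "g 0 \<in> D" "g S \<notin> D" "0 \<le> S"
  obtains s where "0 < s" "s \<le> S" "g s \<notin> D" "\<And>t. 0 \<le> t \<Longrightarrow> t < s \<Longrightarrow> g t \<in> D"
proof -
  let ?A = "{0..S} \<inter> g -` (- D)"
  have "closed ?A" using D g(1) by (intro continuous_closed_preimage) auto
  then have "compact ?A" by (auto simp: compact_eq_bounded_closed intro: bounded_subset[OF bounded_closed_interval])
  moreover have "S \<in> ?A" using g(3,4) by auto
  ultimately obtain s where s: "s \<in> ?A" "\<And>t. t \<in> ?A \<Longrightarrow> s \<le> t"
    using compact_attains_inf[of ?A] by blast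
  have "g t \<in> D" if "0 \<le> t" "t < s" for t using s(2)[of t] s(1) that by force
  moreover have "0 < s" using s(1) g(2) by (auto simp: less_le)
  ultimately show thesis using that[of s] s(1) by auto
qed

lemma curve_to_boundary_exit:
  fixes g :: "real \<Rightarrow> 'a::euclidean_space"
  assumes D: "open D" and g: "continuous_on {0..S} g" "g 0 \<in> D" "g S \<notin> D" "0 \<le> S"
  shows "\<exists>C\<in>curves_to_boundary D (g 0). C \<subseteq> g ` {0..S}"
proof -
  obtain s where s: "0 < s" "s \<le> S" "g s \<notin> D" "\<And>t. 0 \<le> t \<Longrightarrow> t < s \<Longrightarrow> g t \<in> D"
    using first_exit_time[OF D g] by blast
  define \<gamma> where "\<gamma> t = g (s * t)" for t
  have scaled: "s * t \<in> {0..S}" if "t \<in> {0..1}" for t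
    using that s(1,2) mult_mono[of s S t 1] by auto
  have cont: "continuous_on {0..1} \<gamma>"
    unfolding \<gamma>_def using scaled by (intro continuous_on_compose2[OF g(1)] continuous_intros) auto
  have inside: "\<gamma> ` {0..<1} \<subseteq> D" using s(1) by (auto simp: \<gamma>_def intro!: s(4))
  have lim: "(\<gamma> \<longlongrightarrow> g s) (at_left 1)"
    using continuous_on_Icc_at_leftD[OF cont] by (simp add: \<gamma>_def)
  have "tends_to_boundary \<gamma> D"
  proof (rule tends_to_boundary_limit[OF inside, of "Some (g s)"])
    fix U assume "openin extended_space U" "Some (g s) \<in> U"
    then show "\<forall>\<^sub>F t in at_left 1. Some (\<gamma> t) \<in> U"
      using topological_tendstoD[OF lim openin_extended_space_Some] by auto
  qed (use s(3) in auto)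
  then have "\<gamma> ` {0..<1} \<in> curves_to_boundary D (\<gamma> 0)"
    by (intro curves_to_boundaryI continuous_on_subset[OF cont] inside) auto
  moreover have "\<gamma> ` {0..<1} \<subseteq> g ` {0..S}" unfolding \<gamma>_def using scaled by fastforce
  ultimately show ?thesis by (auto simp: \<gamma>_def)
qed

lemma curve_to_boundary_unbounded:
  fixes g :: "real \<Rightarrow> 'a::euclidean_space"
  assumes D: "open D" and g: "continuous_on {0..} g" "g 0 \<in> D" "filterlim (\<lambda>s. norm (g s)) at_top at_top"
  shows "\<exists>C\<in>curves_to_boundary D (g 0). C \<subseteq> g ` {0..}"
proof (cases "g ` {0..} \<subseteq> D")
  case False
  then obtain S where "0 \<le> S" "g S \<notin> D" by auto
  then show ?thesis
    using curve_to_boundary_exit[OF D continuous_on_subset[OF g(1), of "{0..S}"] g(2)]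
      image_mono[of "{0..S}" "{0..}" g]
    by (meson Icc_subset_Ici_iff order_refl subset_trans)
next
  case True
  define \<gamma> where "\<gamma> t = g (t / (1 - t))" for t
  have sub: "\<gamma> ` {0..<1} \<subseteq> g ` {0..}" by (auto simp: \<gamma>_def)
  have cont: "continuous_on {0..<1} \<gamma>"
    unfolding \<gamma>_def by (intro continuous_on_compose2[OF g(1)] continuous_intros) auto
  have "filterlim (\<lambda>t::real. t / (1 - t)) at_top (at_left 1)" by real_asymp
  then have lim: "filterlim (\<lambda>t. norm (\<gamma> t)) at_top (at_left 1)"
    unfolding \<gamma>_def by (rule filterlim_compose[OF g(3)])
  have "tends_to_boundary \<gamma> D"
  proof (rule tends_to_boundary_limit[of _ _ None])
    show "\<gamma> ` {0..<1} \<subseteq> D" using sub True by blast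
    fix U :: "'a option set" assume "openin extended_space U" "None \<in> U"
    then obtain C where C: "compact C" "\<And>p. p \<notin> C \<Longrightarrow> Some p \<in> U" using openin_extended_space_None by blast
    then obtain B where B: "\<And>p. p \<in> C \<Longrightarrow> norm p \<le> B" using compact_imp_bounded bounded_iff by metis
    have "\<forall>\<^sub>F t in at_left 1. B < norm (\<gamma> t)" using lim by (simp add: filterlim_at_top_dense)
    then show "\<forall>\<^sub>F t in at_left 1. Some (\<gamma> t) \<in> U"
      by eventually_elim (use C(2) B in force)
  qed auto
  then have "\<gamma> ` {0..<1} \<in> curves_to_boundary D (\<gamma> 0)"
    using sub True cont by (intro curves_to_boundaryI) auto
  then show ?thesis using sub by (auto simp: \<gamma>_def)
qed

subsection \<open>Spirals to the boundary\<close>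

definition spiral :: "'a::real_inner \<Rightarrow> 'a \<Rightarrow> real \<Rightarrow> real \<Rightarrow> 'a" where
  "spiral e0 e1 \<epsilon> s = s *\<^sub>R great_circle e0 e1 (\<epsilon> * ln s)"

lemma great_circle_through:
  fixes e0 u :: "'a::euclidean_space"
  assumes dim: "2 \<le> DIM('a)" and unit: "norm e0 = 1" "norm u = 1" and \<tau>: "0 < \<tau>"
  obtains e1 \<epsilon> where "norm e1 = 1" "e0 \<bullet> e1 = 0" "\<bar>\<epsilon>\<bar> \<le> pi / \<tau>" "great_circle e0 e1 (\<epsilon> * \<tau>) = u"
proof -
  define w where "w = u - (u \<bullet> e0) *\<^sub>R e0"
  have c: "\<bar>u \<bullet> e0\<bar> \<le> 1" using Cauchy_Schwarz_ineq2[of u e0] unit by simp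
  have inner: "e0 \<bullet> e0 = 1" "u \<bullet> u = 1" using unit by (auto simp: norm_eq_1)
  then have "w \<bullet> w = 1 - (u \<bullet> e0)\<^sup>2"
    by (simp add: w_def inner_diff_left inner_diff_right inner_commute power2_eq_square)
  then have norm_w: "norm w = sqrt (1 - (u \<bullet> e0)\<^sup>2)" by (simp add: norm_eq_sqrt_inner)
  have orth: "e0 \<bullet> w = 0" using inner by (simp add: w_def inner_diff_right inner_commute)
  obtain e1 where e1: "norm e1 = 1" "e0 \<bullet> e1 = 0" "norm w *\<^sub>R e1 = w"
  proof (cases "w = 0")
    case True
    obtain v where "v \<noteq> 0" "orthogonal e0 v"
      using orthogonal_to_vector_exists[OF dim] by metis
    then show ?thesis using that[of "sgn v"] True by (simp add: norm_sgn orthogonal_def sgn_div_norm)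
  next
    case False
    then show ?thesis using that[of "sgn w"] orth by (simp add: norm_sgn sgn_div_norm)
  qed
  have "great_circle e0 e1 (arccos (u \<bullet> e0) / \<tau> * \<tau>) = u"
    using c norm_w e1(3) \<tau> by (simp add: great_circle_def sin_arccos_abs w_def)
  moreover have "\<bar>arccos (u \<bullet> e0) / \<tau>\<bar> \<le> pi / \<tau>"
    using \<tau> c arccos_bounded[of "u \<bullet> e0"] by (auto simp: abs_le_iff divide_right_mono)
  ultimately show thesis using e1(1,2) by (intro that)
qed

lemma norm_spiral:
  assumes "norm e0 = 1" "norm e1 = 1" "e0 \<bullet> e1 = 0"
  shows "norm (spiral e0 e1 \<epsilon> s) = \<bar>s\<bar>"
  by (simp add: spiral_def norm_great_circle[OF assms])

lemma continuous_on_spiral: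
  assumes frame: "norm e0 = 1" "norm e1 = 1" "e0 \<bullet> e1 = 0"
  shows "continuous_on {0..} (spiral e0 e1 \<epsilon>)"
  unfolding continuous_on_eq_continuous_within
proof
  fix s :: real assume s: "s \<in> {0..}"
  show "continuous (at s within {0..}) (spiral e0 e1 \<epsilon>)"
  proof (cases "s = 0")
    case True
    have "(spiral e0 e1 \<epsilon> \<longlongrightarrow> 0) (at 0 within {0..})"
      by (rule Lim_null_comparison[of _ "\<lambda>t. \<bar>t\<bar>"]) (auto simp: norm_spiral[OF frame] intro!: tendsto_eq_intros)
    then show ?thesis using True by (simp add: continuous_within spiral_def)
  next
    case False
    then show ?thesis using s unfolding spiral_def[abs_def] great_circle_def by (intro continuous_intros) auto
  qed
qed

lemma inner_spiral_to_boundary: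
  fixes e0 e1 x :: "'a::euclidean_space"
  assumes frame: "norm e0 = 1" "norm e1 = 1" "e0 \<bullet> e1 = 0" and D: "open D" "x \<in> D"
    and exit: "x - r *\<^sub>R spiral e0 e1 \<epsilon> X \<notin> D" "0 \<le> X"
  obtains C where "C \<in> curves_to_boundary D x" "\<And>q. q \<in> C \<Longrightarrow> \<exists>s\<in>{0..X}. q = x - r *\<^sub>R spiral e0 e1 \<epsilon> s"
proof -
  let ?g = "\<lambda>s. x - r *\<^sub>R spiral e0 e1 \<epsilon> s"
  have g0: "?g 0 = x" by (simp add: spiral_def)
  have "continuous_on {0..X} ?g"
    by (intro continuous_intros continuous_on_subset[OF continuous_on_spiral[OF frame]]) auto
  then obtain C where "C \<in> curves_to_boundary D x" "C \<subseteq> ?g ` {0..X}"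
    using curve_to_boundary_exit[OF D(1), of X ?g] g0 D exit by metis
  then show thesis by (intro that) auto
qed

lemma outer_spiral_to_boundary:
  fixes e0 e1 x :: "'a::euclidean_space"
  assumes frame: "norm e0 = 1" "norm e1 = 1" "e0 \<bullet> e1 = 0" and r: "0 < r" and D: "open D" "x + r *\<^sub>R e0 \<in> D"
  obtains C where "C \<in> curves_to_boundary D (x + r *\<^sub>R e0)" "\<And>q. q \<in> C \<Longrightarrow> \<exists>s\<ge>1. q = x + r *\<^sub>R spiral e0 e1 \<epsilon> s"
proof -
  let ?g = "\<lambda>s. x + r *\<^sub>R spiral e0 e1 \<epsilon> (1 + s)"
  have g0: "?g 0 = x + r *\<^sub>R e0" by (simp add: spiral_def great_circle_def)
  have "continuous_on {0..} ?g"
    by (intro continuous_intros continuous_on_compose2[OF continuous_on_spiral[OF frame]]) auto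
  moreover have "filterlim (\<lambda>s. norm (?g s)) at_top at_top"
  proof (rule filterlim_at_top_mono)
    show "filterlim (\<lambda>s. r * (1 + s) - norm x) at_top at_top" using r by real_asymp
    show "\<forall>\<^sub>F s in at_top. r * (1 + s) - norm x \<le> norm (?g s)"
      using eventually_ge_at_top[of 0]
    proof eventually_elim
      case (elim s)
      then have "norm (r *\<^sub>R spiral e0 e1 \<epsilon> (1 + s)) = r * (1 + s)" using r by (simp add: norm_spiral[OF frame])
      then show ?case using norm_triangle_ineq4[of "?g s" x] by simp
    qed
  qed
  ultimately obtain C where "C \<in> curves_to_boundary D (x + r *\<^sub>R e0)" "C \<subseteq> ?g ` {0..}"
    using curve_to_boundary_unbounded[OF D(1), of ?g] g0 D(2) by auto
  moreover have "\<exists>s\<ge>1. q = x + r *\<^sub>R spiral e0 e1 \<epsilon> s" if q: "q \<in> ?g ` {0..}" for q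
  proof -
    obtain s where "0 \<le> s" "q = ?g s" using q by auto
    then show ?thesis by (intro exI[of _ "1 + s"]) auto
  qed
  ultimately show thesis by (intro that) blast+
qed

subsection \<open>The upper bound for the modulus metric\<close>

lemma nn_integral_rescaled_power:
  fixes \<rho> :: "'a::euclidean_space \<Rightarrow> real"
  assumes [measurable]: "\<rho> \<in> borel_measurable borel" and \<rho>: "\<And>z. 0 \<le> \<rho> z" and r: "0 < r"
  shows "(\<integral>\<^sup>+p. ennreal (\<rho> ((p - x) /\<^sub>R r) / r) ^ DIM('a) \<partial>lborel) = (\<integral>\<^sup>+z. ennreal (\<rho> z) ^ DIM('a) \<partial>lborel)"
proof -
  let ?n = "DIM('a)"
  let ?f = "\<lambda>p. ennreal (\<rho> ((p - x) /\<^sub>R r) / r) ^ ?n"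
  have "(\<integral>\<^sup>+p. ?f p \<partial>lborel) = (\<integral>\<^sup>+p. ?f (x + p) \<partial>lborel)"
    by (rule nn_integral_lborel_translate[symmetric]) measurable
  also have "\<dots> = ennreal (\<bar>r\<bar> ^ ?n) * (\<integral>\<^sup>+p. ?f (x + r *\<^sub>R p) \<partial>lborel)"
    using r by (intro nn_integral_lborel_scale) auto
  also have "\<dots> = (\<integral>\<^sup>+p. ennreal (r ^ ?n) * ?f (x + r *\<^sub>R p) \<partial>lborel)"
    using r by (subst nn_integral_cmult) auto
  also have "\<dots> = (\<integral>\<^sup>+z. ennreal (\<rho> z) ^ ?n \<partial>lborel)"
  proof (rule nn_integral_cong)
    fix p :: 'a
    have "ennreal (r ^ ?n) * ennreal ((\<rho> p / r) ^ ?n) = ennreal (\<rho> p ^ ?n)"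
      using r \<rho>[of p] by (subst ennreal_mult[symmetric]) (auto simp: power_divide)
    then show "ennreal (r ^ ?n) * ?f (x + r *\<^sub>R p) = ennreal (\<rho> p) ^ ?n"
      using r \<rho>[of p] by (simp add: ennreal_power)
  qed
  finally show ?thesis .
qed

context glued_potential
begin

lemma admissible_rescaled:
  assumes r: "0 < r"
    and E: "\<And>p. p \<in> E \<Longrightarrow> potential ((p - x) /\<^sub>R r) = 1" and F: "\<And>p. p \<in> F \<Longrightarrow> potential ((p - x) /\<^sub>R r) = 0"
  shows "admissible (joining_curves E F D) (\<lambda>p. ennreal (potential_slope ((p - x) /\<^sub>R r) / r))"
  unfolding admissible_def
proof (intro conjI ballI impI)
  let ?S = "\<lambda>p. (p - x) /\<^sub>R r"
  show "(\<lambda>p. ennreal (potential_slope (?S p) / r)) \<in> borel_measurable borel" by measurable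
  fix \<gamma> assume \<gamma>: "\<gamma> \<in> joining_curves E F D" "rectifiable \<gamma>"
  show "1 \<le> line_integral (\<lambda>p. ennreal (potential_slope (?S p) / r)) \<gamma>"
  proof (rule line_integral_ge_one[where u = "\<lambda>p. potential (?S p)"])
    show "path \<gamma>" "potential (?S (\<gamma> 0)) = 1" "potential (?S (\<gamma> 1)) = 0"
      using \<gamma> E F by (auto simp: joining_curves_def pathstart_def pathfinish_def)
    show "continuous_on UNIV (\<lambda>p. potential (?S p))"
      by (intro continuous_on_compose2[OF continuous_on_potential] continuous_intros) auto
    show "0 \<le> potential_slope (?S p) / r" for p using potential_slope_nonneg r by simp
    fix p assume "0 < potential (?S p)" "potential (?S p) < 1"
    then have "slope_le potential (potential_slope (?S p)) (?S p) UNIV" by (rule slope_le_potential)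
    moreover have "(1 / r)-lipschitz_on UNIV ?S"
      using r by (intro lipschitz_onI) (auto simp: dist_norm scaleR_diff_right[symmetric] divide_inverse_commute)
    ultimately show "slope_le (\<lambda>p. potential (?S p)) (potential_slope (?S p) / r) p UNIV"
      using slope_le_compose_lipschitz[of potential _ ?S p UNIV "1 / r" UNIV] potential_slope_nonneg by simp
  qed (use \<gamma> in measurable)
qed

lemma potential_on_spirals:
  assumes "0 \<le> s"
  shows "s \<le> exp (2 * L) \<Longrightarrow> potential (- spiral e0 e1 \<epsilon> s) = 1"
    and "1 \<le> s \<Longrightarrow> potential (spiral e0 e1 \<epsilon> s) = 0"
proof -
  have norm: "norm (spiral e0 e1 \<epsilon> s) = s" using assms by (simp add: norm_spiral[OF frame])
  have "great_circle e0 e1 (\<epsilon> * ln s) \<bullet> great_circle e0 e1 (\<epsilon> * ln s) = 1"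
    by (simp add: inner_great_circle[OF frame])
  then have cos: "pole_cos (spiral e0 e1 \<epsilon> s) = 1" "pole_cos (- spiral e0 e1 \<epsilon> s) = -1" if "s \<noteq> 0"
    using that assms norm by (auto simp: axis_cos_def sgn_div_norm) (auto simp: spiral_def)
  show "potential (- spiral e0 e1 \<epsilon> s) = 1" if "s \<le> exp (2 * L)"
    using that norm cos(2) by (intro potential_eq_1) (auto simp: spiral_def)
  show "potential (spiral e0 e1 \<epsilon> s) = 0" if "1 \<le> s"
    using that norm cos(1) by (intro potential_eq_0) auto
qed

lemma admissible_density_for_spirals:
  fixes E F D :: "'a set"
  assumes r: "0 < r" and E: "\<And>q. q \<in> E \<Longrightarrow> \<exists>s\<in>{0..exp (2 * L)}. q = x - r *\<^sub>R spiral e0 e1 \<epsilon> s"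
    and F: "\<And>q. q \<in> F \<Longrightarrow> \<exists>s\<ge>1. q = x + r *\<^sub>R spiral e0 e1 \<epsilon> s"
    and \<theta>: "0 < \<theta>" "\<theta> < 1" and L_large: "2 \<le> exp L" "1 + 1 / b < exp L"
  obtains \<rho> where "admissible (joining_curves E F D) \<rho>"
    "(\<integral>\<^sup>+q. \<rho> q ^ DIM('a) \<partial>lborel) \<le>
      ennreal (cap_constant TYPE('a) * (2 * half_energy DIM('a) b L + transition_energy DIM('a) b k \<delta> \<theta>))"
proof (rule that)
  show "admissible (joining_curves E F D) (\<lambda>q. ennreal (potential_slope ((q - x) /\<^sub>R r) / r))"
  proof (rule admissible_rescaled[OF r])
    show "potential ((q - x) /\<^sub>R r) = 1" if "q \<in> E" for q
      using E[OF that] potential_on_spirals(1) r by auto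
    show "potential ((q - x) /\<^sub>R r) = 0" if "q \<in> F" for q
      using F[OF that] potential_on_spirals(2) r by auto
  qed
  show "(\<integral>\<^sup>+q. ennreal (potential_slope ((q - x) /\<^sub>R r) / r) ^ DIM('a) \<partial>lborel) \<le>
      ennreal (cap_constant TYPE('a) * (2 * half_energy DIM('a) b L + transition_energy DIM('a) b k \<delta> \<theta>))"
    unfolding nn_integral_rescaled_power[OF potential_slope_measurable potential_slope_nonneg r]
    by (rule energy_le[OF \<theta> L_large])
qed

end

lemma lambda_mod_le_energy:
  fixes x y p :: "real ^ 'n" and L k \<delta> \<theta> :: real
  defines "b \<equiv> pi / (2 * L)"
  assumes n: "2 \<le> CARD('n)" and D: "open D" "x \<in> D" "y \<in> D" "p \<notin> D"
    and ratio: "x \<noteq> y" "dist x p = exp (2 * L) * dist x y"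
    and large: "0 < L" "b \<le> 1" "2 \<le> exp L" "1 + 1 / b < exp L" and k: "0 < k" "k \<le> L" and \<delta>: "0 < \<delta>"
      and \<theta>: "0 < \<theta>" "\<theta> < 1"
    and osc: "\<And>t t'. t \<in> {-1..1} \<Longrightarrow> t' \<in> {-1..1} \<Longrightarrow> \<bar>t - t'\<bar> \<le> (1 + exp k) / (2 * exp L) \<Longrightarrow>
      \<bar>ring_potential CARD('n) t - ring_potential CARD('n) t'\<bar> < \<delta>"
  shows "lambda_mod D x y \<le> ennreal (cap_constant TYPE(real ^ 'n) *
    (2 * half_energy CARD('n) b L + transition_energy CARD('n) b k \<delta> \<theta>))"
proof -
  define r where "r = dist x y"
  define e0 where "e0 = (y - x) /\<^sub>R r"
  define u where "u = (x - p) /\<^sub>R (exp (2 * L) * r)"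
  have r: "0 < r" using ratio by (simp add: r_def)
  have unit: "norm e0 = 1" "norm u = 1"
    using r ratio unfolding e0_def u_def norm_scaleR
    by (simp_all add: r_def dist_norm norm_minus_commute field_simps)
  obtain e1 \<epsilon> where e1: "norm e1 = 1" "e0 \<bullet> e1 = 0" "\<bar>\<epsilon>\<bar> \<le> b" "great_circle e0 e1 (\<epsilon> * (2 * L)) = u"
    using great_circle_through[OF _ unit, of "2 * L"] n large(1) by (auto simp: b_def)
  note frame = unit(1) e1(1,2)
  interpret glued_potential e0 e1 \<epsilon> b L k \<delta>
    using frame n large k \<delta> e1(3) osc by unfold_locales (auto simp: b_def)
  have y: "x + r *\<^sub>R e0 = y" using r by (simp add: e0_def)
  have "x - r *\<^sub>R spiral e0 e1 \<epsilon> (exp (2 * L)) = p"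
    using r by (simp add: spiral_def e1(4)) (simp add: u_def field_simps)
  then obtain Cx where Cx: "Cx \<in> curves_to_boundary D x"
      "\<And>q. q \<in> Cx \<Longrightarrow> \<exists>s\<in>{0..exp (2 * L)}. q = x - r *\<^sub>R spiral e0 e1 \<epsilon> s"
    using inner_spiral_to_boundary[OF frame D(1,2), of r \<epsilon> "exp (2 * L)"] D(4) by auto
  obtain Cy where Cy: "Cy \<in> curves_to_boundary D y" "\<And>q. q \<in> Cy \<Longrightarrow> \<exists>s\<ge>1. q = x + r *\<^sub>R spiral e0 e1 \<epsilon> s"
    using outer_spiral_to_boundary[OF frame r D(1), of x \<epsilon>] D(3) unfolding y by blast
  obtain \<rho> where "admissible (joining_curves Cx Cy D) \<rho>"
    "(\<integral>\<^sup>+q. \<rho> q ^ CARD('n) \<partial>lborel) \<le> ennreal (cap_constant TYPE(real ^ 'n) *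
      (2 * half_energy CARD('n) b L + transition_energy CARD('n) b k \<delta> \<theta>))"
    using admissible_density_for_spirals[OF r Cx(2) Cy(2) \<theta> large(3,4), where D = D] by auto
  then have "modulus (joining_curves Cx Cy D) \<le> ennreal (cap_constant TYPE(real ^ 'n) *
      (2 * half_energy CARD('n) b L + transition_energy CARD('n) b k \<delta> \<theta>))"
    unfolding modulus_def by (intro INF_lower2[of \<rho>]) auto
  moreover have "lambda_mod D x y \<le> modulus (joining_curves Cx Cy D)"
    unfolding lambda_mod_def using Cx(1) Cy(1) by (intro INF_lower2[of "(Cx, Cy)"]) auto
  ultimately show ?thesis by (rule order_trans[rotated])
qed

lemma twist_bound_powr:
  assumes "0 \<le> b"
  shows "twist_bound n b = (1 + 2 * b) powr (real n / 2)"
  using assms by (simp add: twist_bound_def powr_half_sqrt[symmetric] powr_realpow[symmetric] powr_powr)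

lemma half_energy_asymptotics:
  assumes "0 < n"
  shows "((\<lambda>L. 2 * half_energy n (pi / (2 * L)) L - 2 * L) \<longlongrightarrow> ln 16) at_top"
proof -
  define a where "a = real n / 2"
  have "0 < a" using assms by (simp add: a_def)
  then have "((\<lambda>L. 2 * ((1 + 2 * (pi / (2 * L))\<^sup>2) powr a * ln (4 * exp L + 2) +
      ((1 + 2 * (pi / (2 * L))) powr a - (1 + 2 * (pi / (2 * L))\<^sup>2) powr a) * ln (4 * (1 + 1 / (pi / (2 * L))) + 2))
      - 2 * L) \<longlongrightarrow> 2 * ln 4) at_top"
    by real_asymp
  also have "2 * ln 4 = ln (16 :: real)" using ln_realpow[of "4::real" 2] by simp
  finally show ?thesis
  proof (rule Lim_transform_eventually)
    show "\<forall>\<^sub>F L in at_top. 2 * ((1 + 2 * (pi / (2 * L))\<^sup>2) powr a * ln (4 * exp L + 2) +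
      ((1 + 2 * (pi / (2 * L))) powr a - (1 + 2 * (pi / (2 * L))\<^sup>2) powr a) * ln (4 * (1 + 1 / (pi / (2 * L))) + 2))
      - 2 * L = 2 * half_energy n (pi / (2 * L)) L - 2 * L"
      using eventually_gt_at_top[of 0]
      by eventually_elim (simp add: half_energy_def twist_bound_powr a_def)
  qed
qed

lemma transition_energy_limit:
  assumes "\<theta> < 1"
  shows "((\<lambda>L. transition_energy n (pi / (2 * L)) k \<delta> \<theta>) \<longlongrightarrow> transition_energy n 0 k \<delta> \<theta>) at_top"
proof -
  have "((\<lambda>L. (pi / (2 * L))\<^sup>2) \<longlongrightarrow> 0) at_top" by real_asymp
  then have "((\<lambda>L. twist_bound n ((pi / (2 * L))\<^sup>2)) \<longlongrightarrow> twist_bound n 0) at_top"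
    unfolding twist_bound_def by (intro tendsto_intros)
  then show ?thesis unfolding transition_energy_def using assms by (auto intro!: tendsto_intros)
qed

lemma transition_energy_small:
  assumes n: "2 \<le> n"
  obtains \<theta> \<delta> :: real where "0 < \<theta>" "\<theta> < 1" "0 < \<delta>" "transition_energy n 0 (1/4) \<delta> \<theta> < 1/2"
proof -
  have "((\<lambda>\<theta>::real. 1/4 * (1 / (1 - \<theta>) ^ (n - 1) * (3/2))) \<longlongrightarrow> 1/4 * (1 / (1 - 0) ^ (n - 1) * (3/2))) (at_right 0)"
    by (intro tendsto_intros) auto
  then have "\<forall>\<^sub>F \<theta> in at_right (0::real). 1/4 * (1 / (1 - \<theta>) ^ (n - 1) * (3/2)) < 1/2"
    by (rule order_tendstoD) simp
  with eventually_at_right_real[of 0 1]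
  have "\<forall>\<^sub>F \<theta> in at_right (0::real). \<theta> \<in> {0<..<1} \<and> 1/4 * (1 / (1 - \<theta>) ^ (n - 1) * (3/2)) < 1/2"
    by (simp add: eventually_conj_iff)
  from eventually_happens'[OF _ this]
  obtain \<theta> :: real where \<theta>: "0 < \<theta>" "\<theta> < 1" "1/4 * (1 / (1 - \<theta>) ^ (n - 1) * (3/2)) < 1/2" by auto
  have "((\<lambda>\<delta>. transition_energy n 0 (1/4) \<delta> \<theta>) \<longlongrightarrow> transition_energy n 0 (1/4) 0 \<theta>) (at_right 0)"
    unfolding transition_energy_def using \<theta> by (intro tendsto_intros) auto
  moreover have "transition_energy n 0 (1/4) 0 \<theta> < 1/2"
    using \<theta>(3) n by (simp add: transition_energy_def twist_bound_def power_0_left)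
  ultimately have "\<forall>\<^sub>F \<delta> in at_right 0. transition_energy n 0 (1/4) \<delta> \<theta> < 1/2" by (rule order_tendstoD)
  with eventually_at_right_real[of 0 1]
  have "\<forall>\<^sub>F \<delta> in at_right (0::real). \<delta> \<in> {0<..<1} \<and> transition_energy n 0 (1/4) \<delta> \<theta> < 1/2"
    by (simp add: eventually_conj_iff)
  from eventually_happens'[OF _ this]
  obtain \<delta> :: real where "0 < \<delta>" "transition_energy n 0 (1/4) \<delta> \<theta> < 1/2" by auto
  with \<theta>(1,2) show thesis by (rule that)
qed

lemma half_less_ln_31_16: "1/2 < ln (31/16 :: real)"
proof -
  have "exp (1/2) \<le> 1 + 1/2 + (1/2 :: real)\<^sup>2" by (rule exp_bound) auto
  then have "exp (1/2) < (31/16 :: real)" by (simp add: power2_eq_square)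
  then have "ln (exp (1/2)) < ln (31/16 :: real)" by (subst ln_less_cancel_iff) auto
  then show ?thesis by simp
qed

lemma eventually_energy_le_log:
  assumes n: "2 \<le> n" and \<theta>: "\<theta> < 1" and small: "transition_energy n 0 k \<delta> \<theta> < 1/2"
  shows "\<forall>\<^sub>F L in at_top. 2 * half_energy n (pi / (2 * L)) L + transition_energy n (pi / (2 * L)) k \<delta> \<theta> \<le>
      ln (31 * exp (2 * L))"
proof -
  have "((\<lambda>L. 2 * half_energy n (pi / (2 * L)) L - 2 * L + transition_energy n (pi / (2 * L)) k \<delta> \<theta>) \<longlongrightarrow>
      ln 16 + transition_energy n 0 k \<delta> \<theta>) at_top"
    using n \<theta> by (intro tendsto_add half_energy_asymptotics transition_energy_limit) auto
  moreover have "ln 31 = ln 16 + ln (31/16 :: real)" using ln_mult[of 16 "31/16 :: real"] by simp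
  then have "ln 16 + transition_energy n 0 k \<delta> \<theta> < ln 31" using small half_less_ln_31_16 by linarith
  ultimately have "\<forall>\<^sub>F L in at_top. 2 * half_energy n (pi / (2 * L)) L - 2 * L +
      transition_energy n (pi / (2 * L)) k \<delta> \<theta> < ln 31"
    by (rule order_tendstoD)
  then show ?thesis by eventually_elim (simp add: ln_mult)
qed

lemma eventually_admissible_scale:
  assumes "0 < \<omega>"
  shows "\<forall>\<^sub>F L in at_top. 1/4 \<le> L \<and> pi / (2 * L) \<le> 1 \<and> 2 \<le> exp L \<and> 1 + 1 / (pi / (2 * L)) < exp L \<and>
    (1 + exp (1/4)) / (2 * exp L) < \<omega>"
proof -
  have "((\<lambda>L. (1 + exp (1/4)) / (2 * exp L)) \<longlongrightarrow> (0::real)) at_top" by real_asymp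
  from order_tendstoD(2)[OF this assms] show ?thesis
    by (intro eventually_conj) (assumption | real_asymp)+
qed

definition boundary_ratio :: "'a::metric_space set \<Rightarrow> 'a \<Rightarrow> 'a \<Rightarrow> real" where
  "boundary_ratio D x y = infdist x (- D) / dist x y"

lemma infdist_Compl_pos:
  assumes "open D" "D \<noteq> UNIV" "x \<in> D"
  shows "0 < infdist x (- D)"
  using assms by (intro infdist_pos_not_in_closed) auto

lemma lambda_mod_le_log:
  assumes n: "2 \<le> CARD('n)"
  obtains M0 where "16 \<le> M0"
    "\<And>D (x :: real ^ 'n) y. open D \<Longrightarrow> D \<noteq> UNIV \<Longrightarrow> x \<in> D \<Longrightarrow> y \<in> D \<Longrightarrow> x \<noteq> y \<Longrightarrow> M0 \<le> boundary_ratio D x y \<Longrightarrow>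
      lambda_mod D x y \<le> ennreal (cap_constant TYPE(real ^ 'n) * ln (31 * boundary_ratio D x y))"
proof -
  let ?n = "CARD('n)"
  obtain \<theta> \<delta> :: real where \<theta>: "0 < \<theta>" "\<theta> < 1" and \<delta>: "0 < \<delta>" and small: "transition_energy ?n 0 (1/4) \<delta> \<theta> < 1/2"
    using transition_energy_small[OF n] .
  obtain \<omega> where \<omega>: "\<omega> > 0" "\<And>t t'. t \<in> {-1..1} \<Longrightarrow> t' \<in> {-1..1} \<Longrightarrow> \<bar>t - t'\<bar> < \<omega> \<Longrightarrow>
      \<bar>ring_potential ?n t - ring_potential ?n t'\<bar> < \<delta>"
    using ring_potential_small_oscillation[OF n \<delta>] by blast
  let ?large = "\<lambda>L. 1/4 \<le> L \<and> pi / (2 * L) \<le> 1 \<and> 2 \<le> exp L \<and> 1 + 1 / (pi / (2 * L)) < exp L \<and>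
    (1 + exp (1/4)) / (2 * exp L) < \<omega>"
  have "\<forall>\<^sub>F L in at_top. ?large L \<and> 2 * half_energy ?n (pi / (2 * L)) L +
      transition_energy ?n (pi / (2 * L)) (1/4) \<delta> \<theta> \<le> ln (31 * exp (2 * L))"
    by (rule eventually_conj[OF eventually_admissible_scale[OF \<omega>(1)] eventually_energy_le_log[OF n \<theta>(2) small]])
  then obtain L0 where L0: "\<And>L. L0 \<le> L \<Longrightarrow> ?large L"
    "\<And>L. L0 \<le> L \<Longrightarrow> 2 * half_energy ?n (pi / (2 * L)) L + transition_energy ?n (pi / (2 * L)) (1/4) \<delta> \<theta> \<le>
        ln (31 * exp (2 * L))"
    unfolding eventually_at_top_linorder by blast
  show thesis
  proof (rule that[of "max 16 (exp (2 * L0))"])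
    fix D and x y :: "real ^ 'n"
    assume D: "open D" "D \<noteq> UNIV" "x \<in> D" "y \<in> D" and ratio: "x \<noteq> y"
      "max 16 (exp (2 * L0)) \<le> boundary_ratio D x y"
    define L where "L = ln (boundary_ratio D x y) / 2"
    have "0 < boundary_ratio D x y" using ratio(2) by linarith
    then have exp_L: "exp (2 * L) = boundary_ratio D x y" by (simp add: L_def)
    then have "exp (2 * L0) \<le> exp (2 * L)" using ratio(2) by simp
    then have "L0 \<le> L" by simp
    note large = L0[OF this]
    obtain p where p: "p \<in> - D" "infdist x (- D) = dist x p"
      using infdist_attains_inf[of "- D" x] D by (auto simp: closed_Compl)
    have "lambda_mod D x y \<le> ennreal (cap_constant TYPE(real ^ 'n) *
        (2 * half_energy ?n (pi / (2 * L)) L + transition_energy ?n (pi / (2 * L)) (1/4) \<delta> \<theta>))"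
    proof (rule lambda_mod_le_energy[OF n D(1,3,4) _ ratio(1)])
      show "p \<notin> D" "dist x p = exp (2 * L) * dist x y"
        using p ratio(1) by (auto simp: exp_L boundary_ratio_def)
      show "\<bar>ring_potential ?n t - ring_potential ?n t'\<bar> < \<delta>"
        if "t \<in> {-1..1}" "t' \<in> {-1..1}" "\<bar>t - t'\<bar> \<le> (1 + exp (1/4)) / (2 * exp L)" for t t'
        using that large(1) by (intro \<omega>(2)) auto
    qed (use large(1) \<delta> \<theta> in auto)
    also have "\<dots> \<le> ennreal (cap_constant TYPE(real ^ 'n) * ln (31 * boundary_ratio D x y))"
      using large(2) cap_constant_pos[where 'a = "real ^ 'n"] n unfolding exp_L
      by (intro ennreal_leI mult_left_mono) auto
    finally show "lambda_mod D x y \<le> ennreal (cap_constant TYPE(real ^ 'n) * ln (31 * boundary_ratio D x y))" .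
  qed simp
qed

subsection \<open>Distortion of distances\<close>

lemma lambda_mod_ge_log_boundary_ratio:
  fixes D :: "(real ^ 'n) set"
  assumes n: "2 \<le> CARD('n)" and D: "open D" and xy: "x \<noteq> y" "1 < boundary_ratio D x y"
  shows "ennreal (cap_constant TYPE(real ^ 'n) * ln (2 * boundary_ratio D x y - 1)) \<le> lambda_mod D x y"
proof -
  have "ball x (infdist x (- D)) \<subseteq> D"
  proof
    fix q assume "q \<in> ball x (infdist x (- D))"
    then show "q \<in> D" using infdist_le[of q "- D" x] by (cases "q \<in> D") auto
  qed
  moreover have "dist x y < infdist x (- D)" using xy by (simp add: boundary_ratio_def less_divide_eq)
  ultimately show ?thesis using lambda_mod_ge_log[OF n D _ xy(1)] unfolding boundary_ratio_def by blast
qed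

lemma boundary_ratio_le_of_lambda_mod_le:
  fixes D D' :: "(real ^ 'n) set"
  assumes n: "2 \<le> CARD('n)" and D: "open D" and xy: "x \<noteq> y"
    and large: "16 \<le> boundary_ratio D x y" "16 \<le> boundary_ratio D' x' y'"
    and le: "lambda_mod D x y \<le> lambda_mod D' x' y'"
    and upper: "lambda_mod D' x' y' \<le> ennreal (cap_constant TYPE(real ^ 'n) * ln (31 * boundary_ratio D' x' y'))"
  shows "boundary_ratio D x y \<le> 16 * boundary_ratio D' x' y'"
proof -
  let ?c = "cap_constant TYPE(real ^ 'n)"
  let ?q = "boundary_ratio D x y" and ?q' = "boundary_ratio D' x' y'"
  have c: "0 < ?c" using cap_constant_pos[where 'a = "real ^ 'n"] n by simp
  have "ennreal (?c * ln (2 * ?q - 1)) \<le> lambda_mod D x y"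
    using large(1) by (intro lambda_mod_ge_log_boundary_ratio n D xy) auto
  also note le
  also note upper
  finally have "?c * ln (2 * ?q - 1) \<le> ?c * ln (31 * ?q')" using c large(2) by (simp add: ennreal_le_iff)
  then have "ln (2 * ?q - 1) \<le> ln (31 * ?q')" using c by simp
  then have "2 * ?q - 1 \<le> 31 * ?q'" by (subst (asm) ln_le_cancel_iff) (use large in linarith)+
  then show ?thesis using large by linarith
qed

lemma eventually_boundary_ratio_ge:
  assumes D: "open D" "D \<noteq> UNIV" "f x \<in> D" and f: "isCont f x" "\<forall>\<^sub>F y in at x. f y \<noteq> f x"
  shows "\<forall>\<^sub>F y in at x. M \<le> boundary_ratio D (f x) (f y)"
proof -
  have "((\<lambda>y. dist (f x) (f y)) \<longlongrightarrow> 0) (at x)"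
    using f(1) by (auto simp: isCont_def intro!: tendsto_eq_intros)
  moreover have "\<forall>\<^sub>F y in at x. 0 < dist (f x) (f y)" using f(2) by eventually_elim auto
  ultimately have "filterlim (\<lambda>y. boundary_ratio D (f x) (f y)) at_top (at x)"
    unfolding boundary_ratio_def by (intro LIM_at_top_divide[OF tendsto_const] infdist_Compl_pos D)
  then show ?thesis by (simp add: filterlim_at_top)
qed

lemma linear_dilatation_le:
  fixes f :: "'a::real_normed_vector \<Rightarrow> 'b::real_normed_vector"
  assumes "0 < a" "0 \<le> b" and bounds: "\<forall>\<^sub>F y in at x. a * dist x y \<le> dist (f x) (f y) \<and>
      dist (f x) (f y) \<le> b * dist x y"
  shows "linear_dilatation f x \<le> ereal (b / a)"
  unfolding linear_dilatation_def
proof (rule Limsup_bounded)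
  obtain \<delta> where \<delta>: "0 < \<delta>" "\<And>y. y \<noteq> x \<Longrightarrow> dist y x < \<delta> \<Longrightarrow>
      a * dist x y \<le> dist (f x) (f y) \<and> dist (f x) (f y) \<le> b * dist x y"
    using bounds unfolding eventually_at by auto
  have ratio: "norm (f x - f y) / norm (f x - f z) \<le> b / a" if r: "0 < r" "r < \<delta>" "dist x y = r" "dist x z = r"
    for r y z
  proof -
    have "y \<noteq> x" "z \<noteq> x" using r by auto
    then have "dist (f x) (f y) \<le> b * r" "a * r \<le> dist (f x) (f z)"
      using \<delta>(2)[of y] \<delta>(2)[of z] r by (auto simp: dist_commute)
    then have "dist (f x) (f y) / dist (f x) (f z) \<le> (b * r) / (a * r)"
      using assms(1,2) r(1) by (intro frac_le) auto
    then show ?thesis using r(1) by (simp add: dist_norm)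
  qed
  show "\<forall>\<^sub>F r in at_right 0. (SUP (y, z)\<in>sphere x r \<times> sphere x r. ereal (norm (f x - f y) / norm (f x - f z))) \<le>
      ereal (b / a)"
    using eventually_at_right_real[OF \<delta>(1)]
  proof eventually_elim
    case (elim r)
    then show ?case using ratio[of r] by (intro SUP_least) auto
  qed
qed

lemma lambda_mod_isometry_dilatation:
  fixes f :: "real ^ 'n \<Rightarrow> real ^ 'n"
  assumes n: "2 \<le> CARD('n)" and D: "open D" "D \<noteq> UNIV" "open D'" "D' \<noteq> UNIV"
    and f: "continuous_on D f" "inj_on f D" "f ` D \<subseteq> D'" and x: "x \<in> D"
    and isometry: "\<And>y. y \<in> D \<Longrightarrow> x \<noteq> y \<Longrightarrow> lambda_mod D' (f x) (f y) = lambda_mod D x y"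
  shows "linear_dilatation f x \<le> 256"
proof -
  obtain M0 where M0: "16 \<le> M0"
    "\<And>D (x :: real ^ 'n) y. open D \<Longrightarrow> D \<noteq> UNIV \<Longrightarrow> x \<in> D \<Longrightarrow> y \<in> D \<Longrightarrow> x \<noteq> y \<Longrightarrow> M0 \<le> boundary_ratio D x y \<Longrightarrow>
      lambda_mod D x y \<le> ennreal (cap_constant TYPE(real ^ 'n) * ln (31 * boundary_ratio D x y))"
    using lambda_mod_le_log[OF n] by blast
  define c where "c = infdist (f x) (- D') / infdist x (- D)"
  have x': "f x \<in> D'" using f x by auto
  have pos: "0 < infdist x (- D)" "0 < infdist (f x) (- D')" using infdist_Compl_pos D x x' by auto
  then have c: "0 < c" by (simp add: c_def)
  have cont: "isCont f x" using f(1) D(1) x by (simp add: continuous_on_eq_continuous_at)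
  have near: "\<forall>\<^sub>F y in at x. y \<in> D \<and> y \<noteq> x"
    using eventually_at_in_open[OF D(1) x] by (rule eventually_mono) auto
  then have ne: "\<forall>\<^sub>F y in at x. f y \<noteq> f x" by eventually_elim (use f(2) x in \<open>auto dest: inj_onD\<close>)
  have "\<forall>\<^sub>F y in at x. M0 \<le> boundary_ratio D' (f x) (f y)"
    by (rule eventually_boundary_ratio_ge[OF D(3,4) x' cont ne])
  moreover have "\<forall>\<^sub>F y in at x. M0 \<le> boundary_ratio D x y"
    using near by (intro eventually_boundary_ratio_ge[OF D(1,2), of "\<lambda>y. y"]) (auto simp: x elim: eventually_mono)
  ultimately have "\<forall>\<^sub>F y in at x. c / 16 * dist x y \<le> dist (f x) (f y) \<and> dist (f x) (f y) \<le> 16 * c * dist x y"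
    using near ne
  proof eventually_elim
    case (elim y)
    then have points: "y \<in> D" "x \<noteq> y" "f y \<in> D'" "f x \<noteq> f y" "0 < dist x y" "0 < dist (f x) (f y)"
      using f(3) by auto
    have upper: "lambda_mod D x y \<le> ennreal (cap_constant TYPE(real ^ 'n) * ln (31 * boundary_ratio D x y))"
      "lambda_mod D' (f x) (f y) \<le> ennreal (cap_constant TYPE(real ^ 'n) *
          ln (31 * boundary_ratio D' (f x) (f y)))"
      using M0(2) D x x' points elim(1,2) by blast+
    have "16 \<le> boundary_ratio D x y" "16 \<le> boundary_ratio D' (f x) (f y)" using elim(1,2) M0(1) by linarith+
    then have "boundary_ratio D x y \<le> 16 * boundary_ratio D' (f x) (f y)"
      "boundary_ratio D' (f x) (f y) \<le> 16 * boundary_ratio D x y"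
      using boundary_ratio_le_of_lambda_mod_le[OF n] D(1,3) points(2,4) isometry[OF points(1,2)] upper
      by (metis order_refl)+
    then show ?case using pos points(5,6) unfolding boundary_ratio_def c_def by (simp add: field_simps)
  qed
  from linear_dilatation_le[OF _ _ this] c show ?thesis by simp
qed

theorem theorem1p2:
  fixes D D' :: "(real ^ 'n) set" and f :: "real ^ 'n \<Rightarrow> real ^ 'n"
  assumes "2 \<le> CARD('n)"
    and "proper_subdomain D" and "proper_subdomain D'"
    and "\<exists>g. homeomorphism D D' f g"
    and "\<forall>x\<in>D. \<forall>y\<in>D. x \<noteq> y \<longrightarrow> lambda_mod D' (f x) (f y) = lambda_mod D x y"
  shows "quasiconformal D D' f \<and> (\<forall>x\<in>D. linear_dilatation f x \<le> 256)"
proof -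
  have domains: "open D" "D \<noteq> UNIV" "open D'" "D' \<noteq> UNIV"
    using assms(2,3) by (auto simp: proper_subdomain_def)
  obtain g where "homeomorphism D D' f g" using assms(4) by blast
  then have "continuous_on D f" "f ` D \<subseteq> D'" "inj_on f D"
    by (auto simp: homeomorphism_def intro: inj_on_inverseI)
  then have "\<forall>x\<in>D. linear_dilatation f x \<le> ereal 256"
    using lambda_mod_isometry_dilatation[OF assms(1) domains] assms(5) by simp
  then show ?thesis using assms(4) unfolding quasiconformal_def by auto
qed

end
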